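(* The system $\mathsf{RCA}_0^{\omega}+\mathsf{IND}$ proves the implication $\mathsf{SUM}\rightarrow\mathsf{NIN}$. Here $\mathsf{SUM}$ is the statement: "if $(a_x)_{x\in[0,1]}$ is Cauchy and non-negative, then there is a sequence of reals $(y_i)_{i\in\mathbb N}$ in $[0,1]$ such that for all $y\in[0,1]$, $a_y=_{\mathbb R}0$ in case $(\forall i\in\mathbb N)(y\neq_{\mathbb R}y_i)$"; and $\mathsf{NIN}$ is the statement "there is no injection from $[0,1]$ to $\mathbb{N}$".
   Context: Language and base theory. The finite types are generated by: $0$ is a type, and if $\sigma,\tau$ are types then so is $\sigma\to\tau$. Type $0$ is the type of natural numbers, $1:=0\to0$, $n+1:=n\to0$. The language $\mathsf{L}_\omega$ of higher-order arithmetic has variables of all finite types, the constants $0,1,<_0,+_0,\times_0,=_0$ on type $0$, combinators, and recursor constants $\mathbf{R}_\sigma$ for each type $\sigma$; finite sequences of objects of type $0$ or $1$ are available via types $0^*$, $1^*$ (or coding). Equality at type $\tau=(\tau_1\to\dots\to\tau_k\to0)$ is defined by $x=_\tau y\equiv(\forall z_1^{\tau_1}\dots z_k^{\tau_k})(xz_1\dots z_k=_0yz_1\dots z_k)$. The theory $\mathsf{RCA}_0^\omega$ (Kohlenbach's base theory of higher-order Reverse Mathematics, with classical logic) consists of: (a) axioms that $0,1,<_0,+_0,\times_0$ form an ordered semi-ring with equality $=_0$; (b) the defining axioms of the $\Pi$ and $\Sigma$ combinators (i.e. $K$ and $S$), giving $\lambda$-abstraction in all types; (c) the axiom for $\mathbf{R}_0$: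 $\mathbf{R}_0(f,m,0)=m$, $\mathbf{R}_0(f,m,n+1)=f(n,\mathbf{R}_0(f,m,n))$ for $m^0,f^1$ (with pairs of numbers coded); (d) extensionality: $x=_\rho y\to\varphi(x)=_\tau\varphi(y)$ for all $x^\rho,y^\rho,\varphi^{\rho\to\tau}$ and all types $\rho,\tau$; (e) induction for quantifier-free formulas of $\mathsf{L}_\omega$ (with parameters of any type); (f) $\mathsf{QF\text{-}AC}^{1,0}$, where for types $\sigma,\tau$ the schema $\mathsf{QF\text{-}AC}^{\sigma,\tau}$ is $(\forall x^\sigma)(\exists y^\tau)A(x,y)\to(\exists Y^{\sigma\to\tau})(\forall x^\sigma)A(x,Y(x))$ for quantifier-free $A$. $\mathsf{IND}$ is the induction axiom (schema) for all formulas of $\mathsf{L}_\omega$. Reals, functions. Real numbers are coded by sequences of rationals $(q_n)$ with $|q_n-q_{n+i}|<2^{-n}$ for all $n,i$; $x=_{\mathbb R}y$ for reals coded by $(q_n),(r_n)$ means $|q_n-r_n|\le2^{-n+1}$ for all $n$, and $<_{\mathbb R}$ is defined similarly. Functions on $\mathbb{R}$ or $[0,1]$ (with values in $\mathbb R$ or $\mathbb N$) are functionals on codes that map $=_{\mathbb R}$-equal reals to equal values. $\mathsf{NIN}$ is formalised as: for every $Y:[0,1]\to\mathbb{N}$ there are $x,y\in[0,1]$ with $x\neq_{\mathbb R}y$ and $Y(x)=_0Y(y)$. Unordered sums. $(a_x)_{x\in[0,1]}$ denotes a function $a:[0,1]\to\mathbb R$, $a_x:=a(x)$; it is non-negative if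 $a_x\ge0$ for all $x\in[0,1]$. Let $\mathrm{fin}$ denote the collection of finite sequences of reals in $[0,1]$ without repetitions (viewed as finite sets). $(a_x)_{x\in[0,1]}$ is Cauchy if for every $\varepsilon>0$ there is $I\in\mathrm{fin}$ such that for all $J\in\mathrm{fin}$ with $J\cap I=\emptyset$, $|\sum_{x\in J}a_x|<\varepsilon$. *)

theory Defs
  imports Main
begin

section \<open>The language of higher-order arithmetic\<close>

datatype ty = T0 | Fn ty ty (infixr "\<rightarrow>\<^sub>t" 65)

abbreviation T1 :: ty where "T1 \<equiv> T0 \<rightarrow>\<^sub>t T0"

text \<open>The recursor constant for \<open>\<sigma>\<close> has type \<open>(0 \<rightarrow> \<sigma> \<rightarrow> \<sigma>) \<rightarrow> \<sigma> \<rightarrow> 0 \<rightarrow> \<sigma>\<close>, i.e. its step function takes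
  its two arguments one after the other. Only the recursor for type \<open>0\<close> is governed by axioms.\<close>

datatype const =
    Zero | One | Plus | Times
  | CK ty ty          \<comment> \<open>the combinator \<open>\<Pi>\<close>\<close>
  | CS ty ty ty       \<comment> \<open>the combinator \<open>\<Sigma>\<close>\<close>
  | CR ty

primrec cty :: "const \<Rightarrow> ty" where
  "cty Zero = T0"
| "cty One = T0"
| "cty Plus = T0 \<rightarrow>\<^sub>t T0 \<rightarrow>\<^sub>t T0"
| "cty Times = T0 \<rightarrow>\<^sub>t T0 \<rightarrow>\<^sub>t T0"
| "cty (CK \<sigma> \<tau>) = \<sigma> \<rightarrow>\<^sub>t \<tau> \<rightarrow>\<^sub>t \<sigma>"
| "cty (CS \<rho> \<sigma> \<tau>) = (\<rho> \<rightarrow>\<^sub>t \<sigma> \<rightarrow>\<^sub>t \<tau>) \<rightarrow>\<^sub>t (\<rho> \<rightarrow>\<^sub>t \<sigma>) \<rightarrow>\<^sub>t \<rho> \<rightarrow>\<^sub>t \<tau>"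
| "cty (CR \<sigma>) = (T0 \<rightarrow>\<^sub>t \<sigma> \<rightarrow>\<^sub>t \<sigma>) \<rightarrow>\<^sub>t \<sigma> \<rightarrow>\<^sub>t T0 \<rightarrow>\<^sub>t \<sigma>"

text \<open>Variables are de Bruijn indices that are counted separately for each type: the quantifier
  \<open>Forall \<sigma>\<close> binds \<open>Var \<sigma> 0\<close>, and inside its scope \<open>Var \<sigma> (n + 1)\<close> denotes what \<open>Var \<sigma> n\<close> denotes
  outside, while the variables of all other types keep their meaning. Hence every variable
  carries its type and no typing contexts are needed.\<close>

datatype tm = Var ty nat | Con const | App tm tm (infixl "\<cdot>" 90)

datatype fm =
    Bot ("\<bottom>\<^sub>f")
  | Eq tm tm (infix "=\<^sub>N" 55)
  | Less tm tm (infix "<\<^sub>N" 55)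
  | Imp fm fm (infixr "\<longrightarrow>\<^sub>f" 40)
  | Forall ty fm

abbreviation Neg :: "fm \<Rightarrow> fm" ("\<not>\<^sub>f _" [50] 50) where "\<not>\<^sub>f A \<equiv> A \<longrightarrow>\<^sub>f \<bottom>\<^sub>f"
abbreviation Or :: "fm \<Rightarrow> fm \<Rightarrow> fm" (infixr "\<or>\<^sub>f" 43) where "A \<or>\<^sub>f B \<equiv> \<not>\<^sub>f A \<longrightarrow>\<^sub>f B"
abbreviation And :: "fm \<Rightarrow> fm \<Rightarrow> fm" (infixr "\<and>\<^sub>f" 45) where "A \<and>\<^sub>f B \<equiv> \<not>\<^sub>f (A \<longrightarrow>\<^sub>f \<not>\<^sub>f B)"
abbreviation Exists :: "ty \<Rightarrow> fm \<Rightarrow> fm" where "Exists \<sigma> A \<equiv> \<not>\<^sub>f Forall \<sigma> (\<not>\<^sub>f A)"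

abbreviation num0 :: tm ("0\<^sub>N") where "0\<^sub>N \<equiv> Con Zero"
abbreviation num1 :: tm ("1\<^sub>N") where "1\<^sub>N \<equiv> Con One"
abbreviation nplus :: "tm \<Rightarrow> tm \<Rightarrow> tm" (infixl "+\<^sub>N" 65) where "s +\<^sub>N t \<equiv> Con Plus \<cdot> s \<cdot> t"
abbreviation ntimes :: "tm \<Rightarrow> tm \<Rightarrow> tm" (infixl "*\<^sub>N" 70) where "s *\<^sub>N t \<equiv> Con Times \<cdot> s \<cdot> t"

primrec cod :: "ty \<Rightarrow> ty" where
  "cod T0 = T0"
| "cod (\<sigma> \<rightarrow>\<^sub>t \<tau>) = \<tau>"

text \<open>The type of a term; meaningful for well-typed terms only.\<close>

primrec tyof :: "tm \<Rightarrow> ty" where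
  "tyof (Var \<sigma> n) = \<sigma>"
| "tyof (Con c) = cty c"
| "tyof (s \<cdot> t) = cod (tyof s)"

primrec wt :: "tm \<Rightarrow> bool" where
  "wt (Var \<sigma> n) \<longleftrightarrow> True"
| "wt (Con c) \<longleftrightarrow> True"
| "wt (s \<cdot> t) \<longleftrightarrow> wt s \<and> wt t \<and> tyof s = tyof t \<rightarrow>\<^sub>t cod (tyof s)"

primrec wff :: "fm \<Rightarrow> bool" where
  "wff \<bottom>\<^sub>f \<longleftrightarrow> True"
| "wff (s =\<^sub>N t) \<longleftrightarrow> wt s \<and> wt t \<and> tyof s = T0 \<and> tyof t = T0"
| "wff (s <\<^sub>N t) \<longleftrightarrow> wt s \<and> wt t \<and> tyof s = T0 \<and> tyof t = T0"
| "wff (A \<longrightarrow>\<^sub>f B) \<longleftrightarrow> wff A \<and> wff B"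
| "wff (Forall \<sigma> A) \<longleftrightarrow> wff A"

primrec qfree :: "fm \<Rightarrow> bool" where
  "qfree \<bottom>\<^sub>f \<longleftrightarrow> True"
| "qfree (s =\<^sub>N t) \<longleftrightarrow> True"
| "qfree (s <\<^sub>N t) \<longleftrightarrow> True"
| "qfree (A \<longrightarrow>\<^sub>f B) \<longleftrightarrow> qfree A \<and> qfree B"
| "qfree (Forall \<sigma> A) \<longleftrightarrow> False"


section \<open>Substitution\<close>

type_synonym sub = "ty \<Rightarrow> nat \<Rightarrow> tm"

primrec tsubst :: "sub \<Rightarrow> tm \<Rightarrow> tm" where
  "tsubst s (Var \<sigma> n) = s \<sigma> n"
| "tsubst s (Con c) = Con c"
| "tsubst s (t \<cdot> u) = tsubst s t \<cdot> tsubst s u"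

definition shiftv :: "ty \<Rightarrow> sub" where
  "shiftv \<sigma> = (\<lambda>\<tau> n. if \<tau> = \<sigma> then Var \<tau> (Suc n) else Var \<tau> n)"

abbreviation lift :: "ty \<Rightarrow> tm \<Rightarrow> tm" where "lift \<sigma> \<equiv> tsubst (shiftv \<sigma>)"

definition upv :: "ty \<Rightarrow> sub \<Rightarrow> sub" where
  "upv \<sigma> s = (\<lambda>\<tau> n. if \<tau> = \<sigma> then (case n of 0 \<Rightarrow> Var \<sigma> 0 | Suc m \<Rightarrow> lift \<sigma> (s \<sigma> m))
                   else lift \<sigma> (s \<tau> n))"

primrec fsubst :: "sub \<Rightarrow> fm \<Rightarrow> fm" where
  "fsubst s \<bottom>\<^sub>f = \<bottom>\<^sub>f"
| "fsubst s (t =\<^sub>N u) = (tsubst s t =\<^sub>N tsubst s u)"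
| "fsubst s (t <\<^sub>N u) = (tsubst s t <\<^sub>N tsubst s u)"
| "fsubst s (A \<longrightarrow>\<^sub>f B) = (fsubst s A \<longrightarrow>\<^sub>f fsubst s B)"
| "fsubst s (Forall \<sigma> A) = Forall \<sigma> (fsubst (upv \<sigma> s) A)"

abbreviation flift :: "ty \<Rightarrow> fm \<Rightarrow> fm" where "flift \<sigma> \<equiv> fsubst (shiftv \<sigma>)"

text \<open>If \<open>A\<close> is the body of a quantifier over \<open>\<sigma>\<close>, then \<open>inst \<sigma> t A\<close> is its instance at \<open>t\<close>.\<close>

definition inst :: "ty \<Rightarrow> tm \<Rightarrow> fm \<Rightarrow> fm" where
  "inst \<sigma> t = fsubst (\<lambda>\<tau> n. if \<tau> = \<sigma> then (case n of 0 \<Rightarrow> t | Suc m \<Rightarrow> Var \<sigma> m) else Var \<tau> n)"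


section \<open>Derivability\<close>

text \<open>Natural deduction for classical many-sorted logic from a set \<open>Ax\<close> of non-logical axioms and
  a list \<open>H\<close> of open assumptions. The eigenvariable condition of \<open>allI\<close> concerns only \<open>H\<close>, so the
  axioms count as universally closed. Equality is not a logical symbol; its axioms are part of
  the theory below.\<close>

inductive prv :: "fm set \<Rightarrow> fm list \<Rightarrow> fm \<Rightarrow> bool" for Ax :: "fm set" where
  ax: "A \<in> Ax \<Longrightarrow> wff A \<Longrightarrow> prv Ax H A"
| hyp: "A \<in> set H \<Longrightarrow> wff A \<Longrightarrow> prv Ax H A"
| impI: "wff A \<Longrightarrow> prv Ax (A # H) B \<Longrightarrow> prv Ax H (A \<longrightarrow>\<^sub>f B)"
| impE: "prv Ax H (A \<longrightarrow>\<^sub>f B) \<Longrightarrow> prv Ax H A \<Longrightarrow> prv Ax H B"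
| raa: "wff A \<Longrightarrow> prv Ax ((\<not>\<^sub>f A) # H) \<bottom>\<^sub>f \<Longrightarrow> prv Ax H A"
| allI: "prv Ax (map (flift \<sigma>) H) A \<Longrightarrow> prv Ax H (Forall \<sigma> A)"
| allE: "prv Ax H (Forall \<sigma> A) \<Longrightarrow> wt t \<Longrightarrow> tyof t = \<sigma> \<Longrightarrow> prv Ax H (inst \<sigma> t A)"

abbreviation provable :: "fm set \<Rightarrow> fm \<Rightarrow> bool" (infix "\<turnstile>" 30) where
  "T \<turnstile> A \<equiv> prv T [] A"


section \<open>The theory\<close>

primrec eqT :: "ty \<Rightarrow> tm \<Rightarrow> tm \<Rightarrow> fm" where
  "eqT T0 s t = (s =\<^sub>N t)"
| "eqT (\<sigma> \<rightarrow>\<^sub>t \<tau>) s t = Forall \<sigma> (eqT \<tau> (lift \<sigma> s \<cdot> Var \<sigma> 0) (lift \<sigma> t \<cdot> Var \<sigma> 0))"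

text \<open>Discreteness of the order and \<open>0 \<le> x\<close> follow from quantifier-free induction.\<close>

definition semiring_axioms :: "fm set" where
  "semiring_axioms =
    (let x = Var T0 0; y = Var T0 1; z = Var T0 2 in
     {x =\<^sub>N x,
      x =\<^sub>N y \<longrightarrow>\<^sub>f y =\<^sub>N x,
      x =\<^sub>N y \<longrightarrow>\<^sub>f y =\<^sub>N z \<longrightarrow>\<^sub>f x =\<^sub>N z,
      x =\<^sub>N y \<longrightarrow>\<^sub>f x <\<^sub>N z \<longrightarrow>\<^sub>f y <\<^sub>N z,
      x =\<^sub>N y \<longrightarrow>\<^sub>f z <\<^sub>N x \<longrightarrow>\<^sub>f z <\<^sub>N y,
      (x +\<^sub>N y) +\<^sub>N z =\<^sub>N x +\<^sub>N (y +\<^sub>N z),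
      x +\<^sub>N y =\<^sub>N y +\<^sub>N x,
      x +\<^sub>N 0\<^sub>N =\<^sub>N x,
      (x *\<^sub>N y) *\<^sub>N z =\<^sub>N x *\<^sub>N (y *\<^sub>N z),
      x *\<^sub>N y =\<^sub>N y *\<^sub>N x,
      x *\<^sub>N 1\<^sub>N =\<^sub>N x,
      x *\<^sub>N 0\<^sub>N =\<^sub>N 0\<^sub>N,
      x *\<^sub>N (y +\<^sub>N z) =\<^sub>N x *\<^sub>N y +\<^sub>N x *\<^sub>N z,
      \<not>\<^sub>f x <\<^sub>N x,
      x <\<^sub>N y \<longrightarrow>\<^sub>f y <\<^sub>N z \<longrightarrow>\<^sub>f x <\<^sub>N z,
      x <\<^sub>N y \<or>\<^sub>f x =\<^sub>N y \<or>\<^sub>f y <\<^sub>N x,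
      0\<^sub>N <\<^sub>N 1\<^sub>N,
      x <\<^sub>N y \<longrightarrow>\<^sub>f x +\<^sub>N z <\<^sub>N y +\<^sub>N z,
      0\<^sub>N <\<^sub>N z \<longrightarrow>\<^sub>f x <\<^sub>N y \<longrightarrow>\<^sub>f x *\<^sub>N z <\<^sub>N y *\<^sub>N z})"

definition K_axiom :: "ty \<Rightarrow> ty \<Rightarrow> fm" where
  "K_axiom \<sigma> \<tau> = (let x = Var \<sigma> 0; y = Var \<tau> 1 in eqT \<sigma> (Con (CK \<sigma> \<tau>) \<cdot> x \<cdot> y) x)"

definition S_axiom :: "ty \<Rightarrow> ty \<Rightarrow> ty \<Rightarrow> fm" where
  "S_axiom \<rho> \<sigma> \<tau> =
    (let x = Var (\<rho> \<rightarrow>\<^sub>t \<sigma> \<rightarrow>\<^sub>t \<tau>) 0; y = Var (\<rho> \<rightarrow>\<^sub>t \<sigma>) 1; z = Var \<rho> 2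
     in eqT \<tau> (Con (CS \<rho> \<sigma> \<tau>) \<cdot> x \<cdot> y \<cdot> z) (x \<cdot> z \<cdot> (y \<cdot> z)))"

definition R_axioms :: "fm set" where
  "R_axioms =
    (let R = Con (CR T0); f = Var (T0 \<rightarrow>\<^sub>t T0 \<rightarrow>\<^sub>t T0) 0; m = Var T0 0; n = Var T0 1 in
     {R \<cdot> f \<cdot> m \<cdot> 0\<^sub>N =\<^sub>N m,
      R \<cdot> f \<cdot> m \<cdot> (n +\<^sub>N 1\<^sub>N) =\<^sub>N f \<cdot> n \<cdot> (R \<cdot> f \<cdot> m \<cdot> n)})"

definition ext_axiom :: "ty \<Rightarrow> ty \<Rightarrow> fm" where
  "ext_axiom \<rho> \<tau> =
    (let x = Var \<rho> 0; y = Var \<rho> 1; \<phi> = Var (\<rho> \<rightarrow>\<^sub>t \<tau>) 0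
     in eqT \<rho> x y \<longrightarrow>\<^sub>f eqT \<tau> (\<phi> \<cdot> x) (\<phi> \<cdot> y))"

text \<open>Induction for \<open>A\<close> with induction variable \<open>Var T0 0\<close>.\<close>

definition ind_ax :: "fm \<Rightarrow> fm" where
  "ind_ax A =
    (inst T0 0\<^sub>N A \<longrightarrow>\<^sub>f
     Forall T0 (A \<longrightarrow>\<^sub>f fsubst (\<lambda>\<tau> n. if \<tau> = T0 \<and> n = 0 then Var T0 0 +\<^sub>N 1\<^sub>N else Var \<tau> n) A) \<longrightarrow>\<^sub>f
     Forall T0 A)"

text \<open>In the premise, \<open>A\<close> lives in the scope of \<open>x\<^sup>\<sigma>\<close> and \<open>y\<^sup>\<tau>\<close>. In the conclusion it is first weakened
  by the choice_ax functional \<open>Y\<close>, quantified outside of \<open>x\<close>, and then instantiated at \<open>y = Y x\<close>.\<close>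

definition choice_ax :: "ty \<Rightarrow> ty \<Rightarrow> fm \<Rightarrow> fm" where
  "choice_ax \<sigma> \<tau> A =
    (Forall \<sigma> (Exists \<tau> A) \<longrightarrow>\<^sub>f
     Exists (\<sigma> \<rightarrow>\<^sub>t \<tau>) (Forall \<sigma>
       (inst \<tau> (Var (\<sigma> \<rightarrow>\<^sub>t \<tau>) 0 \<cdot> Var \<sigma> 0) (fsubst (upv \<tau> (upv \<sigma> (shiftv (\<sigma> \<rightarrow>\<^sub>t \<tau>)))) A))))"

definition QF_AC :: "ty \<Rightarrow> ty \<Rightarrow> fm set" where
  "QF_AC \<sigma> \<tau> = {choice_ax \<sigma> \<tau> A | A. wff A \<and> qfree A}"

definition RCA0\<omega> :: "fm set" where
  "RCA0\<omega> =
     semiring_axioms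
     \<union> {K_axiom \<sigma> \<tau> | \<sigma> \<tau>. True}
     \<union> {S_axiom \<rho> \<sigma> \<tau> | \<rho> \<sigma> \<tau>. True}
     \<union> R_axioms
     \<union> {ext_axiom \<rho> \<tau> | \<rho> \<tau>. True}
     \<union> {ind_ax A | A. wff A \<and> qfree A}
     \<union> QF_AC T1 T0"

definition IND :: "fm set" where
  "IND = {ind_ax A | A. wff A}"


section \<open>Defined terms of the language\<close>

text \<open>Bracket abstraction: \<open>lam \<sigma> t\<close> is the combinator term for \<open>\<lambda>x\<^sup>\<sigma>. t\<close>, where \<open>x\<close> is \<open>Var \<sigma> 0\<close> in
  \<open>t\<close> (indices behave as under a quantifier over \<open>\<sigma>\<close>). Terms in which \<open>x\<close> does not occur are abstracted
  in one step; otherwise nested abstractions would become very large.\<close>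

primrec occurs0 :: "ty \<Rightarrow> tm \<Rightarrow> bool" where
  "occurs0 \<sigma> (Var \<tau> n) \<longleftrightarrow> \<tau> = \<sigma> \<and> n = 0"
| "occurs0 \<sigma> (Con c) \<longleftrightarrow> False"
| "occurs0 \<sigma> (s \<cdot> t) \<longleftrightarrow> occurs0 \<sigma> s \<or> occurs0 \<sigma> t"

definition constfun :: "ty \<Rightarrow> tm \<Rightarrow> tm" where
  "constfun \<sigma> t =
    Con (CK (tyof t) \<sigma>) \<cdot> tsubst (\<lambda>\<tau> n. if \<tau> = \<sigma> then Var \<tau> (n - 1) else Var \<tau> n) t"

primrec lam :: "ty \<Rightarrow> tm \<Rightarrow> tm" where
  "lam \<sigma> (Var \<tau> n) =
     (if occurs0 \<sigma> (Var \<tau> n)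
      then Con (CS \<sigma> (\<sigma> \<rightarrow>\<^sub>t \<sigma>) \<sigma>) \<cdot> Con (CK \<sigma> (\<sigma> \<rightarrow>\<^sub>t \<sigma>)) \<cdot> Con (CK \<sigma> \<sigma>)
      else constfun \<sigma> (Var \<tau> n))"
| "lam \<sigma> (Con c) = constfun \<sigma> (Con c)"
| "lam \<sigma> (s \<cdot> t) =
     (if occurs0 \<sigma> (s \<cdot> t)
      then Con (CS \<sigma> (tyof t) (cod (tyof s))) \<cdot> lam \<sigma> s \<cdot> lam \<sigma> t
      else constfun \<sigma> (s \<cdot> t))"

abbreviation vN :: "nat \<Rightarrow> tm" where "vN n \<equiv> Var T0 n"
abbreviation lam2 :: "tm \<Rightarrow> tm" where "lam2 t \<equiv> lam T0 (lam T0 t)"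

abbreviation recN :: "tm \<Rightarrow> tm \<Rightarrow> tm \<Rightarrow> tm" where
  "recN f m n \<equiv> Con (CR T0) \<cdot> f \<cdot> m \<cdot> n"

definition predC :: tm where
  "predC = lam T0 (recN (lam2 (vN 1)) 0\<^sub>N (vN 0))"

definition monusC :: tm where
  "monusC = lam2 (recN (lam2 (predC \<cdot> vN 0)) (vN 1) (vN 0))"
abbreviation monusN :: "tm \<Rightarrow> tm \<Rightarrow> tm" (infixl "-\<^sub>N" 65) where "s -\<^sub>N t \<equiv> monusC \<cdot> s \<cdot> t"

text \<open>\<open>ifzero n x y\<close> is \<open>x\<close> if \<open>n = 0\<close> and \<open>y\<close> otherwise.\<close>
definition ifzeroC :: tm where
  "ifzeroC = lam2 (lam T0 (recN (lam2 (vN 2)) (vN 1) (vN 2)))"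
abbreviation ifzero :: "tm \<Rightarrow> tm \<Rightarrow> tm \<Rightarrow> tm" where "ifzero n x y \<equiv> ifzeroC \<cdot> n \<cdot> x \<cdot> y"

definition pow2C :: tm where
  "pow2C = lam T0 (recN (lam2 (vN 0 +\<^sub>N vN 0)) 1\<^sub>N (vN 0))"
abbreviation pow2 :: "tm \<Rightarrow> tm" where "pow2 n \<equiv> pow2C \<cdot> n"

text \<open>Pairing is Cantor's bijection \<open>pairN a b = T(a + b) + a\<close>, where \<open>T\<close> enumerates the triangular
  numbers; \<open>rootN p\<close> is the largest \<open>t\<close> with \<open>T(t) \<le> p\<close>.\<close>
definition triC :: tm where
  "triC = lam T0 (recN (lam2 (vN 0 +\<^sub>N (vN 1 +\<^sub>N 1\<^sub>N))) 0\<^sub>N (vN 0))"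
abbreviation triN :: "tm \<Rightarrow> tm" where "triN n \<equiv> triC \<cdot> n"

definition rootC :: tm where
  "rootC = lam T0 (recN (lam2 (ifzero (triN (vN 0 +\<^sub>N 1\<^sub>N) -\<^sub>N (vN 1 +\<^sub>N 1\<^sub>N)) (vN 0 +\<^sub>N 1\<^sub>N) (vN 0))) 0\<^sub>N (vN 0))"
abbreviation rootN :: "tm \<Rightarrow> tm" where "rootN p \<equiv> rootC \<cdot> p"

definition pairC :: tm where
  "pairC = lam2 (triN (vN 1 +\<^sub>N vN 0) +\<^sub>N vN 1)"
abbreviation pairN :: "tm \<Rightarrow> tm \<Rightarrow> tm" where "pairN a b \<equiv> pairC \<cdot> a \<cdot> b"

definition proj1C :: tm where
  "proj1C = lam T0 (vN 0 -\<^sub>N triN (rootN (vN 0)))"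
abbreviation proj1 :: "tm \<Rightarrow> tm" where "proj1 p \<equiv> proj1C \<cdot> p"

definition proj2C :: tm where
  "proj2C = lam T0 (rootN (vN 0) -\<^sub>N proj1 (vN 0))"
abbreviation proj2 :: "tm \<Rightarrow> tm" where "proj2 p \<equiv> proj2C \<cdot> p"


section \<open>Rational numbers\<close>

text \<open>Every number is a code: \<open>pairN (pairN a b) d\<close> codes the rational number \<open>(a - b) / (d + 1)\<close>.\<close>

definition qmkC :: tm where
  "qmkC = lam2 (lam T0 (pairN (pairN (vN 2) (vN 1)) (vN 0)))"
abbreviation qmk :: "tm \<Rightarrow> tm \<Rightarrow> tm \<Rightarrow> tm" where "qmk a b d \<equiv> qmkC \<cdot> a \<cdot> b \<cdot> d"

abbreviation qpos :: "tm \<Rightarrow> tm" where "qpos q \<equiv> proj1 (proj1 q)"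
abbreviation qneg :: "tm \<Rightarrow> tm" where "qneg q \<equiv> proj2 (proj1 q)"
abbreviation qden :: "tm \<Rightarrow> tm" where "qden q \<equiv> proj2 q +\<^sub>N 1\<^sub>N"

definition qaddC :: tm where
  "qaddC =
    (let q = vN 1; r = vN 0 in
     lam2 (qmk (qpos q *\<^sub>N qden r +\<^sub>N qpos r *\<^sub>N qden q)
               (qneg q *\<^sub>N qden r +\<^sub>N qneg r *\<^sub>N qden q)
               (qden q *\<^sub>N qden r -\<^sub>N 1\<^sub>N)))"
abbreviation qadd :: "tm \<Rightarrow> tm \<Rightarrow> tm" (infixl "+\<^sub>Q" 65) where "q +\<^sub>Q r \<equiv> qaddC \<cdot> q \<cdot> r"

definition qnegC :: tm where
  "qnegC = lam T0 (qmk (qneg (vN 0)) (qpos (vN 0)) (proj2 (vN 0)))"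
abbreviation qminus :: "tm \<Rightarrow> tm \<Rightarrow> tm" (infixl "-\<^sub>Q" 65) where "q -\<^sub>Q r \<equiv> q +\<^sub>Q qnegC \<cdot> r"

definition qabsC :: tm where
  "qabsC =
    (let q = vN 0 in
     lam T0 (qmk ((qpos q -\<^sub>N qneg q) +\<^sub>N (qneg q -\<^sub>N qpos q)) 0\<^sub>N (proj2 q)))"
abbreviation qabs :: "tm \<Rightarrow> tm" where "qabs q \<equiv> qabsC \<cdot> q"

definition qless :: "tm \<Rightarrow> tm \<Rightarrow> fm" (infix "<\<^sub>Q" 55) where
  "q <\<^sub>Q r =
    (qpos q *\<^sub>N qden r +\<^sub>N qneg r *\<^sub>N qden q <\<^sub>N qpos r *\<^sub>N qden q +\<^sub>N qneg q *\<^sub>N qden r)"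
abbreviation qle :: "tm \<Rightarrow> tm \<Rightarrow> fm" (infix "\<le>\<^sub>Q" 55) where "q \<le>\<^sub>Q r \<equiv> \<not>\<^sub>f r <\<^sub>Q q"

abbreviation qzero :: tm ("0\<^sub>Q") where "0\<^sub>Q \<equiv> qmk 0\<^sub>N 0\<^sub>N 0\<^sub>N"
abbreviation qone :: tm ("1\<^sub>Q") where "1\<^sub>Q \<equiv> qmk 1\<^sub>N 0\<^sub>N 0\<^sub>N"

text \<open>\<open>qeps n\<close> is \<open>2\<^sup>-\<^sup>n\<close> and \<open>qeps2 n\<close> is \<open>2\<^sup>-\<^sup>n\<^sup>+\<^sup>1\<close>.\<close>
abbreviation qeps :: "tm \<Rightarrow> tm" where "qeps n \<equiv> qmk 1\<^sub>N 0\<^sub>N (pow2 n -\<^sub>N 1\<^sub>N)"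
abbreviation qeps2 :: "tm \<Rightarrow> tm" where "qeps2 n \<equiv> qmk (1\<^sub>N +\<^sub>N 1\<^sub>N) 0\<^sub>N (pow2 n -\<^sub>N 1\<^sub>N)"


section \<open>Real numbers\<close>

definition is_real :: "tm \<Rightarrow> fm" where
  "is_real x =
    Forall T0 (Forall T0
      (let n = vN 1; i = vN 0; x = lift T0 (lift T0 x)
       in qabs (x \<cdot> n -\<^sub>Q x \<cdot> (n +\<^sub>N i)) <\<^sub>Q qeps n))"

definition eqR :: "tm \<Rightarrow> tm \<Rightarrow> fm" (infix "=\<^sub>R" 55) where
  "x =\<^sub>R y =
    Forall T0 (let n = vN 0; x = lift T0 x; y = lift T0 y in qabs (x \<cdot> n -\<^sub>Q y \<cdot> n) \<le>\<^sub>Q qeps2 n)"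

definition lessR :: "tm \<Rightarrow> tm \<Rightarrow> fm" (infix "<\<^sub>R" 55) where
  "x <\<^sub>R y =
    Exists T0 (let n = vN 0; x = lift T0 x; y = lift T0 y in qeps2 n <\<^sub>Q y \<cdot> n -\<^sub>Q x \<cdot> n)"

abbreviation leR :: "tm \<Rightarrow> tm \<Rightarrow> fm" (infix "\<le>\<^sub>R" 55) where "x \<le>\<^sub>R y \<equiv> \<not>\<^sub>f y <\<^sub>R x"

abbreviation rzero :: tm ("0\<^sub>R") where "0\<^sub>R \<equiv> lam T0 0\<^sub>Q"
abbreviation rone :: tm ("1\<^sub>R") where "1\<^sub>R \<equiv> lam T0 1\<^sub>Q"

definition rabs :: "tm \<Rightarrow> tm" where
  "rabs x = lam T0 (qabs (lift T0 x \<cdot> vN 0))"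

definition in01 :: "tm \<Rightarrow> fm" where
  "in01 x = (is_real x \<and>\<^sub>f 0\<^sub>R \<le>\<^sub>R x \<and>\<^sub>f x \<le>\<^sub>R 1\<^sub>R)"


section \<open>Functions on the unit interval\<close>

definition natfun01 :: "tm \<Rightarrow> fm" where
  "natfun01 Y =
    Forall T1 (Forall T1
      (let x = Var T1 1; y = Var T1 0; Y = lift T1 (lift T1 Y)
       in in01 x \<longrightarrow>\<^sub>f in01 y \<longrightarrow>\<^sub>f x =\<^sub>R y \<longrightarrow>\<^sub>f Y \<cdot> x =\<^sub>N Y \<cdot> y))"

definition realfun01 :: "tm \<Rightarrow> fm" where
  "realfun01 a =
    (Forall T1 (let x = Var T1 0; a = lift T1 a in in01 x \<longrightarrow>\<^sub>f is_real (a \<cdot> x)) \<and>\<^sub>f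
     Forall T1 (Forall T1
       (let x = Var T1 1; y = Var T1 0; a = lift T1 (lift T1 a)
        in in01 x \<longrightarrow>\<^sub>f in01 y \<longrightarrow>\<^sub>f x =\<^sub>R y \<longrightarrow>\<^sub>f a \<cdot> x =\<^sub>R a \<cdot> y)))"

definition NIN :: fm where
  "NIN =
    Forall (T1 \<rightarrow>\<^sub>t T0)
      (let Y = Var (T1 \<rightarrow>\<^sub>t T0) 0; x = Var T1 1; y = Var T1 0 in
       natfun01 Y \<longrightarrow>\<^sub>f
       Exists T1 (Exists T1 (in01 x \<and>\<^sub>f in01 y \<and>\<^sub>f \<not>\<^sub>f x =\<^sub>R y \<and>\<^sub>f Y \<cdot> x =\<^sub>N Y \<cdot> y)))"


section \<open>Unordered sums\<close>

text \<open>A finite sequence of reals is given by its length \<open>l\<close> and some \<open>w\<close> of type \<open>0 \<rightarrow> 1\<close>, the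
  elements being \<open>w 0, \<dots>, w (l - 1)\<close>.\<close>

definition fin01 :: "tm \<Rightarrow> tm \<Rightarrow> fm" where
  "fin01 l w =
    (Forall T0 (let i = vN 0; l = lift T0 l; w = lift T0 w in i <\<^sub>N l \<longrightarrow>\<^sub>f in01 (w \<cdot> i)) \<and>\<^sub>f
     Forall T0 (Forall T0
       (let i = vN 1; j = vN 0; l = lift T0 (lift T0 l); w = lift T0 (lift T0 w)
        in i <\<^sub>N l \<longrightarrow>\<^sub>f j <\<^sub>N l \<longrightarrow>\<^sub>f \<not>\<^sub>f i =\<^sub>N j \<longrightarrow>\<^sub>f \<not>\<^sub>f w \<cdot> i =\<^sub>R w \<cdot> j)))"

definition disjoint01 :: "tm \<Rightarrow> tm \<Rightarrow> tm \<Rightarrow> tm \<Rightarrow> fm" where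
  "disjoint01 k u l w =
    Forall T0 (Forall T0
      (let i = vN 1; j = vN 0; k = lift T0 (lift T0 k); u = lift T0 (lift T0 u);
           l = lift T0 (lift T0 l); w = lift T0 (lift T0 w)
       in i <\<^sub>N k \<longrightarrow>\<^sub>f j <\<^sub>N l \<longrightarrow>\<^sub>f \<not>\<^sub>f u \<cdot> i =\<^sub>R w \<cdot> j))"

text \<open>The \<open>n\<close>-th approximation to \<open>\<Sum>i<l. a (w i)\<close> is the sum of the \<open>(n + l)\<close>-th approximations to the
  summands: as \<open>l * 2\<^sup>-\<^sup>(\<^sup>n\<^sup>+\<^sup>l\<^sup>) < 2\<^sup>-\<^sup>n\<close>, this has the rate of convergence required of a real.\<close>

definition rsum :: "tm \<Rightarrow> tm \<Rightarrow> tm \<Rightarrow> tm" where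
  "rsum a l w =
    (let step = (let n = vN 2; i = vN 1; s = vN 0; a = lift T0 (lift T0 (lift T0 a));
                     l = lift T0 (lift T0 (lift T0 l)); w = lift T0 (lift T0 (lift T0 w))
                 in s +\<^sub>Q a \<cdot> (w \<cdot> i) \<cdot> (n +\<^sub>N l))
     in lam T0 (recN (lam2 step) 0\<^sub>Q (lift T0 l)))"

definition Cauchy_sum :: "tm \<Rightarrow> fm" where
  "Cauchy_sum a =
    Forall T1
      (let \<epsilon> = Var T1 0;
           k = vN 1; u = Var (T0 \<rightarrow>\<^sub>t T1) 1;
           l = vN 0; w = Var (T0 \<rightarrow>\<^sub>t T1) 0;
           a = lift T1 (lift T0 (lift (T0 \<rightarrow>\<^sub>t T1) (lift T0 (lift (T0 \<rightarrow>\<^sub>t T1) a))))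
       in is_real \<epsilon> \<longrightarrow>\<^sub>f 0\<^sub>R <\<^sub>R \<epsilon> \<longrightarrow>\<^sub>f
          Exists T0 (Exists (T0 \<rightarrow>\<^sub>t T1)
            (fin01 (vN 0) (Var (T0 \<rightarrow>\<^sub>t T1) 0) \<and>\<^sub>f
             Forall T0 (Forall (T0 \<rightarrow>\<^sub>t T1)
               (fin01 l w \<longrightarrow>\<^sub>f disjoint01 k u l w \<longrightarrow>\<^sub>f rabs (rsum a l w) <\<^sub>R \<epsilon>)))))"

definition nonneg01 :: "tm \<Rightarrow> fm" where
  "nonneg01 a = Forall T1 (let x = Var T1 0; a = lift T1 a in in01 x \<longrightarrow>\<^sub>f 0\<^sub>R \<le>\<^sub>R a \<cdot> x)"

definition SUM_stmt :: fm where
  "SUM_stmt =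
    Forall (T1 \<rightarrow>\<^sub>t T1)
      (let a = Var (T1 \<rightarrow>\<^sub>t T1) 0; y = Var (T0 \<rightarrow>\<^sub>t T1) 0; z = Var T1 0; i = vN 0 in
       realfun01 a \<longrightarrow>\<^sub>f Cauchy_sum a \<longrightarrow>\<^sub>f nonneg01 a \<longrightarrow>\<^sub>f
       Exists (T0 \<rightarrow>\<^sub>t T1)
         (Forall T0 (in01 (y \<cdot> i)) \<and>\<^sub>f
          Forall T1 (in01 z \<longrightarrow>\<^sub>f Forall T0 (\<not>\<^sub>f z =\<^sub>R y \<cdot> i) \<longrightarrow>\<^sub>f a \<cdot> z =\<^sub>R 0\<^sub>R)))"

end

theory Submission
  imports Defs "HOL-Library.Countable" "HOL-Computational_Algebra.Fraction_Field"
begin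

text \<open>By completeness it suffices to show the implication in every extensional (Henkin) model of
  \<open>RCA\<^sub>0\<^sup>\<omega> + IND\<close>, whose numbers may be nonstandard. There, an injection \<open>Y\<close> from the unit interval to the
  numbers gives the weights \<open>a\<^sub>x = 2\<^sup>-\<^sup>Y\<^sup>(\<^sup>x\<^sup>)\<close>. By induction on \<open>m\<close>, the finitely many \<open>x\<close> with \<open>Y(x) < m\<close> form a
  finite sequence, and the weights of any finite set disjoint from it sum to less than \<open>2\<^sup>-\<^sup>m\<^sup>+\<^sup>1\<close>; so \<open>a\<close> is
  Cauchy. As no weight vanishes, \<open>SUM\<close> enumerates the whole unit interval, which Cantor's diagonal
  argument refutes.\<close>

text \<open>A number of the model may be nonstandard, so neither the induction of HOL nor its finite
  sums apply to it: every induction on such numbers goes through a formula that defines the property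
  in the model, and every function on them is the value of a term built from the recursor. That
  recursor only produces numbers, which is enough: partial sums and diagonal approximations are
  codes of rationals, and appending to a sequence of reals is a case distinction. Algebra on
  rational codes is moved into an ordered field, the fractions of the formal differences of the
  model's numbers. This asks for a type of numbers, while completeness yields only a carrier set;
  hence the choice of such a type at the end. The weights are rational and coded by constant
  sequences, so an approximation to one of their sums is its exact value. Equality of reals
  tolerates an error at each precision; for this reason the diagonal real uses the digits 0 and 3 in
  base 4, which leaves a gap on both sides of the threshold 2.\<close>

instance ty :: countable by countable_datatype
instance const :: countable by countable_datatype
instance tm :: countable by countable_datatype
instance fm :: countable by countable_datatype

section \<open>Substitution calculus for de Bruijn indices that are counted per type\<close>

definition push :: "ty \<Rightarrow> 'd \<Rightarrow> (ty \<Rightarrow> nat \<Rightarrow> 'd) \<Rightarrow> ty \<Rightarrow> nat \<Rightarrow> 'd" where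
  "push \<sigma> d e = (\<lambda>\<tau> n. if \<tau> = \<sigma> then (case n of 0 \<Rightarrow> d | Suc m \<Rightarrow> e \<tau> m) else e \<tau> n)"

lemma push_simps [simp]:
  "push \<sigma> d e \<sigma> 0 = d"
  "push \<sigma> d e \<sigma> (Suc m) = e \<sigma> m"
  "push \<sigma> d e \<sigma> (numeral k) = e \<sigma> (pred_numeral k)"
  "\<tau> \<noteq> \<sigma> \<Longrightarrow> push \<sigma> d e \<tau> n = e \<tau> n"
  by (simp_all add: push_def numeral_eq_Suc)

definition wtsub :: "sub \<Rightarrow> bool" where
  "wtsub s \<longleftrightarrow> (\<forall>\<sigma> n. wt (s \<sigma> n) \<and> tyof (s \<sigma> n) = \<sigma>)"

lemma tyof_tsubst [simp]: "wtsub s \<Longrightarrow> tyof (tsubst s t) = tyof t"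
  by (induction t) (auto simp: wtsub_def)

lemma wt_tsubst [simp]: "wtsub s \<Longrightarrow> wt t \<Longrightarrow> wt (tsubst s t)"
  by (induction t) (auto simp: wtsub_def)

lemma wtsub_Var [simp]: "wtsub Var"
  by (simp add: wtsub_def)

lemma wtsub_shiftv [simp]: "wtsub (shiftv \<sigma>)"
  by (simp add: wtsub_def shiftv_def)

lemma wtsub_push [simp]: "wtsub s \<Longrightarrow> wt t \<Longrightarrow> tyof t = \<sigma> \<Longrightarrow> wtsub (push \<sigma> t s)"
  by (auto simp: wtsub_def push_def split: nat.split)

lemma wtsub_upv [simp]: "wtsub s \<Longrightarrow> wtsub (upv \<sigma> s)"
proof -
  assume s: "wtsub s"
  then have "wt (lift \<sigma> (s \<tau> n))" "tyof (lift \<sigma> (s \<tau> n)) = \<tau>" for \<tau> n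
    by (simp_all add: wtsub_def[of s])
  then show ?thesis unfolding wtsub_def[of "upv \<sigma> s"] by (auto simp: upv_def split: nat.split)
qed

lemma wff_fsubst [simp]: "wtsub s \<Longrightarrow> wff A \<Longrightarrow> wff (fsubst s A)"
  by (induction A arbitrary: s) auto

lemma tsubst_Var [simp]: "tsubst Var t = t"
  by (induction t) auto

lemma tsubst_tsubst: "tsubst s (tsubst r t) = tsubst (\<lambda>\<sigma> n. tsubst s (r \<sigma> n)) t"
  by (induction t) auto

lemma upv_Var [simp]: "upv \<sigma> Var = Var"
  by (intro ext) (simp add: upv_def shiftv_def split: nat.split)

lemma fsubst_Var [simp]: "fsubst Var A = A"
  by (induction A) auto

lemma upv_lift: "tsubst (upv \<sigma> s) (lift \<sigma> t) = lift \<sigma> (tsubst s t)"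
  unfolding tsubst_tsubst by (rule arg_cong[where f="\<lambda>r. tsubst r t"]) (auto simp: fun_eq_iff shiftv_def upv_def)

lemma upv_comp: "(\<lambda>\<tau> n. tsubst (upv \<sigma> s) (upv \<sigma> r \<tau> n)) = upv \<sigma> (\<lambda>\<tau> n. tsubst s (r \<tau> n))"
proof (intro ext)
  fix \<tau> n
  show "tsubst (upv \<sigma> s) (upv \<sigma> r \<tau> n) = upv \<sigma> (\<lambda>\<tau> n. tsubst s (r \<tau> n)) \<tau> n"
    by (cases "\<tau> = \<sigma>"; cases n) (simp_all add: upv_def[of _ r] upv_def[of _ "\<lambda>\<tau> n. tsubst s (r \<tau> n)"] upv_lift,
       simp add: upv_def)
qed

lemma fsubst_fsubst: "fsubst s (fsubst r A) = fsubst (\<lambda>\<sigma> n. tsubst s (r \<sigma> n)) A"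
  by (induction A arbitrary: s r) (auto simp: tsubst_tsubst upv_comp)

text \<open>With instances written as a \<open>push\<close> on the identity, facts about them reduce
  to composition of substitutions. The same \<open>push\<close> extends the environments of a model,
  so that syntactic and semantic updates correspond in \<open>sat_inst\<close>.\<close>

lemma inst_push: "inst \<sigma> t = fsubst (push \<sigma> t Var)"
  unfolding inst_def push_def by (rule arg_cong[where f=fsubst]) (auto simp: fun_eq_iff)

lemma push_lift [simp]: "tsubst (push \<sigma> t s) (lift \<sigma> u) = tsubst s u"
  unfolding tsubst_tsubst
  by (rule arg_cong[where f="\<lambda>r. tsubst r u"]) (auto simp: fun_eq_iff shiftv_def push_def)

lemma fsubst_inst: "fsubst s (inst \<sigma> t A) = fsubst (push \<sigma> (tsubst s t) s) A"
  unfolding inst_push fsubst_fsubst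
  by (rule arg_cong[where f="\<lambda>r. fsubst r A"]) (auto simp: fun_eq_iff push_def split: nat.split)

lemma inst_upv: "inst \<sigma> t (fsubst (upv \<sigma> s) A) = fsubst (push \<sigma> t s) A"
  unfolding inst_push fsubst_fsubst
proof (rule arg_cong[where f="\<lambda>r. fsubst r A"], intro ext)
  fix \<tau> n
  show "tsubst (push \<sigma> t Var) (upv \<sigma> s \<tau> n) = push \<sigma> t s \<tau> n"
    by (cases "\<tau> = \<sigma>"; cases n) (simp_all add: upv_def)
qed

lemma wff_inst [simp]: "wff A \<Longrightarrow> wt t \<Longrightarrow> tyof t = \<sigma> \<Longrightarrow> wff (inst \<sigma> t A)"
  by (simp add: inst_push)

section \<open>Free variables: each formula has finitely many, and substitution depends on them
  alone\<close>

definition unbind :: "ty \<Rightarrow> (ty \<times> nat) set \<Rightarrow> (ty \<times> nat) set" where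
  "unbind \<sigma> S = {(\<tau>, n). (\<tau>, if \<tau> = \<sigma> then Suc n else n) \<in> S}"

lemma unbind_simps [simp]:
  "unbind \<sigma> {} = {}"
  "unbind \<sigma> (A \<union> B) = unbind \<sigma> A \<union> unbind \<sigma> B"
  "unbind \<sigma> (insert (\<tau>, n) A) =
    (if \<tau> = \<sigma> then (case n of 0 \<Rightarrow> {} | Suc m \<Rightarrow> {(\<sigma>, m)}) else {(\<tau>, n)}) \<union> unbind \<sigma> A"
  by (auto simp: unbind_def split: nat.splits if_splits)

lemma finite_unbind: assumes "finite S" shows "finite (unbind \<sigma> S)"
proof -
  have "unbind \<sigma> S = (\<lambda>(\<tau>, n). (\<tau>, if \<tau> = \<sigma> then Suc n else n)) -` S"
    by (auto simp: unbind_def)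
  moreover have "inj (\<lambda>(\<tau>, n). (\<tau>, if \<tau> = \<sigma> then Suc n else n))"
    by (auto simp: inj_def split: if_splits)
  ultimately show ?thesis
    using assms by (simp add: finite_vimageI)
qed

primrec tv :: "tm \<Rightarrow> (ty \<times> nat) set" where
  "tv (Var \<sigma> n) = {(\<sigma>, n)}"
| "tv (Con c) = {}"
| "tv (s \<cdot> t) = tv s \<union> tv t"

primrec fv :: "fm \<Rightarrow> (ty \<times> nat) set" where
  "fv \<bottom>\<^sub>f = {}"
| "fv (s =\<^sub>N t) = tv s \<union> tv t"
| "fv (s <\<^sub>N t) = tv s \<union> tv t"
| "fv (A \<longrightarrow>\<^sub>f B) = fv A \<union> fv B"
| "fv (Forall \<sigma> A) = unbind \<sigma> (fv A)"

lemma finite_tv: "finite (tv t)"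
  by (induction t) auto

lemma finite_fv: "finite (fv A)"
  by (induction A) (auto simp: finite_tv finite_unbind)

lemma tsubst_cong: "(\<And>\<sigma> n. (\<sigma>, n) \<in> tv t \<Longrightarrow> s \<sigma> n = r \<sigma> n) \<Longrightarrow> tsubst s t = tsubst r t"
  by (induction t) auto

lemma fsubst_cong: "(\<And>\<sigma> n. (\<sigma>, n) \<in> fv A \<Longrightarrow> s \<sigma> n = r \<sigma> n) \<Longrightarrow> fsubst s A = fsubst r A"
proof (induction A arbitrary: s r)
  case (Eq x1 x2)
  then show ?case by (auto intro!: tsubst_cong)
next
  case (Less x1 x2)
  then show ?case by (auto intro!: tsubst_cong)
next
  case (Imp A1 A2)
  have "fsubst s A1 = fsubst r A1" by (rule Imp.IH) (simp add: Imp.prems)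
  moreover have "fsubst s A2 = fsubst r A2" by (rule Imp.IH) (simp add: Imp.prems)
  ultimately show ?case by simp
next
  case (Forall \<sigma> A)
  have "fsubst (upv \<sigma> s) A = fsubst (upv \<sigma> r) A"
  proof (rule Forall.IH)
    fix \<tau> n assume "(\<tau>, n) \<in> fv A"
    then show "upv \<sigma> s \<tau> n = upv \<sigma> r \<tau> n"
      using Forall.prems by (auto simp: upv_def unbind_def split: nat.split)
  qed
  then show ?case by simp
qed auto

section \<open>Admissible rules\<close>

lemma prv_wff: "prv Ax H A \<Longrightarrow> wff A"
  by (induction rule: prv.induct) auto

lemma prv_weaken: "prv Ax H A \<Longrightarrow> set H \<subseteq> set H' \<Longrightarrow> prv Ax H' A"
proof (induction arbitrary: H' rule: prv.induct)
  case (ax A H)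
  then show ?case by (simp add: prv.ax)
next
  case (hyp A H)
  then show ?case by (auto intro: prv.hyp)
next
  case (impI A H B)
  show ?case using impI.hyps(1) by (rule prv.impI) (rule impI.IH, use impI.prems in auto)
next
  case (impE H A B)
  show ?case by (rule prv.impE[OF impE.IH]) (use impE.prems in auto)
next
  case (raa A H)
  show ?case using raa.hyps(1) by (rule prv.raa) (rule raa.IH, use raa.prems in auto)
next
  case (allI \<sigma> H A)
  show ?case by (rule prv.allI) (rule allI.IH, use allI.prems in auto)
next
  case (allE H \<sigma> A t)
  then show ?case by (auto intro: prv.allE)
qed

primrec pushes :: "(ty \<times> tm) list \<Rightarrow> sub" where
  "pushes [] = Var"
| "pushes (x # xs) = push (fst x) (snd x) (pushes xs)"

primrec lifts :: "(ty \<times> tm) list \<Rightarrow> tm \<Rightarrow> tm" where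
  "lifts [] t = t"
| "lifts (x # xs) t = lift (fst x) (lifts xs t)"

lemma pushes_lifts [simp]: "tsubst (pushes xs) (lifts xs t) = t"
  by (induction xs) auto

lemma wt_lifts [simp]: "wt t \<Longrightarrow> wt (lifts xs t)" "tyof (lifts xs t) = tyof t"
  by (induction xs) auto

text \<open>Each \<open>push\<close> is a generalization followed by an instantiation, which is
  possible as there are no open assumptions. The term is first lifted over the remaining pushes, so
  that carrying them out afterwards restores it.\<close>

lemma prv_pushes:
  assumes "\<And>\<sigma> t. (\<sigma>, t) \<in> set xs \<Longrightarrow> wt t \<and> tyof t = \<sigma>" and "prv Ax [] A"
  shows "prv Ax [] (fsubst (pushes xs) A)"
  using assms
proof (induction xs arbitrary: A)
  case (Cons x xs)
  obtain \<sigma> t where x: "x = (\<sigma>, t)" by (cases x)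
  have t: "wt t" "tyof t = \<sigma>" using Cons.prems(1) x by auto
  have "prv Ax [] (Forall \<sigma> A)" using Cons.prems(2) by (simp add: prv.allI)
  then have "prv Ax [] (inst \<sigma> (lifts xs t) A)" by (rule prv.allE) (simp_all add: t)
  then have "prv Ax [] (fsubst (pushes xs) (inst \<sigma> (lifts xs t) A))"
    by (rule Cons.IH[rotated]) (use Cons.prems(1) in auto)
  then show ?case by (simp add: x fsubst_inst)
qed simp

text \<open>A derivation instantiates finitely many variables, one at a time, whereas
  \<open>s\<close> acts on infinitely many. It suffices to treat, type by type, all indices below a
  common bound \<open>k\<close>.\<close>

lemma pushes_agree:
  assumes "finite S"
  obtains xs where "\<And>\<sigma> t. (\<sigma>, t) \<in> set xs \<Longrightarrow> \<exists>n. t = s \<sigma> n"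
    "\<And>\<sigma> n. (\<sigma>, n) \<in> S \<Longrightarrow> pushes xs \<sigma> n = s \<sigma> n"
proof -
  obtain k where k: "\<And>\<sigma> n. (\<sigma>, n) \<in> S \<Longrightarrow> n < k"
    using finite_nat_set_iff_bounded[of "snd ` S"] assms by force
  obtain \<tau>s where \<tau>s: "set \<tau>s = fst ` S" "distinct \<tau>s"
    using finite_distinct_list[of "fst ` S"] assms by auto
  define block where "block \<tau> i = map (\<lambda>j. (\<tau>, s \<tau> j)) [i..<k]" for \<tau> i
  \<comment> \<open>The claim speaks of the suffixes \<open>block \<tau> i\<close>, since passing
    one \<open>push\<close> lowers the indices of type \<open>\<tau>\<close> by one while the list
    of terms moves on to \<open>s \<tau> (i + 1)\<close>.\<close>
  have block: "pushes (block \<tau> i @ ys) \<sigma> n = (if \<sigma> = \<tau> then (if i + n < k then s \<tau> (i + n) else pushes ys \<tau> (i + n - k)) else pushes ys \<sigma> n)"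
    if "i \<le> k" for \<tau> \<sigma> i n ys using that
  proof (induction "k - i" arbitrary: i n)
    case 0
    then show ?case by (simp add: block_def)
  next
    case (Suc m)
    then have "i < k" by simp
    then have "block \<tau> i = (\<tau>, s \<tau> i) # block \<tau> (Suc i)"
      by (simp add: block_def upt_conv_Cons)
    moreover have "m = k - Suc i" "Suc i \<le> k" using Suc.hyps(2) by auto
    ultimately show ?case using Suc.hyps(1)[of "Suc i"] \<open>i < k\<close>
      by (cases n) (auto simp: push_def)
  qed
  define xs where "xs = concat (map (\<lambda>\<tau>. block \<tau> 0) \<tau>s)"
  have "pushes (concat (map (\<lambda>\<tau>. block \<tau> 0) \<tau>s)) \<sigma> n = s \<sigma> n" if "\<sigma> \<in> set \<tau>s" "n < k" for \<sigma> n \<tau>s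
    using that by (induction \<tau>s) (auto simp: block)
  then have "pushes xs \<sigma> n = s \<sigma> n" if "(\<sigma>, n) \<in> S" for \<sigma> n
    using that k \<tau>s by (force simp: xs_def)
  moreover have "\<exists>n. t = s \<sigma> n" if "(\<sigma>, t) \<in> set xs" for \<sigma> t
    using that by (auto simp: xs_def block_def)
  ultimately show thesis using that by blast
qed

text \<open>The axiom case of \<open>prv_fsubst\<close> rests on this: the set \<open>Ax\<close>
  need not be closed under substitution, but the eigenvariable condition does not look at it, so a
  theorem can be generalized and then instantiated.\<close>

lemma prv_instance:
  assumes "prv Ax [] A" and s: "wtsub s"
  shows "prv Ax H (fsubst s A)"
proof -
  obtain xs where xs: "\<And>\<sigma> t. (\<sigma>, t) \<in> set xs \<Longrightarrow> \<exists>n. t = s \<sigma> n"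
    "\<And>\<sigma> n. (\<sigma>, n) \<in> fv A \<Longrightarrow> pushes xs \<sigma> n = s \<sigma> n"
    using pushes_agree[OF finite_fv] by metis
  have "prv Ax [] (fsubst (pushes xs) A)"
    by (rule prv_pushes) (use assms xs(1) in \<open>fastforce simp: wtsub_def\<close>)+
  moreover have "fsubst (pushes xs) A = fsubst s A"
    by (rule fsubst_cong) (rule xs(2))
  ultimately show ?thesis using prv_weaken by fastforce
qed

lemma prv_fsubst: "prv Ax H A \<Longrightarrow> wtsub s \<Longrightarrow> prv Ax (map (fsubst s) H) (fsubst s A)"
proof (induction arbitrary: s rule: prv.induct)
  case (ax A H)
  then show ?case by (auto intro: prv_instance prv.ax)
next
  case (hyp A H)
  then show ?case by (auto intro: prv.hyp)
next
  case (impI A H B)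
  then show ?case by (auto intro: prv.impI)
next
  case (impE H A B)
  then show ?case by (auto intro: prv.impE)
next
  case (raa A H)
  then show ?case by (auto intro: prv.raa)
next
  case (allI \<sigma> H A)
  have "prv Ax (map (fsubst (upv \<sigma> s)) (map (flift \<sigma>) H)) (fsubst (upv \<sigma> s) A)"
    using allI by simp
  moreover have "(\<lambda>\<tau> n. tsubst (upv \<sigma> s) (shiftv \<sigma> \<tau> n)) = (\<lambda>\<tau> n. lift \<sigma> (s \<tau> n))"
    by (auto simp: fun_eq_iff shiftv_def upv_def)
  then have "map (fsubst (upv \<sigma> s)) (map (flift \<sigma>) H) = map (flift \<sigma>) (map (fsubst s) H)"
    by (simp add: fsubst_fsubst)
  ultimately show ?case by (simp only: fsubst.simps) (rule prv.allI, simp only:)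
next
  case (allE H \<sigma> A t)
  have "prv Ax (map (fsubst s) H) (Forall \<sigma> (fsubst (upv \<sigma> s) A))"
    using allE by simp
  then have "prv Ax (map (fsubst s) H) (inst \<sigma> (tsubst s t) (fsubst (upv \<sigma> s) A))"
    by (rule prv.allE) (use allE in auto)
  then show ?case by (simp add: inst_upv fsubst_inst)
qed

text \<open>Turns a fresh variable with an arbitrary index into the index 0 that \<open>allI\<close>
  binds. The substitution \<open>s\<close> renames this variable to 0 and shifts the others of its
  type, so that it acts on the assumptions as a lift.\<close>

lemma prv_generalize:
  assumes p: "prv Ax H (inst \<sigma> (Var \<sigma> k) B)"
    and k: "\<And>A. A \<in> set H \<Longrightarrow> (\<sigma>, k) \<notin> fv A" "(\<sigma>, k) \<notin> fv (Forall \<sigma> B)"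
  shows "prv Ax H (Forall \<sigma> B)"
proof (rule prv.allI)
  define s where "s = (shiftv \<sigma>)(\<sigma> := \<lambda>n. if n = k then Var \<sigma> 0 else Var \<sigma> (Suc n))"
  have s: "wtsub s" by (auto simp: s_def wtsub_def shiftv_def)
  have "fsubst s (inst \<sigma> (Var \<sigma> k) B) = fsubst Var B"
    unfolding fsubst_inst using k(2)
    by (intro fsubst_cong) (auto simp: push_def s_def shiftv_def unbind_def split: nat.splits)
  moreover have "fsubst s A = flift \<sigma> A" if "A \<in> set H" for A
    using k(1)[OF that] by (intro fsubst_cong) (auto simp: s_def shiftv_def)
  then have "map (fsubst s) H = map (flift \<sigma>) H" by simp
  ultimately show "prv Ax (map (flift \<sigma>) H) B"
    using prv_fsubst[OF p s] by (simp only: fsubst_Var)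
qed

lemma prv_cut: "prv Ax H A \<Longrightarrow> prv Ax (A # H) B \<Longrightarrow> prv Ax H B"
  by (meson prv.impE prv.impI prv_wff)

lemma prv_botE: "prv Ax H \<bottom>\<^sub>f \<Longrightarrow> wff A \<Longrightarrow> prv Ax H A"
  by (rule prv.raa) (auto intro: prv_weaken)

section \<open>Completeness\<close>

text \<open>These closure properties are what the term model uses. The first clause admits all
  substitution instances of theorems, because the valuations of the term model are induced by
  substitutions.\<close>

definition henkin :: "fm set \<Rightarrow> fm set \<Rightarrow> bool" where
  "henkin Ax \<Delta> \<longleftrightarrow>
    (\<forall>A s. prv Ax [] A \<longrightarrow> wtsub s \<longrightarrow> fsubst s A \<in> \<Delta>) \<and>
    \<bottom>\<^sub>f \<notin> \<Delta> \<and>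
    (\<forall>A B. wff A \<longrightarrow> wff B \<longrightarrow> ((A \<longrightarrow>\<^sub>f B) \<in> \<Delta> \<longleftrightarrow> (A \<in> \<Delta> \<longrightarrow> B \<in> \<Delta>))) \<and>
    (\<forall>\<sigma> A. wff A \<longrightarrow> (Forall \<sigma> A \<in> \<Delta> \<longleftrightarrow> (\<forall>t. wt t \<longrightarrow> tyof t = \<sigma> \<longrightarrow> inst \<sigma> t A \<in> \<Delta>)))"

text \<open>Fresh variables serve as Henkin witnesses, so the language needs no new constants.\<close>

lemma henkin_step:
  assumes H: "\<not> prv Ax H \<bottom>\<^sub>f" "\<forall>A \<in> set H. wff A"
  shows "\<exists>H'. set H \<subseteq> set H' \<and> \<not> prv Ax H' \<bottom>\<^sub>f \<and> (\<forall>A \<in> set H'. wff A) \<and>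
    (wff A \<longrightarrow> \<not> prv Ax (A # H) \<bottom>\<^sub>f \<longrightarrow> A \<in> set H' \<and>
      (\<forall>\<sigma> B. A = (\<not>\<^sub>f Forall \<sigma> B) \<longrightarrow> (\<exists>t. wt t \<and> tyof t = \<sigma> \<and> (\<not>\<^sub>f inst \<sigma> t B) \<in> set H')))"
proof (cases "wff A \<and> \<not> prv Ax (A # H) \<bottom>\<^sub>f \<and> (\<exists>\<sigma> B. A = (\<not>\<^sub>f Forall \<sigma> B))")
  case False
  then show ?thesis
    using H by (intro exI[of _ "if wff A \<and> \<not> prv Ax (A # H) \<bottom>\<^sub>f then A # H else H"]) auto
next
  case True
  then obtain \<sigma> B where A: "A = (\<not>\<^sub>f Forall \<sigma> B)" "wff A" "wff B" and con: "\<not> prv Ax (A # H) \<bottom>\<^sub>f"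
    by auto
  have "finite ((\<Union>C \<in> set (A # H). fv C))" by (simp add: finite_fv)
  then have "finite (Pair \<sigma> -` (\<Union>C \<in> set (A # H). fv C))"
    by (rule finite_vimageI) (simp add: inj_def)
  then obtain k where k: "k \<notin> Pair \<sigma> -` (\<Union>C \<in> set (A # H). fv C)"
    using ex_new_if_finite infinite_UNIV_nat by blast
  let ?W = "\<not>\<^sub>f inst \<sigma> (Var \<sigma> k) B"
  \<comment> \<open>If the witness were inconsistent, the instance at the fresh variable would be
    derivable, hence also its generalization, against \<open>A\<close>.\<close>
  have "\<not> prv Ax (?W # A # H) \<bottom>\<^sub>f"
  proof
    assume "prv Ax (?W # A # H) \<bottom>\<^sub>f"
    then have "prv Ax (A # H) (inst \<sigma> (Var \<sigma> k) B)"
      by (rule prv.raa[rotated]) (simp add: A)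
    then have "prv Ax (A # H) (Forall \<sigma> B)"
      by (rule prv_generalize) (use k A in auto)
    moreover have "prv Ax (A # H) A" using A by (auto intro: prv.hyp)
    ultimately show False using con A by (blast intro: prv.impE)
  qed
  then show ?thesis
    using H A by (intro exI[of _ "?W # A # H"]) (auto intro!: exI[of _ "Var \<sigma> k"])
qed

text \<open>Lindenbaum construction along the enumeration of all formulas. Every stage is a finite
  list, so a fresh witness variable always exists, and finitely many assumptions from the limit
  already belong to a single stage.\<close>

lemma henkin_extension:
  assumes H0: "\<not> prv Ax H0 \<bottom>\<^sub>f" "\<forall>A \<in> set H0. wff A"
  obtains \<Delta> where "henkin Ax \<Delta>" "set H0 \<subseteq> \<Delta>"
proof -
  define good where "good H \<longleftrightarrow> set H0 \<subseteq> set H \<and> \<not> prv Ax H \<bottom>\<^sub>f \<and> (\<forall>A \<in> set H. wff A)" for H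
  define nxt where "nxt n H H' \<longleftrightarrow> set H \<subseteq> set H' \<and> (wff (from_nat n) \<longrightarrow>
     \<not> prv Ax (from_nat n # H) \<bottom>\<^sub>f \<longrightarrow> from_nat n \<in> set H' \<and>
      (\<forall>\<sigma> B. from_nat n = (\<not>\<^sub>f Forall \<sigma> B) \<longrightarrow> (\<exists>t. wt t \<and> tyof t = \<sigma> \<and> (\<not>\<^sub>f inst \<sigma> t B) \<in> set H')))"
    for n :: nat and H H'
  have "\<exists>h. \<forall>n. good (h n) \<and> nxt n (h n) (h (Suc n))"
  proof (rule dependent_nat_choice)
    show "\<exists>H. good H" using H0 by (auto simp: good_def)
    fix H n assume "good H"
    then show "\<exists>H'. good H' \<and> nxt n H H'"
      using henkin_step[of Ax H "from_nat n"] unfolding good_def nxt_def by blast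
  qed
  then obtain h where h: "\<And>n. good (h n)" "\<And>n. nxt n (h n) (h (Suc n))" by blast
  have mono: "set (h n) \<subseteq> set (h m)" if "n \<le> m" for n m
    by (rule lift_Suc_mono_le[where f="\<lambda>n. set (h n)", OF _ that]) (use h(2) in \<open>auto simp: nxt_def\<close>)
  define \<Delta> where "\<Delta> = (\<Union>n. set (h n))"
  have bound: "\<exists>n. set H \<subseteq> set (h n)" if "set H \<subseteq> \<Delta>" for H using that
  proof (induction H)
    case (Cons A H)
    then obtain n m where "set H \<subseteq> set (h n)" "A \<in> set (h m)" by (auto simp: \<Delta>_def)
    then have "set (A # H) \<subseteq> set (h (max n m))"
      using mono[of n "max n m"] mono[of m "max n m"] by auto
    then show ?case by blast
  qed simp
  have con: "\<not> prv Ax H \<bottom>\<^sub>f" if "set H \<subseteq> \<Delta>" for H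
    using bound[OF that] h(1) prv_weaken unfolding good_def by blast
  \<comment> \<open>A formula compatible with every finite part of \<open>\<Delta>\<close> is in
    particular compatible with the stage that treats it, and is added there.\<close>
  have enter: "A \<in> set (h (Suc (to_nat A)))" if "wff A" "\<And>H. set H \<subseteq> \<Delta> \<Longrightarrow> \<not> prv Ax (A # H) \<bottom>\<^sub>f" for A
    using h(2)[of "to_nat A"] that unfolding nxt_def \<Delta>_def by (auto)
  have closed: "A \<in> \<Delta>" if p: "prv Ax H A" and H: "set H \<subseteq> \<Delta>" for A H
  proof -
    have "\<not> prv Ax (A # H') \<bottom>\<^sub>f" if "set H' \<subseteq> \<Delta>" for H'
    proof
      assume "prv Ax (A # H') \<bottom>\<^sub>f"
      then have "prv Ax (A # H' @ H) \<bottom>\<^sub>f" by (rule prv_weaken) auto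
      moreover have "prv Ax (H' @ H) A" using p by (rule prv_weaken) auto
      ultimately have "prv Ax (H' @ H) \<bottom>\<^sub>f" by (rule prv_cut[rotated])
      then show False using con[of "H' @ H"] that H by auto
    qed
    then show ?thesis using enter[of A] prv_wff[OF p] by (auto simp: \<Delta>_def)
  qed
  have bot: "\<bottom>\<^sub>f \<notin> \<Delta>" using con[of "[\<bottom>\<^sub>f]"] prv.hyp[of "\<bottom>\<^sub>f" "[\<bottom>\<^sub>f]"] by auto
  have wffD: "wff A" if "A \<in> \<Delta>" for A using that h(1) by (auto simp: \<Delta>_def good_def)
  have neg: "(\<not>\<^sub>f A) \<in> \<Delta>" if w: "wff A" "A \<notin> \<Delta>" for A
  proof -
    have "A \<notin> set (h (Suc (to_nat A)))" using that by (auto simp: \<Delta>_def)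
    then obtain H where "set H \<subseteq> \<Delta>" "prv Ax (A # H) \<bottom>\<^sub>f"
      using enter[of A] w by blast
    then show ?thesis using that by (auto intro: closed prv.impI)
  qed
  have mp: "B \<in> \<Delta>" if "(A \<longrightarrow>\<^sub>f B) \<in> \<Delta>" "A \<in> \<Delta>" for A B
  proof (rule closed[of "[A \<longrightarrow>\<^sub>f B, A]"])
    show "prv Ax [A \<longrightarrow>\<^sub>f B, A] B"
      by (rule prv.impE[of _ _ A B]) (use wffD[OF that(1)] in \<open>auto intro: prv.hyp\<close>)
  qed (use that in auto)
  have "henkin Ax \<Delta>"
    unfolding henkin_def
  proof (intro conjI HOL.allI HOL.impI)
    show "fsubst s A \<in> \<Delta>" if "prv Ax [] A" "wtsub s" for A s
      by (rule closed[of "[]"]) (auto intro: prv_instance that)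
    show "(A \<longrightarrow>\<^sub>f B) \<in> \<Delta> \<longleftrightarrow> (A \<in> \<Delta> \<longrightarrow> B \<in> \<Delta>)" if w: "wff A" "wff B" for A B
    proof
      assume *: "A \<in> \<Delta> \<longrightarrow> B \<in> \<Delta>"
      show "(A \<longrightarrow>\<^sub>f B) \<in> \<Delta>"
      proof (cases "A \<in> \<Delta>")
        case True
        then show ?thesis using * w by (intro closed[of "[B]"] prv.impI) (auto intro: prv.hyp)
      next
        case False
        have "prv Ax [A, \<not>\<^sub>f A] \<bottom>\<^sub>f"
          by (rule prv.impE[of _ _ A]) (use w in \<open>auto intro: prv.hyp\<close>)
        then have "prv Ax [\<not>\<^sub>f A] (A \<longrightarrow>\<^sub>f B)" using w by (blast intro: prv.impI prv_botE)
        then show ?thesis by (rule closed) (simp add: neg[OF w(1) False])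
      qed
    qed (use mp in blast)
    show "Forall \<sigma> A \<in> \<Delta> \<longleftrightarrow> (\<forall>t. wt t \<longrightarrow> tyof t = \<sigma> \<longrightarrow> inst \<sigma> t A \<in> \<Delta>)" if w: "wff A" for \<sigma> A
    proof
      assume *: "Forall \<sigma> A \<in> \<Delta>"
      have "prv Ax [Forall \<sigma> A] (Forall \<sigma> A)" using w by (auto intro: prv.hyp)
      then show "\<forall>t. wt t \<longrightarrow> tyof t = \<sigma> \<longrightarrow> inst \<sigma> t A \<in> \<Delta>"
        using * closed[OF prv.allE] by simp
    next
      assume all: "\<forall>t. wt t \<longrightarrow> tyof t = \<sigma> \<longrightarrow> inst \<sigma> t A \<in> \<Delta>"
      show "Forall \<sigma> A \<in> \<Delta>"
      proof (rule ccontr)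
        let ?N = "\<not>\<^sub>f Forall \<sigma> A"
        assume "Forall \<sigma> A \<notin> \<Delta>"
        then have N: "?N \<in> \<Delta>" using neg w by simp
        \<comment> \<open>The negated universal formula belongs to the consistent limit, so the
          stage that treats it did not reject it and supplied a counterexample term.\<close>
        have "\<not> prv Ax (?N # h (to_nat ?N)) \<bottom>\<^sub>f"
          by (rule con) (use N in \<open>auto simp: \<Delta>_def\<close>)
        then obtain t where "wt t" "tyof t = \<sigma>" "(\<not>\<^sub>f inst \<sigma> t A) \<in> \<Delta>"
          using h(2)[of "to_nat ?N"] w unfolding nxt_def \<Delta>_def from_nat_to_nat by fastforce
        then show False using all mp bot by blast
      qed
    qed
  qed (rule bot)
  moreover have "set H0 \<subseteq> \<Delta>" using h(1)[of 0] by (auto simp: \<Delta>_def good_def)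
  ultimately show thesis by (rule that)
qed

section \<open>Extensional models\<close>

text \<open>Application is one operation on a common carrier and the domains are sets, so that all
  finite types live in a single HOL type. Extensionality of the domains makes \<open>eqT\<close>
  denote identity at every type.\<close>

locale type_structure =
  fixes D :: "ty \<Rightarrow> 'd set" and app :: "'d \<Rightarrow> 'd \<Rightarrow> 'd" and con :: "const \<Rightarrow> 'd"
    and lt :: "'d \<Rightarrow> 'd \<Rightarrow> bool"
  assumes con_D [simp]: "con c \<in> D (cty c)"
    and app_D: "f \<in> D (\<sigma> \<rightarrow>\<^sub>t \<tau>) \<Longrightarrow> d \<in> D \<sigma> \<Longrightarrow> app f d \<in> D \<tau>"
    and D_nonempty: "D \<sigma> \<noteq> {}"
    and app_ext: "f \<in> D (\<sigma> \<rightarrow>\<^sub>t \<tau>) \<Longrightarrow> g \<in> D (\<sigma> \<rightarrow>\<^sub>t \<tau>) \<Longrightarrow> (\<And>d. d \<in> D \<sigma> \<Longrightarrow> app f d = app g d) \<Longrightarrow> f = g"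
begin

primrec eval :: "(ty \<Rightarrow> nat \<Rightarrow> 'd) \<Rightarrow> tm \<Rightarrow> 'd" where
  "eval e (Var \<sigma> n) = e \<sigma> n"
| "eval e (Con c) = con c"
| "eval e (s \<cdot> t) = app (eval e s) (eval e t)"

primrec sat :: "(ty \<Rightarrow> nat \<Rightarrow> 'd) \<Rightarrow> fm \<Rightarrow> bool" where
  "sat e \<bottom>\<^sub>f \<longleftrightarrow> False"
| "sat e (s =\<^sub>N t) \<longleftrightarrow> eval e s = eval e t"
| "sat e (s <\<^sub>N t) \<longleftrightarrow> lt (eval e s) (eval e t)"
| "sat e (A \<longrightarrow>\<^sub>f B) \<longleftrightarrow> (sat e A \<longrightarrow> sat e B)"
| "sat e (Forall \<sigma> A) \<longleftrightarrow> (\<forall>d \<in> D \<sigma>. sat (push \<sigma> d e) A)"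

definition valid :: "(ty \<Rightarrow> nat \<Rightarrow> 'd) \<Rightarrow> bool" where
  "valid e \<longleftrightarrow> (\<forall>\<sigma> n. e \<sigma> n \<in> D \<sigma>)"

lemma valid_push [simp]: "valid e \<Longrightarrow> d \<in> D \<sigma> \<Longrightarrow> valid (push \<sigma> d e)"
  by (auto simp: valid_def push_def split: nat.split)

lemma valid_D [simp]: "valid e \<Longrightarrow> e \<sigma> n \<in> D \<sigma>"
  by (simp add: valid_def)

lemma eval_D: "valid e \<Longrightarrow> wt t \<Longrightarrow> eval e t \<in> D (tyof t)"
proof (induction t)
  case (App s t)
  then show ?case by simp (metis app_D)
qed auto

lemma eval_in_D [simp]: "valid e \<Longrightarrow> wt t \<Longrightarrow> tyof t = \<sigma> \<Longrightarrow> eval e t \<in> D \<sigma>"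
  using eval_D by blast

lemma eval_cong: "(\<And>\<sigma> n. (\<sigma>, n) \<in> tv t \<Longrightarrow> e \<sigma> n = e' \<sigma> n) \<Longrightarrow> eval e t = eval e' t"
  by (induction t) auto

lemma eval_tsubst: "eval e (tsubst s t) = eval (\<lambda>\<sigma> n. eval e (s \<sigma> n)) t"
  by (induction t) auto

lemma eval_lift [simp]: "eval (push \<sigma> d e) (lift \<sigma> t) = eval e t"
  unfolding eval_tsubst
  by (rule arg_cong[where f="\<lambda>r. eval r t"]) (auto simp: fun_eq_iff shiftv_def push_def)

lemma push_upv: "(\<lambda>\<tau> n. eval (push \<sigma> d e) (upv \<sigma> s \<tau> n)) = push \<sigma> d (\<lambda>\<tau> n. eval e (s \<tau> n))"
proof (intro ext)
  fix \<tau> n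
  show "eval (push \<sigma> d e) (upv \<sigma> s \<tau> n) = push \<sigma> d (\<lambda>\<tau> n. eval e (s \<tau> n)) \<tau> n"
    by (cases "\<tau> = \<sigma>"; cases n) (simp_all add: upv_def)
qed

lemma sat_fsubst: "sat e (fsubst s A) \<longleftrightarrow> sat (\<lambda>\<sigma> n. eval e (s \<sigma> n)) A"
  by (induction A arbitrary: e s) (auto simp: eval_tsubst push_upv)

lemma sat_inst [simp]: "sat e (inst \<sigma> t A) \<longleftrightarrow> sat (push \<sigma> (eval e t) e) A"
  unfolding inst_push sat_fsubst
  by (rule arg_cong[where f="\<lambda>r. sat r A"]) (auto simp: fun_eq_iff push_def split: nat.split)

lemma sat_eqT [simp]:
  "valid e \<Longrightarrow> wt s \<Longrightarrow> wt t \<Longrightarrow> tyof s = \<rho> \<Longrightarrow> tyof t = \<rho> \<Longrightarrow>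
    sat e (eqT \<rho> s t) \<longleftrightarrow> eval e s = eval e t"
proof (induction \<rho> arbitrary: e s t)
  case (Fn \<sigma> \<tau>)
  then have "eval e s \<in> D (\<sigma> \<rightarrow>\<^sub>t \<tau>)" "eval e t \<in> D (\<sigma> \<rightarrow>\<^sub>t \<tau>)" by auto
  moreover have "sat e (eqT (\<sigma> \<rightarrow>\<^sub>t \<tau>) s t) \<longleftrightarrow> (\<forall>d \<in> D \<sigma>. app (eval e s) d = app (eval e t) d)"
    using Fn by simp
  ultimately show ?case by (metis app_ext)
qed auto

text \<open>Truncated subtraction leaves index 0 in place, which would be wrong for the abstracted
  variable; but this variable does not occur, and all other indices drop as they should.\<close>

lemma eval_lower: "occurs0 \<sigma> t = False \<Longrightarrow>
    eval e (tsubst (\<lambda>\<tau> n. if \<tau> = \<sigma> then Var \<tau> (n - 1) else Var \<tau> n) t) = eval (push \<sigma> d e) t"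
  by (induction t) (auto simp: push_def split: nat.split)

end

lemma wtsub_lower: "wtsub (\<lambda>\<tau> n. if \<tau> = \<sigma> then Var \<tau> (n - 1) else Var \<tau> n)"
  by (auto simp: wtsub_def)

lemma constfun_wt [simp]: "wt t \<Longrightarrow> wt (constfun \<sigma> t)" "tyof (constfun \<sigma> t) = (\<sigma> \<rightarrow>\<^sub>t tyof t)"
  by (simp_all add: constfun_def wtsub_lower)

lemma lam_wt [simp]: "wt t \<Longrightarrow> wt (lam \<sigma> t)" "wt t \<Longrightarrow> tyof (lam \<sigma> t) = (\<sigma> \<rightarrow>\<^sub>t tyof t)"
proof -
  have "wt t \<Longrightarrow> wt (lam \<sigma> t) \<and> tyof (lam \<sigma> t) = (\<sigma> \<rightarrow>\<^sub>t tyof t)"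
    by (induction t) auto
  then show "wt t \<Longrightarrow> wt (lam \<sigma> t)" "wt t \<Longrightarrow> tyof (lam \<sigma> t) = (\<sigma> \<rightarrow>\<^sub>t tyof t)" by auto
qed

lemma tv_constfun: "\<not> occurs0 \<sigma> t \<Longrightarrow> tv (constfun \<sigma> t) = unbind \<sigma> (tv t)"
proof -
  have "\<not> occurs0 \<sigma> t \<Longrightarrow> tv (tsubst (\<lambda>\<tau> n. if \<tau> = \<sigma> then Var \<tau> (n - 1) else Var \<tau> n) t) = unbind \<sigma> (tv t)"
    by (induction t) (auto split: nat.split)
  then show "\<not> occurs0 \<sigma> t \<Longrightarrow> tv (constfun \<sigma> t) = unbind \<sigma> (tv t)"
    by (simp add: constfun_def)
qed

lemma tv_lam [simp]: "tv (lam \<sigma> t) = unbind \<sigma> (tv t)"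
  by (induction t) (simp_all add: tv_constfun)

locale comb_model = type_structure +
  assumes sat_K: "valid e \<Longrightarrow> sat e (K_axiom \<sigma> \<tau>)"
    and sat_S: "valid e \<Longrightarrow> sat e (S_axiom \<rho> \<sigma> \<tau>)"
begin

definition e0 :: "ty \<Rightarrow> nat \<Rightarrow> 'a" where
  "e0 \<sigma> n = (SOME d. d \<in> D \<sigma>)"

lemma valid_e0 [simp]: "valid e0"
  unfolding valid_def e0_def by (metis D_nonempty ex_in_conv someI_ex)

lemma app_K: assumes "x \<in> D \<sigma>" "y \<in> D \<tau>" shows "app (app (con (CK \<sigma> \<tau>)) x) y = x"
proof -
  let ?e = "\<lambda>\<rho> n. if \<rho> = \<sigma> \<and> n = 0 then x else if \<rho> = \<tau> \<and> n = 1 then y else e0 \<rho> n"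
  have e: "valid ?e" using assms valid_e0 by (auto simp: valid_def)
  show ?thesis using sat_K[OF e, of \<sigma> \<tau>] e by (simp add: K_axiom_def Let_def)
qed

lemma app_S:
  assumes "x \<in> D (\<rho> \<rightarrow>\<^sub>t \<sigma> \<rightarrow>\<^sub>t \<tau>)" "y \<in> D (\<rho> \<rightarrow>\<^sub>t \<sigma>)" "z \<in> D \<rho>"
  shows "app (app (app (con (CS \<rho> \<sigma> \<tau>)) x) y) z = app (app x z) (app y z)"
proof -
  let ?e = "\<lambda>\<upsilon> n. if \<upsilon> = (\<rho> \<rightarrow>\<^sub>t \<sigma> \<rightarrow>\<^sub>t \<tau>) \<and> n = 0 then x else if \<upsilon> = (\<rho> \<rightarrow>\<^sub>t \<sigma>) \<and> n = 1 then y
    else if \<upsilon> = \<rho> \<and> n = 2 then z else e0 \<upsilon> n"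
  have e: "valid ?e" using assms valid_e0 by (auto simp: valid_def)
  have v: "?e (\<rho> \<rightarrow>\<^sub>t \<sigma> \<rightarrow>\<^sub>t \<tau>) 0 = x" "?e (\<rho> \<rightarrow>\<^sub>t \<sigma>) 1 = y" "?e \<rho> 2 = z" by auto
  show ?thesis using sat_S[OF e, of \<rho> \<sigma> \<tau>] e v by (simp add: S_axiom_def Let_def)
qed

lemma app_constfun:
  assumes "valid e" "wt t" "d \<in> D \<sigma>" "\<not> occurs0 \<sigma> t"
  shows "app (eval e (constfun \<sigma> t)) d = eval (push \<sigma> d e) t"
  using assms by (simp add: constfun_def eval_lower[where d=d] app_K)

text \<open>Beta conversion. It holds as an identity because the combinator equations are formulated
  with \<open>eqT\<close>, which is equality in an extensional structure.\<close>

lemma app_lam [simp]: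
  assumes "valid e" "wt t" "d \<in> D \<sigma>"
  shows "app (eval e (lam \<sigma> t)) d = eval (push \<sigma> d e) t"
  using assms
proof (induction t)
  case (Var \<tau> n)
  then show ?case
    by (auto simp: app_constfun app_S[of _ \<sigma> "\<sigma> \<rightarrow>\<^sub>t \<sigma>" \<sigma>] app_K con_D[of "CK _ _", simplified] app_D[OF con_D[of "CK _ _", simplified]]
        simp del: con_D)
next
  case (App s t)
  then obtain \<tau> where ty: "tyof s = (tyof t \<rightarrow>\<^sub>t \<tau>)" and wt: "wt s" "wt t" by (metis wt.simps(3))
  show ?case
  proof (cases "occurs0 \<sigma> (s \<cdot> t)")
    case True
    then show ?thesis
      using App.IH App.prems(1,3) ty wt by (simp add: app_S[of _ \<sigma> "tyof t" \<tau>])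
  next
    case False
    then have "app (eval e (constfun \<sigma> (s \<cdot> t))) d = eval (push \<sigma> d e) (s \<cdot> t)"
      using App.prems by (intro app_constfun)
    with False show ?thesis by simp
  qed
qed (simp add: app_constfun)

end

declare lam.simps [simp del]

section \<open>The term model of a Henkin set\<close>

lemma fsubst_eqT [simp]: "fsubst s (eqT \<rho> t u) = eqT \<rho> (tsubst s t) (tsubst s u)"
  by (induction \<rho> arbitrary: s t u) (simp_all add: upv_lift, simp add: upv_def)

lemma wff_eqT [simp]: "wt s \<Longrightarrow> wt t \<Longrightarrow> tyof s = \<rho> \<Longrightarrow> tyof t = \<rho> \<Longrightarrow> wff (eqT \<rho> s t)"
  by (induction \<rho> arbitrary: s t) auto

text \<open>Variables are indexed separately for each type, so looking up a variable of type
  \<open>\<sigma>\<close> behind a \<open>push\<close> at a function type with domain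
  \<open>\<sigma>\<close> relies on these types being different.\<close>

lemma Fn_neq [simp]: "(\<sigma> \<rightarrow>\<^sub>t \<tau>) \<noteq> \<sigma>" "\<sigma> \<noteq> (\<sigma> \<rightarrow>\<^sub>t \<tau>)"
proof -
  show "(\<sigma> \<rightarrow>\<^sub>t \<tau>) \<noteq> \<sigma>" by (induction \<sigma> arbitrary: \<tau>) auto
  then show "\<sigma> \<noteq> (\<sigma> \<rightarrow>\<^sub>t \<tau>)" by metis
qed

context
  fixes Ax \<Delta>
  assumes Ax: "RCA0\<omega> \<subseteq> Ax" and henkin: "henkin Ax \<Delta>"
begin

lemma ax_in: "A \<in> RCA0\<omega> \<Longrightarrow> wff A \<Longrightarrow> wtsub s \<Longrightarrow> fsubst s A \<in> \<Delta>"
  using henkin Ax by (auto simp: henkin_def intro: prv.ax)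

lemma imp_in: "wff A \<Longrightarrow> wff B \<Longrightarrow> (A \<longrightarrow>\<^sub>f B) \<in> \<Delta> \<longleftrightarrow> (A \<in> \<Delta> \<longrightarrow> B \<in> \<Delta>)"
  using henkin by (simp add: henkin_def)

lemma all_in: "wff A \<Longrightarrow> Forall \<sigma> A \<in> \<Delta> \<longleftrightarrow> (\<forall>t. wt t \<longrightarrow> tyof t = \<sigma> \<longrightarrow> inst \<sigma> t A \<in> \<Delta>)"
  using henkin unfolding henkin_def by blast

lemma eqT_Fn_in:
  assumes "wt s" "wt t" "tyof s = (\<sigma> \<rightarrow>\<^sub>t \<tau>)" "tyof t = (\<sigma> \<rightarrow>\<^sub>t \<tau>)"
  shows "eqT (\<sigma> \<rightarrow>\<^sub>t \<tau>) s t \<in> \<Delta> \<longleftrightarrow> (\<forall>u. wt u \<longrightarrow> tyof u = \<sigma> \<longrightarrow> eqT \<tau> (s \<cdot> u) (t \<cdot> u) \<in> \<Delta>)"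
  using assms by (simp add: all_in inst_push)

lemma semiring_in: "A \<in> semiring_axioms \<Longrightarrow> wff A \<Longrightarrow> wtsub s \<Longrightarrow> fsubst s A \<in> \<Delta>"
  by (rule ax_in) (auto simp: RCA0\<omega>_def)

lemma eqT_refl: "wt t \<Longrightarrow> tyof t = \<rho> \<Longrightarrow> eqT \<rho> t t \<in> \<Delta>"
proof (induction \<rho> arbitrary: t)
  case T0
  then show ?case
    using semiring_in[of "Var T0 0 =\<^sub>N Var T0 0" "push T0 t Var"]
    by (simp add: semiring_axioms_def Let_def)
next
  case (Fn \<sigma> \<tau>)
  then show ?case by (simp add: eqT_Fn_in del: eqT.simps)
qed

lemma eqT_sym:
  "wt s \<Longrightarrow> tyof s = \<rho> \<Longrightarrow> wt t \<Longrightarrow> tyof t = \<rho> \<Longrightarrow> eqT \<rho> s t \<in> \<Delta> \<Longrightarrow> eqT \<rho> t s \<in> \<Delta>"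
proof (induction \<rho> arbitrary: s t)
  case T0
  then show ?case
    using semiring_in[of "Var T0 0 =\<^sub>N Var T0 1 \<longrightarrow>\<^sub>f Var T0 1 =\<^sub>N Var T0 0" "push T0 s (push T0 t Var)"]
    by (simp add: semiring_axioms_def imp_in Let_def)
next
  case (Fn \<sigma> \<tau>)
  from Fn.prems show ?case
    by (simp add: eqT_Fn_in Fn.IH del: eqT.simps)
qed

lemma eqT_trans:
  "wt s \<Longrightarrow> tyof s = \<rho> \<Longrightarrow> wt t \<Longrightarrow> tyof t = \<rho> \<Longrightarrow> wt u \<Longrightarrow> tyof u = \<rho> \<Longrightarrow>
    eqT \<rho> s t \<in> \<Delta> \<Longrightarrow> eqT \<rho> t u \<in> \<Delta> \<Longrightarrow> eqT \<rho> s u \<in> \<Delta>"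
proof (induction \<rho> arbitrary: s t u)
  case T0
  then show ?case
    using semiring_in[of "Var T0 0 =\<^sub>N Var T0 1 \<longrightarrow>\<^sub>f Var T0 1 =\<^sub>N Var T0 2 \<longrightarrow>\<^sub>f Var T0 0 =\<^sub>N Var T0 2"
        "push T0 s (push T0 t (push T0 u Var))"]
    by (simp add: semiring_axioms_def imp_in Let_def)
next
  case (Fn \<sigma> \<tau>)
  have "eqT \<tau> (s \<cdot> v) (u \<cdot> v) \<in> \<Delta>" if "wt v" "tyof v = \<sigma>" for v
    by (rule Fn.IH(2)[of _ "t \<cdot> v"]) (use Fn.prems that in \<open>simp_all add: eqT_Fn_in del: eqT.simps\<close>)
  with Fn.prems show ?case by (simp add: eqT_Fn_in del: eqT.simps)
qed

text \<open>The function is exchanged by the pointwise definition of \<open>eqT\<close>, the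
  argument by the extensionality axiom.\<close>

lemma eqT_app:
  assumes "wt s" "wt s'" "tyof s = (\<sigma> \<rightarrow>\<^sub>t \<tau>)" "tyof s' = (\<sigma> \<rightarrow>\<^sub>t \<tau>)" "eqT (\<sigma> \<rightarrow>\<^sub>t \<tau>) s s' \<in> \<Delta>"
    and "wt t" "wt t'" "tyof t = \<sigma>" "tyof t' = \<sigma>" "eqT \<sigma> t t' \<in> \<Delta>"
  shows "eqT \<tau> (s \<cdot> t) (s' \<cdot> t') \<in> \<Delta>"
proof (rule eqT_trans[of _ _ "s' \<cdot> t"])
  show "eqT \<tau> (s \<cdot> t) (s' \<cdot> t) \<in> \<Delta>"
    using assms by (simp add: eqT_Fn_in del: eqT.simps)
  let ?s = "push (\<sigma> \<rightarrow>\<^sub>t \<tau>) s' (push \<sigma> t (push \<sigma> t' Var))"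
  have "fsubst ?s (ext_axiom \<sigma> \<tau>) \<in> \<Delta>"
    by (rule ax_in) (use assms in \<open>auto simp: RCA0\<omega>_def ext_axiom_def Let_def\<close>)
  then show "eqT \<tau> (s' \<cdot> t) (s' \<cdot> t') \<in> \<Delta>"
    using assms by (simp add: ext_axiom_def imp_in Let_def push_def)
qed (use assms in auto)

text \<open>The equivalence depends on \<open>\<Delta>\<close>, so its classes are represented as
  sets of terms, and operations go through chosen representatives. The carrier type is thus
  \<open>tm set\<close> for every \<open>\<Delta>\<close>.\<close>

definition cls :: "tm \<Rightarrow> tm set" where
  "cls t = {u. wt u \<and> tyof u = tyof t \<and> eqT (tyof t) t u \<in> \<Delta>}"

lemma cls_eq_iff:
  assumes "wt s" "wt t" "tyof s = \<rho>" "tyof t = \<rho>"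
  shows "cls s = cls t \<longleftrightarrow> eqT \<rho> s t \<in> \<Delta>"
proof
  assume "cls s = cls t"
  moreover have "t \<in> cls t" using assms by (auto simp: cls_def eqT_refl)
  ultimately show "eqT \<rho> s t \<in> \<Delta>" using assms by (auto simp: cls_def)
next
  assume "eqT \<rho> s t \<in> \<Delta>"
  then show "cls s = cls t"
    using assms unfolding cls_def by (auto intro: eqT_trans eqT_sym)
qed

definition tD :: "ty \<Rightarrow> tm set set" where "tD \<sigma> = cls ` {t. wt t \<and> tyof t = \<sigma>}"
definition some_tm :: "tm set \<Rightarrow> tm" where "some_tm d = (SOME t. t \<in> d)"
definition tapp :: "tm set \<Rightarrow> tm set \<Rightarrow> tm set" where "tapp d d' = cls (some_tm d \<cdot> some_tm d')"
definition tlt :: "tm set \<Rightarrow> tm set \<Rightarrow> bool" where "tlt d d' \<longleftrightarrow> (some_tm d <\<^sub>N some_tm d') \<in> \<Delta>"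

lemma some_cls:
  assumes "wt t" shows "wt (some_tm (cls t))" "tyof (some_tm (cls t)) = tyof t"
    "eqT (tyof t) t (some_tm (cls t)) \<in> \<Delta>"
proof -
  have "t \<in> cls t" using assms by (auto simp: cls_def eqT_refl)
  then have "some_tm (cls t) \<in> cls t" unfolding some_tm_def by (rule someI)
  then show "wt (some_tm (cls t))" "tyof (some_tm (cls t)) = tyof t"
    "eqT (tyof t) t (some_tm (cls t)) \<in> \<Delta>" by (auto simp: cls_def)
qed

lemma tapp_cls: assumes "wt s" "wt t" "tyof s = (tyof t \<rightarrow>\<^sub>t \<tau>)" shows "tapp (cls s) (cls t) = cls (s \<cdot> t)"
proof -
  have "cls (s \<cdot> t) = cls (some_tm (cls s) \<cdot> some_tm (cls t))"
    using assms some_cls[of s] some_cls[of t]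
    by (subst cls_eq_iff[where \<rho>=\<tau>]) (auto intro!: eqT_app)
  then show ?thesis by (simp add: tapp_def)
qed

lemma less_cong_in:
  assumes "wt s" "tyof s = T0" "wt t" "tyof t = T0" "wt s'" "tyof s' = T0" "wt t'" "tyof t' = T0"
    and "(s =\<^sub>N s') \<in> \<Delta>" "(t =\<^sub>N t') \<in> \<Delta>" "(s <\<^sub>N t) \<in> \<Delta>"
  shows "(s' <\<^sub>N t') \<in> \<Delta>"
proof -
  have "(s' <\<^sub>N t) \<in> \<Delta>"
    using semiring_in[of "Var T0 0 =\<^sub>N Var T0 1 \<longrightarrow>\<^sub>f Var T0 0 <\<^sub>N Var T0 2 \<longrightarrow>\<^sub>f Var T0 1 <\<^sub>N Var T0 2"
        "push T0 s (push T0 s' (push T0 t Var))"] assms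
    by (simp add: semiring_axioms_def imp_in Let_def)
  then show ?thesis
    using semiring_in[of "Var T0 0 =\<^sub>N Var T0 1 \<longrightarrow>\<^sub>f Var T0 2 <\<^sub>N Var T0 0 \<longrightarrow>\<^sub>f Var T0 2 <\<^sub>N Var T0 1"
        "push T0 t (push T0 t' (push T0 s' Var))"] assms
    by (simp add: semiring_axioms_def imp_in Let_def)
qed

lemma tlt_cls:
  assumes "wt s" "tyof s = T0" "wt t" "tyof t = T0"
  shows "tlt (cls s) (cls t) \<longleftrightarrow> (s <\<^sub>N t) \<in> \<Delta>"
proof -
  have rep: "wt (some_tm (cls u)) \<and> tyof (some_tm (cls u)) = T0 \<and> (u =\<^sub>N some_tm (cls u)) \<in> \<Delta> \<and>
    (some_tm (cls u) =\<^sub>N u) \<in> \<Delta>" if "wt u" "tyof u = T0" for u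
    using some_cls[OF that(1)] eqT_sym[of u T0 "some_tm (cls u)"] that by simp
  show ?thesis
    using rep[of s] rep[of t] assms unfolding tlt_def by (meson less_cong_in)
qed

text \<open>Extensionality is where the Henkin property enters: agreement of two functions on the
  classes of all terms means that all instances belong to \<open>\<Delta>\<close>, and then so does
  the universal formula behind \<open>eqT\<close>.\<close>

lemma term_structure: "type_structure tD tapp (\<lambda>c. cls (Con c))"
proof
  show "cls (Con c) \<in> tD (cty c)" for c by (auto simp: tD_def)
  show "tapp f d \<in> tD \<tau>" if "f \<in> tD (\<sigma> \<rightarrow>\<^sub>t \<tau>)" "d \<in> tD \<sigma>" for f d \<sigma> \<tau>
    using that by (auto simp: tD_def tapp_cls)
  show "tD \<sigma> \<noteq> {}" for \<sigma>
    by (auto simp: tD_def intro!: exI[of _ "Var \<sigma> 0"])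
  show "f = g" if "f \<in> tD (\<sigma> \<rightarrow>\<^sub>t \<tau>)" "g \<in> tD (\<sigma> \<rightarrow>\<^sub>t \<tau>)" and eq: "\<And>d. d \<in> tD \<sigma> \<Longrightarrow> tapp f d = tapp g d"
    for f g \<sigma> \<tau>
  proof -
    obtain s t where s: "f = cls s" "wt s" "tyof s = (\<sigma> \<rightarrow>\<^sub>t \<tau>)" and t: "g = cls t" "wt t" "tyof t = (\<sigma> \<rightarrow>\<^sub>t \<tau>)"
      using \<open>f \<in> _\<close> \<open>g \<in> _\<close> by (auto simp: tD_def)
    have "eqT \<tau> (s \<cdot> u) (t \<cdot> u) \<in> \<Delta>" if "wt u" "tyof u = \<sigma>" for u
      using eq[of "cls u"] that s t by (simp add: tapp_cls tD_def cls_eq_iff[where \<rho>=\<tau>])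
    then have "eqT (\<sigma> \<rightarrow>\<^sub>t \<tau>) s t \<in> \<Delta>" using s t by (simp add: eqT_Fn_in del: eqT.simps)
    then show ?thesis using s t cls_eq_iff by blast
  qed
qed

interpretation T: type_structure tD tapp "\<lambda>c. cls (Con c)" tlt
  by (rule term_structure)

lemma ball_tD: "(\<forall>d \<in> tD \<sigma>. P d) \<longleftrightarrow> (\<forall>t. wt t \<longrightarrow> tyof t = \<sigma> \<longrightarrow> P (cls t))"
  by (auto simp: tD_def)

lemma eval_cls: "wtsub s \<Longrightarrow> wt t \<Longrightarrow> T.eval (\<lambda>\<sigma> n. cls (s \<sigma> n)) t = cls (tsubst s t)"
proof (induction t)
  case (App t u)
  then obtain \<tau> where ty: "tyof t = (tyof u \<rightarrow>\<^sub>t \<tau>)" and wt: "wt t" "wt u" by (metis wt.simps(3))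
  with App show ?case by (simp add: tapp_cls[where \<tau>=\<tau>])
qed auto

text \<open>Truth lemma. It is stated for arbitrary substitutions because under a quantifier the
  environment is extended by the class of a term, which matches extending the substitution by that
  term.\<close>

lemma sat_cls: "wtsub s \<Longrightarrow> wff A \<Longrightarrow> T.sat (\<lambda>\<sigma> n. cls (s \<sigma> n)) A \<longleftrightarrow> fsubst s A \<in> \<Delta>"
proof (induction A arbitrary: s)
  case Bot
  then show ?case using henkin by (simp add: henkin_def)
next
  case (Eq t u)
  then show ?case by (simp add: eval_cls cls_eq_iff[where \<rho>=T0])
next
  case (Less t u)
  then show ?case by (simp add: eval_cls tlt_cls)
next
  case (Imp A B)
  then show ?case by (simp add: imp_in)
next
  case (Forall \<sigma> A)
  have "(\<lambda>\<tau> n. cls (push \<sigma> t s \<tau> n)) = push \<sigma> (cls t) (\<lambda>\<tau> n. cls (s \<tau> n))" for t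
    by (auto simp: push_def fun_eq_iff split: nat.split)
  then have "T.sat (push \<sigma> (cls t) (\<lambda>\<tau> n. cls (s \<tau> n))) A \<longleftrightarrow> inst \<sigma> t (fsubst (upv \<sigma> s) A) \<in> \<Delta>"
    if "wt t" "tyof t = \<sigma>" for t
    using Forall.IH[of "push \<sigma> t s"] Forall.prems that by (simp add: inst_upv)
  then show ?case using Forall.prems by (simp add: all_in ball_tD)
qed

lemma valid_cls:
  assumes "T.valid e" obtains s where "wtsub s" "e = (\<lambda>\<sigma> n. cls (s \<sigma> n))"
proof -
  have "\<forall>\<sigma> n. \<exists>t. wt t \<and> tyof t = \<sigma> \<and> e \<sigma> n = cls t"
    using assms by (force simp: T.valid_def tD_def)
  then obtain s where s: "\<forall>\<sigma> n. wt (s \<sigma> n) \<and> tyof (s \<sigma> n) = \<sigma> \<and> e \<sigma> n = cls (s \<sigma> n)" by metis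
  show thesis by (rule that[of s]) (use s in \<open>auto simp: wtsub_def fun_eq_iff\<close>)
qed

lemma sat_axiom: "T.valid e \<Longrightarrow> A \<in> Ax \<Longrightarrow> wff A \<Longrightarrow> T.sat e A"
  using henkin by (auto elim!: valid_cls simp: sat_cls henkin_def intro: prv.ax)

lemma valid_Var: "T.valid (\<lambda>\<sigma> n. cls (Var \<sigma> n))"
  by (auto simp: T.valid_def tD_def)

end

definition is_model ::
  "fm set \<Rightarrow> (ty \<Rightarrow> 'd set) \<Rightarrow> ('d \<Rightarrow> 'd \<Rightarrow> 'd) \<Rightarrow> (const \<Rightarrow> 'd) \<Rightarrow> ('d \<Rightarrow> 'd \<Rightarrow> bool) \<Rightarrow> bool" where
  "is_model Ax D app con lt \<longleftrightarrow> type_structure D app con \<and>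
    (\<forall>A e. A \<in> Ax \<longrightarrow> wff A \<longrightarrow> type_structure.valid D e \<longrightarrow> type_structure.sat D app con lt e A)"

text \<open>The carrier \<open>tm set\<close> is the same for all \<open>Ax\<close> and
  \<open>A\<close>; this is what later allows a type of numbers to be chosen among all countermodels
  of that shape. The inclusion of \<open>RCA0\<omega>\<close> provides the equality and
  extensionality axioms behind the term model.\<close>

theorem completeness:
  assumes Ax: "RCA0\<omega> \<subseteq> Ax" and A: "wff A" and unprovable: "\<not> prv Ax [] A"
  obtains D app con lt e where "is_model Ax (D :: ty \<Rightarrow> tm set set) app con lt"
    "type_structure.valid D e" "\<not> type_structure.sat D app con lt e A"
proof -
  have "\<not> prv Ax [\<not>\<^sub>f A] \<bottom>\<^sub>f" using unprovable A prv.raa by blast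
  then obtain \<Delta> where \<Delta>: "henkin Ax \<Delta>" "set [\<not>\<^sub>f A] \<subseteq> \<Delta>"
    by (rule henkin_extension) (use A in auto)
  interpret T: type_structure "tD \<Delta>" "tapp \<Delta>" "\<lambda>c. cls \<Delta> (Con c)" "tlt \<Delta>"
    by (rule term_structure[OF Ax \<Delta>(1)])
  have "is_model Ax (tD \<Delta>) (tapp \<Delta>) (\<lambda>c. cls \<Delta> (Con c)) (tlt \<Delta>)"
    using term_structure[OF Ax \<Delta>(1)] sat_axiom[OF Ax \<Delta>(1)] by (simp add: is_model_def)
  moreover have "\<not> T.sat (\<lambda>\<sigma> n. cls \<Delta> (Var \<sigma> n)) A"
    using sat_cls[OF Ax \<Delta>(1) wtsub_Var, of "\<not>\<^sub>f A"] \<Delta>(2) A by simp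
  ultimately show thesis using that valid_Var[OF Ax \<Delta>(1)] by blast
qed

section \<open>The ordered field generated by an ordered semiring\<close>

text \<open>A pair stands for the formal difference of its components. This gives the integers over
  a semiring; their fractions serve as the rationals over the numbers of a model.\<close>

definition gz_rel :: "'a::linordered_semidom \<times> 'a \<Rightarrow> 'a \<times> 'a \<Rightarrow> bool" where
  "gz_rel p q \<longleftrightarrow> fst p + snd q = fst q + snd p"

lemma equivp_gz_rel: "equivp (gz_rel :: 'a::linordered_semidom \<times> 'a \<Rightarrow> _)"
proof (rule equivpI)
  show "transp (gz_rel :: 'a \<times> 'a \<Rightarrow> _)"
  proof (rule transpI)
    fix p q r :: "'a \<times> 'a"
    assume "gz_rel p q" "gz_rel q r"
    then have "(fst p + snd q) + (fst q + snd r) = (fst q + snd p) + (fst r + snd q)"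
      by (simp add: gz_rel_def)
    then have "(fst p + snd r) + (fst q + snd q) = (fst r + snd p) + (fst q + snd q)"
      by (simp only: ac_simps)
    then show "gz_rel p r" by (simp add: gz_rel_def)
  qed
qed (auto simp: gz_rel_def reflp_def symp_def)

quotient_type (overloaded) 'a gz = "'a::linordered_semidom \<times> 'a" / gz_rel
  morphisms Rep_gz Abs_gz
  by (rule equivp_gz_rel)

instantiation gz :: (linordered_semidom) comm_ring_1
begin

lift_definition zero_gz :: "'a gz" is "(0, 0)" .
lift_definition one_gz :: "'a gz" is "(1, 0)" .
lift_definition plus_gz :: "'a gz \<Rightarrow> 'a gz \<Rightarrow> 'a gz" is "\<lambda>p q. (fst p + fst q, snd p + snd q)"
proof -
  fix p p' q q' :: "'a \<times> 'a"
  assume "gz_rel p p'" "gz_rel q q'"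
  then have "(fst p + snd p') + (fst q + snd q') = (fst p' + snd p) + (fst q' + snd q)"
    by (simp add: gz_rel_def)
  then show "gz_rel (fst p + fst q, snd p + snd q) (fst p' + fst q', snd p' + snd q')"
    by (simp add: gz_rel_def ac_simps)
qed
lift_definition uminus_gz :: "'a gz \<Rightarrow> 'a gz" is "\<lambda>p. (snd p, fst p)"
  by (auto simp: gz_rel_def ac_simps)
definition minus_gz :: "'a gz \<Rightarrow> 'a gz \<Rightarrow> 'a gz" where "minus_gz x y = x + - y"
lift_definition times_gz :: "'a gz \<Rightarrow> 'a gz \<Rightarrow> 'a gz"
  is "\<lambda>p q. (fst p * fst q + snd p * snd q, fst p * snd q + snd p * fst q)"
proof -
  fix p p' q q' :: "'a \<times> 'a"
  assume p: "gz_rel p p'" and q: "gz_rel q q'"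
  \<comment> \<open>The factors are exchanged one at a time, and the two results are joined by
    transitivity.\<close>
  let ?m = "\<lambda>p q. (fst p * fst q + snd p * snd q, fst p * snd q + snd p * fst q)"
  have "(fst p + snd p') * fst q + (fst p' + snd p) * snd q = (fst p' + snd p) * fst q + (fst p + snd p') * snd q"
    using p by (simp add: gz_rel_def)
  then have 1: "gz_rel (?m p q) (?m p' q)"
    by (simp add: gz_rel_def algebra_simps)
  have "(fst q + snd q') * fst p' + (fst q' + snd q) * snd p' = (fst q' + snd q) * fst p' + (fst q + snd q') * snd p'"
    using q by (simp add: gz_rel_def)
  then have "gz_rel (?m p' q) (?m p' q')"
    by (simp add: gz_rel_def algebra_simps)
  with 1 show "gz_rel (?m p q) (?m p' q')"
    using equivp_transp[OF equivp_gz_rel] by blast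
qed

instance
  by intro_classes (unfold minus_gz_def, (transfer; simp add: gz_rel_def algebra_simps)+)

end

instantiation gz :: (linordered_semidom) linordered_idom
begin

lift_definition less_eq_gz :: "'a gz \<Rightarrow> 'a gz \<Rightarrow> bool" is "\<lambda>p q. fst p + snd q \<le> fst q + snd p"
proof -
  fix p p' q q' :: "'a \<times> 'a"
  assume p: "gz_rel p p'" and q: "gz_rel q q'"
  have "fst p + snd q \<le> fst q + snd p \<longleftrightarrow> (fst p + snd q) + (snd p' + fst q') \<le> (fst q + snd p) + (snd p' + fst q')"
    by simp
  also have "(fst p + snd q) + (snd p' + fst q') = (fst p' + snd q') + (snd p + fst q)"
  proof -
    have "(fst p + snd q) + (snd p' + fst q') = (fst p + snd p') + (fst q' + snd q)" by (simp only: ac_simps)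
    also have "\<dots> = (fst p' + snd p) + (fst q + snd q')" using p q by (simp only: gz_rel_def)
    finally show ?thesis by (simp only: ac_simps)
  qed
  also have "(fst q + snd p) + (snd p' + fst q') = (fst q' + snd p') + (snd p + fst q)"
    by (simp add: ac_simps)
  finally show "fst p + snd q \<le> fst q + snd p \<longleftrightarrow> fst p' + snd q' \<le> fst q' + snd p'"
    by simp
qed

definition less_gz :: "'a gz \<Rightarrow> 'a gz \<Rightarrow> bool" where "less_gz x y \<longleftrightarrow> \<not> y \<le> x"
definition abs_gz :: "'a gz \<Rightarrow> 'a gz" where "abs_gz x = (if x < 0 then - x else x)"
definition sgn_gz :: "'a gz \<Rightarrow> 'a gz" where "sgn_gz x = (if x = 0 then 0 else if 0 < x then 1 else - 1)"

instance
proof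
  fix x y z :: "'a gz"
  show lin: "x \<le> y \<or> y \<le> x" by transfer auto
  show antisym: "x = y" if "x \<le> y" "y \<le> x"
    using that by transfer (auto simp: gz_rel_def intro: antisym)
  show "x < y \<longleftrightarrow> x \<le> y \<and> \<not> y \<le> x" using lin by (auto simp: less_gz_def)
  show "x \<le> x" by transfer simp
  show "x \<le> z" if "x \<le> y" "y \<le> z"
    using that
  proof transfer
    fix p q r :: "'a \<times> 'a"
    assume "fst p + snd q \<le> fst q + snd p" "fst q + snd r \<le> fst r + snd q"
    then have "(fst p + snd q) + (fst q + snd r) \<le> (fst q + snd p) + (fst r + snd q)"
      by (rule add_mono)
    then have "(fst p + snd r) + (fst q + snd q) \<le> (fst r + snd p) + (fst q + snd q)"
      by (simp only: ac_simps)
    then show "fst p + snd r \<le> fst r + snd p" by simp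
  qed
  show "z + x \<le> z + y" if "x \<le> y"
    using that
  proof transfer
    fix p q r :: "'a \<times> 'a"
    assume "fst p + snd q \<le> fst q + snd p"
    then have "(fst p + snd q) + (fst r + snd r) \<le> (fst q + snd p) + (fst r + snd r)"
      by simp
    then show "fst (fst r + fst p, snd r + snd p) + snd (fst r + fst q, snd r + snd q)
      \<le> fst (fst r + fst q, snd r + snd q) + snd (fst r + fst p, snd r + snd p)"
      by (simp add: ac_simps)
  qed
  show "z * x < z * y" if "x < y" "0 < z"
    using that unfolding less_gz_def
  proof transfer
    fix p q r :: "'a \<times> 'a"
    assume "\<not> fst q + snd p \<le> fst p + snd q" "\<not> fst r + snd (0, 0) \<le> fst (0, 0) + snd r"
    then have *: "fst p + snd q < fst q + snd p" "snd r < fst r" by auto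
    \<comment> \<open>The positive number denoted by \<open>r\<close>. Multiplying the assumption by
      \<open>k\<close> and adding \<open>snd r\<close> times the sum of all components of
      \<open>p\<close> and \<open>q\<close> to both sides gives the claim without negative
      numbers.\<close>
    define k where "k = fst r - snd r"
    have k: "fst r = snd r + k" using *(2) by (simp add: k_def)
    with *(2) have "0 < k" by simp
    with *(1) have "k * (fst p + snd q) < k * (fst q + snd p)" by (rule mult_strict_left_mono)
    then have "k * (fst p + snd q) + snd r * (fst p + snd q + fst q + snd p)
      < k * (fst q + snd p) + snd r * (fst p + snd q + fst q + snd p)" by (rule add_strict_right_mono)
    then have "(fst r * (fst p + snd q)) + snd r * (fst q + snd p) < fst r * (fst q + snd p) + snd r * (fst p + snd q)"
      unfolding k by (simp only: algebra_simps)
    then show "\<not> fst (fst r * fst q + snd r * snd q, fst r * snd q + snd r * fst q) +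
        snd (fst r * fst p + snd r * snd p, fst r * snd p + snd r * fst p)
      \<le> fst (fst r * fst p + snd r * snd p, fst r * snd p + snd r * fst p) +
        snd (fst r * fst q + snd r * snd q, fst r * snd q + snd r * fst q)"
      by (simp add: not_le algebra_simps)
  qed
  show "\<bar>x\<bar> = (if x < 0 then - x else x)" by (rule abs_gz_def)
  show "sgn x = (if x = 0 then 0 else if 0 < x then 1 else - 1)" by (rule sgn_gz_def)
qed

end

lift_definition gz_of :: "'a::linordered_semidom \<Rightarrow> 'a gz" is "\<lambda>a. (a, 0)" .

definition qof :: "'a::linordered_semidom \<Rightarrow> 'a gz fract" where
  "qof a = Fract (gz_of a) 1"

lemma qof_simps [simp]:
  fixes a b :: "'a::linordered_semidom"
  shows "qof 0 = (0 :: 'a gz fract)" "qof 1 = (1 :: 'a gz fract)" "qof (a + b) = qof a + qof b" "qof (a * b) = qof a * qof b"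
proof -
  have "gz_of 0 = (0 :: 'a gz)" "gz_of 1 = (1 :: 'a gz)"
    "gz_of (a + b) = gz_of a + gz_of b" "gz_of (a * b) = gz_of a * gz_of b"
    by (transfer; simp add: gz_rel_def)+
  then show "qof 0 = (0 :: 'a gz fract)" "qof 1 = (1 :: 'a gz fract)" "qof (a + b) = qof a + qof b" "qof (a * b) = qof a * qof b"
    by (simp_all add: qof_def Zero_fract_def One_fract_def)
qed

lemma qof_2 [simp]: "qof (2 :: 'a::linordered_semidom) = 2"
  by (metis qof_simps(2,3) one_add_one)

lemma qof_less_iff [simp]: "qof a < qof b \<longleftrightarrow> a < b"
  by (simp add: qof_def less_gz_def, transfer, simp add: not_le)

lemma qof_le_iff [simp]: "qof a \<le> qof b \<longleftrightarrow> a \<le> b"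
  using qof_less_iff[of b a] by (simp add: not_less[symmetric] del: qof_less_iff)

lemma qof_eq_iff [simp]: "qof a = qof b \<longleftrightarrow> a = b"
  by (simp add: order_eq_iff)

lemma qof_diff: "b \<le> a \<Longrightarrow> qof (a - b) = qof a - qof b"
  using qof_simps(3)[of "a - b" b] by simp

section \<open>Models of the theory with full induction\<close>

locale omega_model = type_structure +
  assumes sat_axioms: "A \<in> RCA0\<omega> \<union> IND \<Longrightarrow> wff A \<Longrightarrow> valid e \<Longrightarrow> sat e A"
begin

sublocale comb_model
proof
  show "sat e (K_axiom \<sigma> \<tau>)" if "valid e" for e \<sigma> \<tau>
  proof (rule sat_axioms)
    show "K_axiom \<sigma> \<tau> \<in> RCA0\<omega> \<union> IND" unfolding RCA0\<omega>_def by blast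
  qed (simp_all add: K_axiom_def Let_def that)
  show "sat e (S_axiom \<rho> \<sigma> \<tau>)" if "valid e" for e \<rho> \<sigma> \<tau>
  proof (rule sat_axioms)
    show "S_axiom \<rho> \<sigma> \<tau> \<in> RCA0\<omega> \<union> IND" unfolding RCA0\<omega>_def by blast
  qed (simp_all add: S_axiom_def Let_def that)
qed

abbreviation "pl x y \<equiv> app (app (con Plus) x) y"
abbreviation "ti x y \<equiv> app (app (con Times) x) y"

lemma con0_D [simp]: "con Zero \<in> D T0" "con One \<in> D T0"
  using con_D[of Zero] con_D[of One] by simp_all

lemma pl_D [simp]: "x \<in> D T0 \<Longrightarrow> y \<in> D T0 \<Longrightarrow> pl x y \<in> D T0"
  using con_D[of Plus] app_D by (metis cty.simps(3))

lemma ti_D [simp]: "x \<in> D T0 \<Longrightarrow> y \<in> D T0 \<Longrightarrow> ti x y \<in> D T0"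
  using con_D[of Times] app_D by (metis cty.simps(4))

lemma semiring_axiom:
  assumes "A \<in> semiring_axioms" "wff A" "x \<in> D T0" "y \<in> D T0" "z \<in> D T0"
  shows "sat (push T0 x (push T0 y (push T0 z e0))) A"
  by (rule sat_axioms) (use assms in \<open>auto simp: RCA0\<omega>_def\<close>)

lemma raw_laws:
  assumes "x \<in> D T0" "y \<in> D T0" "z \<in> D T0"
  shows "pl (pl x y) z = pl x (pl y z)" "pl x y = pl y x" "pl x (con Zero) = x"
    "ti (ti x y) z = ti x (ti y z)" "ti x y = ti y x" "ti x (con One) = x" "ti x (con Zero) = con Zero"
    "ti x (pl y z) = pl (ti x y) (ti x z)"
    "\<not> lt x x" "lt x y \<Longrightarrow> lt y z \<Longrightarrow> lt x z" "lt x y \<or> x = y \<or> lt y x" "lt (con Zero) (con One)"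
    "lt x y \<Longrightarrow> lt (pl x z) (pl y z)" "lt (con Zero) z \<Longrightarrow> lt x y \<Longrightarrow> lt (ti x z) (ti y z)"
proof -
  let ?e = "push T0 x (push T0 y (push T0 z e0))"
  let ?x = "Var T0 0" and ?y = "Var T0 1" and ?z = "Var T0 2"
  note ax = semiring_axiom[OF _ _ assms]
  have mem: "(?x +\<^sub>N ?y) +\<^sub>N ?z =\<^sub>N ?x +\<^sub>N (?y +\<^sub>N ?z) \<in> semiring_axioms"
    "?x +\<^sub>N ?y =\<^sub>N ?y +\<^sub>N ?x \<in> semiring_axioms" "?x +\<^sub>N 0\<^sub>N =\<^sub>N ?x \<in> semiring_axioms"
    "(?x *\<^sub>N ?y) *\<^sub>N ?z =\<^sub>N ?x *\<^sub>N (?y *\<^sub>N ?z) \<in> semiring_axioms"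
    "?x *\<^sub>N ?y =\<^sub>N ?y *\<^sub>N ?x \<in> semiring_axioms" "?x *\<^sub>N 1\<^sub>N =\<^sub>N ?x \<in> semiring_axioms"
    "?x *\<^sub>N 0\<^sub>N =\<^sub>N 0\<^sub>N \<in> semiring_axioms"
    "?x *\<^sub>N (?y +\<^sub>N ?z) =\<^sub>N ?x *\<^sub>N ?y +\<^sub>N ?x *\<^sub>N ?z \<in> semiring_axioms"
    "(\<not>\<^sub>f ?x <\<^sub>N ?x) \<in> semiring_axioms"
    "(?x <\<^sub>N ?y \<longrightarrow>\<^sub>f ?y <\<^sub>N ?z \<longrightarrow>\<^sub>f ?x <\<^sub>N ?z) \<in> semiring_axioms"
    "(?x <\<^sub>N ?y \<or>\<^sub>f ?x =\<^sub>N ?y \<or>\<^sub>f ?y <\<^sub>N ?x) \<in> semiring_axioms"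
    "0\<^sub>N <\<^sub>N 1\<^sub>N \<in> semiring_axioms"
    "(?x <\<^sub>N ?y \<longrightarrow>\<^sub>f ?x +\<^sub>N ?z <\<^sub>N ?y +\<^sub>N ?z) \<in> semiring_axioms"
    "(0\<^sub>N <\<^sub>N ?z \<longrightarrow>\<^sub>f ?x <\<^sub>N ?y \<longrightarrow>\<^sub>f ?x *\<^sub>N ?z <\<^sub>N ?y *\<^sub>N ?z) \<in> semiring_axioms"
    unfolding semiring_axioms_def Let_def by (simp_all only: insert_iff simp_thms)
  show "pl (pl x y) z = pl x (pl y z)" using ax[OF mem(1)] by simp
  show "pl x y = pl y x" using ax[OF mem(2)] by simp
  show "pl x (con Zero) = x" using ax[OF mem(3)] by simp
  show "ti (ti x y) z = ti x (ti y z)" using ax[OF mem(4)] by simp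
  show "ti x y = ti y x" using ax[OF mem(5)] by simp
  show "ti x (con One) = x" using ax[OF mem(6)] by simp
  show "ti x (con Zero) = con Zero" using ax[OF mem(7)] by simp
  show "ti x (pl y z) = pl (ti x y) (ti x z)" using ax[OF mem(8)] by simp
  show "\<not> lt x x" using ax[OF mem(9)] by simp
  show "lt x y \<Longrightarrow> lt y z \<Longrightarrow> lt x z" using ax[OF mem(10)] by simp
  show "lt x y \<or> x = y \<or> lt y x" using ax[OF mem(11)] by auto
  show "lt (con Zero) (con One)" using ax[OF mem(12)] by simp
  show "lt x y \<Longrightarrow> lt (pl x z) (pl y z)" using ax[OF mem(13)] by simp
  show "lt (con Zero) z \<Longrightarrow> lt x y \<Longrightarrow> lt (ti x z) (ti y z)" using ax[OF mem(14)] by simp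
qed

text \<open>Only properties given by a formula admit induction. The environment carries the
  parameters, and replacing the induction variable by its successor inside \<open>A\<close> amounts
  to a \<open>push\<close> of the successor.\<close>

lemma raw_induct:
  assumes e: "valid e" and A: "wff A" and base: "sat (push T0 (con Zero) e) A"
    and step: "\<And>n. n \<in> D T0 \<Longrightarrow> sat (push T0 n e) A \<Longrightarrow> sat (push T0 (pl n (con One)) e) A"
    and n: "n \<in> D T0"
  shows "sat (push T0 n e) A"
proof -
  have w: "wtsub (\<lambda>\<tau> n. if \<tau> = T0 \<and> n = 0 then Var T0 0 +\<^sub>N 1\<^sub>N else Var \<tau> n)"
    by (simp add: wtsub_def)
  have "(\<lambda>\<tau> k. eval (push T0 n e) (if \<tau> = T0 \<and> k = 0 then Var T0 0 +\<^sub>N 1\<^sub>N else Var \<tau> k))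
      = push T0 (pl n (con One)) e" for n
    by (auto simp: fun_eq_iff push_def split: nat.split)
  moreover have "sat e (ind_ax A)"
    by (rule sat_axioms) (use A e w in \<open>auto simp: IND_def ind_ax_def\<close>)
  ultimately show ?thesis
    using base step n by (auto simp: ind_ax_def sat_fsubst)
qed

lemma raw_nonneg: "n \<in> D T0 \<Longrightarrow> n = con Zero \<or> lt (con Zero) n"
proof -
  let ?A = "Var T0 0 =\<^sub>N 0\<^sub>N \<or>\<^sub>f 0\<^sub>N <\<^sub>N Var T0 0"
  assume n: "n \<in> D T0"
  have "sat (push T0 n e0) ?A"
  proof (rule raw_induct[OF _ _ _ _ n])
    show "sat (push T0 (pl m (con One)) e0) ?A" if m: "m \<in> D T0" "sat (push T0 m e0) ?A" for m
    proof -
      have "lt (con Zero) (pl m (con One))"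
      proof (cases "m = con Zero")
        case True
        then show ?thesis using raw_laws(2,3,12) m con0_D by metis
      next
        case False
        then have "lt (pl (con Zero) (con One)) (pl m (con One))" using m raw_laws(13) by auto
        then show ?thesis using raw_laws(2,3,10,12) m con0_D pl_D by metis
      qed
      then show ?thesis by simp
    qed
  qed auto
  then show ?thesis by auto
qed

lemma raw_pred: "n \<in> D T0 \<Longrightarrow> n = con Zero \<or> (\<exists>m \<in> D T0. n = pl m (con One))"
proof -
  let ?A = "Var T0 0 =\<^sub>N 0\<^sub>N \<or>\<^sub>f Exists T0 (Var T0 1 =\<^sub>N Var T0 0 +\<^sub>N 1\<^sub>N)"
  assume n: "n \<in> D T0"
  have "sat (push T0 n e0) ?A"
    by (rule raw_induct[OF _ _ _ _ n]) auto
  then show ?thesis by auto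
qed

text \<open>The source of subtraction in the later type of numbers. The difference obtained for
  \<open>m\<close> is not zero if \<open>m + 1\<close> is still smaller than \<open>y\<close>, so it
  has a predecessor, which is the difference for \<open>m + 1\<close>.\<close>

lemma raw_diff: "x \<in> D T0 \<Longrightarrow> y \<in> D T0 \<Longrightarrow> lt x y \<Longrightarrow> \<exists>c \<in> D T0. y = pl x c"
proof -
  let ?A = "Forall T0 (Var T0 1 <\<^sub>N Var T0 0 \<longrightarrow>\<^sub>f Exists T0 (Var T0 1 =\<^sub>N Var T0 2 +\<^sub>N Var T0 0))"
  assume x: "x \<in> D T0" and y: "y \<in> D T0" "lt x y"
  have "sat (push T0 x e0) ?A"
  proof (rule raw_induct[OF _ _ _ _ x])
    have "\<exists>c \<in> D T0. y = pl (con Zero) c" if "y \<in> D T0" for y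
      using that raw_laws(2,3) con0_D by metis
    then show "sat (push T0 (con Zero) e0) ?A" by simp
    show "sat (push T0 (pl m (con One)) e0) ?A" if m: "m \<in> D T0" and IH: "sat (push T0 m e0) ?A" for m
    proof -
      have "\<exists>c \<in> D T0. y = pl (pl m (con One)) c" if y: "y \<in> D T0" "lt (pl m (con One)) y" for y
      proof -
        have mm: "lt m (pl m (con One))"
          using raw_laws(13)[of "con Zero" "con One" m] raw_laws(2,3,12) m con0_D by metis
        then have "lt m y" using raw_laws(10)[of m "pl m (con One)" y] y m by simp
        then obtain c where c: "c \<in> D T0" "y = pl m c" using IH y by auto
        have "c \<noteq> con Zero"
          using c y m mm raw_laws(3,9,10) con0_D pl_D by metis
        then obtain d where "d \<in> D T0" "c = pl d (con One)" using raw_pred c by blast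
        then show ?thesis using c m raw_laws(1,2) con0_D by metis
      qed
      then show ?thesis by simp
    qed
  qed auto
  then show ?thesis using y by simp
qed

end

section \<open>Arithmetic in a model\<close>

abbreviation T2f :: ty where "T2f \<equiv> T0 \<rightarrow>\<^sub>t T0 \<rightarrow>\<^sub>t T0"
abbreviation TW :: ty where "TW \<equiv> T0 \<rightarrow>\<^sub>t T1"
abbreviation TY :: ty where "TY \<equiv> T1 \<rightarrow>\<^sub>t T0"
abbreviation TA :: ty where "TA \<equiv> T1 \<rightarrow>\<^sub>t T1"

section \<open>Well-typedness of the defined terms and formulas\<close>

lemma wt_consts [simp]:
  "wt predC" "tyof predC = T1" "wt monusC" "tyof monusC = T2f" "wt ifzeroC" "tyof ifzeroC = (T0 \<rightarrow>\<^sub>t T2f)"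
  "wt pow2C" "tyof pow2C = T1" "wt triC" "tyof triC = T1"
  by (simp_all add: predC_def monusC_def ifzeroC_def pow2C_def triC_def)

lemma tv_consts [simp]: "tv triC = {}" "tv monusC = {}" "tv ifzeroC = {}" "tv predC = {}"
  by (simp_all add: triC_def monusC_def ifzeroC_def predC_def)

lemma wt_rootC [simp]: "wt rootC" "tyof rootC = T1" "tv rootC = {}"
  by (simp_all add: rootC_def)

lemma wt_pair [simp]: "wt pairC" "tyof pairC = T2f" "wt proj1C" "tyof proj1C = T1"
  by (simp_all add: pairC_def proj1C_def)

lemma wt_pair2 [simp]: "wt proj2C" "tyof proj2C = T1"
  by (simp_all add: proj2C_def)

lemma wt_qmk [simp]: "wt qmkC" "tyof qmkC = (T0 \<rightarrow>\<^sub>t T2f)"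
  by (simp_all add: qmkC_def)

lemma wt_qadd [simp]: "wt qaddC" "tyof qaddC = T2f" "wt qnegC" "tyof qnegC = T1" "wt qabsC" "tyof qabsC = T1"
  by (simp_all add: qaddC_def qnegC_def qabsC_def Let_def)

lemma wff_qless [simp]: "wt s \<Longrightarrow> tyof s = T0 \<Longrightarrow> wt t \<Longrightarrow> tyof t = T0 \<Longrightarrow> wff (s <\<^sub>Q t)"
  by (simp add: qless_def)

lemma wff_is_real [simp]: "wt x \<Longrightarrow> tyof x = T1 \<Longrightarrow> wff (is_real x)"
  by (simp add: is_real_def Let_def)

lemma wff_reals [simp]:
  assumes "wt x" "tyof x = T1" "wt y" "tyof y = T1"
  shows "wff (x =\<^sub>R y)" "wff (x <\<^sub>R y)"
  using assms by (simp_all add: eqR_def lessR_def Let_def)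

lemma wff_in01 [simp]: "wt x \<Longrightarrow> tyof x = T1 \<Longrightarrow> wff (in01 x)"
  by (simp add: in01_def)

lemma wff_fin01 [simp]: "wt l \<Longrightarrow> tyof l = T0 \<Longrightarrow> wt w \<Longrightarrow> tyof w = TW \<Longrightarrow> wff (fin01 l w)"
  by (simp add: fin01_def Let_def)

lemma wt_rsum [simp]:
  assumes "wt a" "tyof a = TA" "wt l" "tyof l = T0" "wt w" "tyof w = TW"
  shows "wt (rsum a l w)" "tyof (rsum a l w) = T1"
  using assms by (simp_all add: rsum_def Let_def)

lemma wt_rabs [simp]: "wt x \<Longrightarrow> tyof x = T1 \<Longrightarrow> wt (rabs x)" "wt x \<Longrightarrow> tyof x = T1 \<Longrightarrow> tyof (rabs x) = T1"
  by (simp_all add: rabs_def)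

lemma wff_disjoint01 [simp]:
  assumes "wt k" "tyof k = T0" "wt u" "tyof u = TW" "wt l" "tyof l = T0" "wt w" "tyof w = TW"
  shows "wff (disjoint01 k u l w)"
  using assms by (simp add: disjoint01_def Let_def)

lemma wff_Cauchy_sum [simp]: "wt a \<Longrightarrow> tyof a = TA \<Longrightarrow> wff (Cauchy_sum a)"
  by (simp add: Cauchy_sum_def Let_def)

lemma wff_functions [simp]:
  "wt Y \<Longrightarrow> tyof Y = TY \<Longrightarrow> wff (natfun01 Y)"
  "wt a \<Longrightarrow> tyof a = TA \<Longrightarrow> wff (realfun01 a)"
  "wt a \<Longrightarrow> tyof a = TA \<Longrightarrow> wff (nonneg01 a)"
  by (simp_all add: natfun01_def realfun01_def nonneg01_def Let_def)

text \<open>The domain of numbers is only a set; here it is identified with a type of class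
  \<open>linordered_semidom\<close>, which brings the algebra of that class and its fraction field.
  The last assumption settles the differences that the class leaves open, in agreement with the
  truncated subtraction of the language.\<close>

locale num_model = omega_model D app con lt
  for D :: "ty \<Rightarrow> 'd set" and app con lt +
  fixes num :: "'n::linordered_semidom \<Rightarrow> 'd"
  assumes range_num: "range num = D T0"
    and num_eq_iff [simp]: "num a = num b \<longleftrightarrow> a = b"
    and con_Zero: "con Zero = num 0" and con_One: "con One = num 1"
    and num_plus: "pl (num a) (num b) = num (a + b)"
    and num_times: "ti (num a) (num b) = num (a * b)"
    and num_less: "lt (num a) (num b) \<longleftrightarrow> a < b"
    and num_diff: "a \<le> b \<Longrightarrow> a - b = (0 :: 'n)"
begin

lemma num_D [simp]: "num n \<in> D T0"
  using range_num by blast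

lemma ball_D0 [simp]: "(\<forall>d \<in> D T0. P d) \<longleftrightarrow> (\<forall>n. P (num n))"
  by (auto simp: range_num[symmetric])

definition nm :: "'d \<Rightarrow> 'n" where "nm = inv num"

lemma nm_num [simp]: "nm (num n) = n"
  by (simp add: nm_def inv_f_f inj_def)

lemma num_nm: "d \<in> D T0 \<Longrightarrow> num (nm d) = d"
  by (auto simp: range_num[symmetric])

definition at :: "'d \<Rightarrow> 'n \<Rightarrow> 'n" where "at f n = nm (app f (num n))"

lemma num_at: "f \<in> D T1 \<Longrightarrow> app f (num n) = num (at f n)"
  by (simp add: at_def num_nm app_D[where \<sigma>=T0])

definition nv :: "(ty \<Rightarrow> nat \<Rightarrow> 'd) \<Rightarrow> tm \<Rightarrow> 'n" where "nv e t = nm (eval e t)"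

lemma eval_num: "valid e \<Longrightarrow> wt t \<Longrightarrow> tyof t = T0 \<Longrightarrow> eval e t = num (nv e t)"
  by (simp add: nv_def num_nm)

declare sat.simps(2,3) [simp del]

lemma sat_atoms [simp]:
  assumes "valid e" "wt s" "tyof s = T0" "wt t" "tyof t = T0"
  shows "sat e (s =\<^sub>N t) \<longleftrightarrow> nv e s = nv e t" "sat e (s <\<^sub>N t) \<longleftrightarrow> nv e s < nv e t"
  using assms by (simp_all add: sat.simps(2,3) eval_num num_less)

lemma nv_Var [simp]: "nv e (Var T0 n) = nm (e T0 n)"
  by (simp add: nv_def)

lemma nv_const [simp]: "nv e 0\<^sub>N = 0" "nv e 1\<^sub>N = 1"
  by (simp_all add: nv_def con_Zero con_One)

lemma nv_arith [simp]:
  assumes "valid e" "wt s" "tyof s = T0" "wt t" "tyof t = T0"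
  shows "nv e (s +\<^sub>N t) = nv e s + nv e t" "nv e (s *\<^sub>N t) = nv e s * nv e t"
  using assms by (simp_all add: nv_def[of e "_ \<cdot> _"] eval_num num_plus num_times)

lemma nv_app:
  assumes "valid e" "wt s" "tyof s = T1" "wt t" "tyof t = T0"
  shows "nv e (s \<cdot> t) = at (eval e s) (nv e t)"
  using assms by (simp add: nv_def[of e "_ \<cdot> _"] eval_num at_def)

lemma nv_Var_app [simp]:
  assumes "valid e" "wt t" "tyof t = T0"
  shows "nv e (Var T1 k \<cdot> t) = at (e T1 k) (nv e t)"
  using assms by (simp add: nv_app)

lemma nv_Var_app_app [simp]:
  assumes "valid e" "wt s" "tyof s = T0" "wt t" "tyof t = T0"
  shows "nv e (Var TW k \<cdot> s \<cdot> t) = at (app (e TW k) (num (nv e s))) (nv e t)"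
  using assms by (simp add: nv_app eval_num[of e s])

lemma nv_lam [simp]:
  assumes "valid e" "wt b" "tyof b = T0" "wt t" "tyof t = T0"
  shows "nv e (lam T0 b \<cdot> t) = nv (push T0 (num (nv e t)) e) b"
  using assms by (simp add: nv_def[of _ "lam T0 b \<cdot> t"] eval_num[of e t], simp add: nv_def)

lemma at_lam [simp]: "valid e \<Longrightarrow> wt b \<Longrightarrow> tyof b = T0 \<Longrightarrow> at (eval e (lam T0 b)) n = nv (push T0 (num n) e) b"
  by (simp add: at_def nv_def)

lemma nv_lam2 [simp]:
  assumes "valid e" "wt b" "tyof b = T0" "wt s" "tyof s = T0" "wt t" "tyof t = T0"
  shows "nv e (lam2 b \<cdot> s \<cdot> t) = nv (push T0 (num (nv e t)) (push T0 (num (nv e s)) e)) b"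
  using assms by (simp add: nv_def[of _ "lam2 b \<cdot> s \<cdot> t"] eval_num[of e t] eval_num[of e s], simp add: nv_def)

lemma nv_lam3 [simp]:
  assumes "valid e" "wt b" "tyof b = T0" "wt s" "tyof s = T0" "wt t" "tyof t = T0" "wt u" "tyof u = T0"
  shows "nv e (lam2 (lam T0 b) \<cdot> s \<cdot> t \<cdot> u) =
    nv (push T0 (num (nv e u)) (push T0 (num (nv e t)) (push T0 (num (nv e s)) e))) b"
  using assms
  by (simp add: nv_def[of _ "lam2 (lam T0 b) \<cdot> s \<cdot> t \<cdot> u"] eval_num[of e t] eval_num[of e s] eval_num[of e u], simp add: nv_def)

lemma eval_closed: "tv t = {} \<Longrightarrow> eval e t = eval e' t"
  by (rule eval_cong) simp

text \<open>The formula \<open>A\<close> defines the property \<open>P\<close> in the model, as the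
  third premise certifies. Each induction on numbers in this locale has to name such a
  formula.\<close>

lemma num_induct:
  assumes "valid e" "wff A" "\<And>n. sat (push T0 (num n) e) A \<longleftrightarrow> P n"
    and "P 0" "\<And>n. P n \<Longrightarrow> P (n + 1)"
  shows "P n"
proof -
  have "sat (push T0 (num n) e) A"
  proof (rule raw_induct[OF assms(1,2)])
    show "sat (push T0 (con Zero) e) A" using assms(3,4) by (simp add: con_Zero)
    show "sat (push T0 (pl d (con One)) e) A" if "d \<in> D T0" "sat (push T0 d e) A" for d
    proof -
      obtain m where "d = num m" using \<open>d \<in> D T0\<close> range_num by blast
      then show ?thesis using that assms(3,5) by (simp add: con_One num_plus)
    qed
  qed simp
  then show ?thesis using assms(3) by blast
qed

lemma num_cases: obtains "n = (0 :: 'n)" | m where "n = m + 1"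
proof -
  have "num n = num 0 \<or> (\<exists>d \<in> D T0. num n = pl d (num 1))"
    using raw_pred[of "num n"] by (simp add: con_Zero con_One)
  then have "n = 0 \<or> (\<exists>m. num n = num (m + 1))"
    by (auto simp: range_num[symmetric] num_plus)
  then show thesis using that by auto
qed

lemma num_nonneg [simp]: "0 \<le> (n :: 'n)"
proof -
  have "num n = num 0 \<or> lt (num 0) (num n)"
    using raw_nonneg[OF num_D, of n] unfolding con_Zero .
  then show ?thesis unfolding num_eq_iff num_less by (metis le_less)
qed

lemma num_not_neg [simp]: "\<not> (n :: 'n) < 0"
  by (simp add: not_less)

lemma num_Suc_neq_0 [simp]: "(n :: 'n) + 1 \<noteq> 0"
  by (metis add_nonneg_pos num_nonneg less_irrefl zero_less_one)

text \<open>Discreteness of the order: a nonzero difference \<open>m - n\<close> is a successor by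
  \<open>num_cases\<close>, hence at least 1.\<close>

lemma num_less_Suc: "(m :: 'n) < n + 1 \<longleftrightarrow> m \<le> n"
proof
  assume *: "m < n + 1"
  show "m \<le> n"
  proof (rule ccontr)
    assume "\<not> m \<le> n"
    then have c: "m = n + (m - n)" and "m - n \<noteq> 0"
      by (metis le_add_diff_inverse less_imp_le not_le, metis le_add_diff_inverse less_imp_le not_le add_0_right order_refl)
    then obtain d where "m - n = d + 1" using num_cases by metis
    then have "m = n + 1 + d" using c by (simp only: ac_simps)
    then have "n + 1 \<le> m" by (simp only: le_add_same_cancel1 num_nonneg)
    with * show False by (metis not_le)
  qed
qed (metis less_add_one le_less_trans)

lemma num_pos_iff: "0 < (n :: 'n) \<longleftrightarrow> 1 \<le> n"
  using num_less_Suc[of n 0] by (metis add_0 not_le num_nonneg order_antisym order_refl)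

subsection \<open>Recursion\<close>

definition at2 :: "'d \<Rightarrow> 'n \<Rightarrow> 'n \<Rightarrow> 'n" where "at2 f a b = nm (app (app f (num a)) (num b))"
definition rec :: "'d \<Rightarrow> 'n \<Rightarrow> 'n \<Rightarrow> 'n" where
  "rec f m n = nm (app (app (app (con (CR T0)) f) (num m)) (num n))"

lemma nv_rec [simp]:
  assumes "valid e" "wt f" "tyof f = T2f" "wt m" "tyof m = T0" "wt n" "tyof n = T0"
  shows "nv e (recN f m n) = rec (eval e f) (nv e m) (nv e n)"
  using assms by (simp add: nv_def[of _ "recN f m n"] eval_num[of e m] eval_num[of e n] rec_def)

lemma at2_lam2 [simp]:
  assumes "valid e" "wt b" "tyof b = T0"
  shows "at2 (eval e (lam2 b)) m n = nv (push T0 (num n) (push T0 (num m) e)) b"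
  using assms by (simp add: at2_def nv_def)

lemma rec_simps [simp]:
  assumes f: "f \<in> D T2f"
  shows "rec f m 0 = m" "rec f m (n + 1) = at2 f n (rec f m n)"
proof -
  let ?e = "push T2f f (push T0 (num m) (push T0 (num n) e0))"
  have e: "valid ?e" using f by simp
  let ?F = "Var T2f 0" and ?R = "recN (Var T2f 0) (vN 0)"
  have mem: "?R 0\<^sub>N =\<^sub>N vN 0 \<in> RCA0\<omega>" "?R (vN 1 +\<^sub>N 1\<^sub>N) =\<^sub>N ?F \<cdot> vN 1 \<cdot> ?R (vN 1) \<in> RCA0\<omega>"
    unfolding RCA0\<omega>_def R_axioms_def Let_def by blast+
  show "rec f m 0 = m" using sat_axioms[OF UnI1[OF mem(1)] _ e] e by simp
  have "nv ?e (?F \<cdot> vN 1 \<cdot> ?R (vN 1)) = at2 f n (rec f m n)"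
    using e eval_in_D[OF e, of "?R (vN 1)" T0] by (simp add: nv_def at2_def rec_def num_nm)
  then show "rec f m (n + 1) = at2 f n (rec f m n)"
    using sat_axioms[OF UnI1[OF mem(2)] _ e] e by simp
qed

lemma nv_pred [simp]:
  assumes "valid e" "wt t" "tyof t = T0"
  shows "nv e (predC \<cdot> t) = nv e t - 1"
proof -
  have "nv e (predC \<cdot> t) = rec (eval (push T0 (num (nv e t)) e) (lam2 (vN 1))) 0 (nv e t)"
    using assms by (simp add: predC_def)
  then show ?thesis
    using assms by (cases rule: num_cases[of "nv e t"]) (simp_all add: num_diff)
qed

lemma nv_monus [simp]:
  assumes "valid e" "wt s" "tyof s = T0" "wt t" "tyof t = T0"
  shows "nv e (s -\<^sub>N t) = nv e s - nv e t"
proof -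
  define f where "f = eval (push T0 (num (nv e t)) (push T0 (num (nv e s)) e)) (lam2 (predC \<cdot> vN 0))"
  define a where "a = nv e s"
  have f: "f \<in> D T2f" "\<And>m n. at2 f m n = n - 1" using assms by (simp_all add: f_def)
  let ?e = "push T2f f (push T0 (num a) e0)" and ?R = "recN (Var T2f 0) (vN 1) (vN 0)"
  \<comment> \<open>The invariant pins down truncated subtraction through addition and order, so a
    formula can express it before the meaning of \<open>monusC\<close> is known.\<close>
  have "rec f a n + n = a \<or> rec f a n = 0 \<and> a < n" for n
  proof (rule num_induct[where e="?e" and A="?R +\<^sub>N vN 0 =\<^sub>N vN 1 \<or>\<^sub>f (?R =\<^sub>N 0\<^sub>N \<and>\<^sub>f vN 1 <\<^sub>N vN 0)"])
    show "sat (push T0 (num n) ?e) (?R +\<^sub>N vN 0 =\<^sub>N vN 1 \<or>\<^sub>f (?R =\<^sub>N 0\<^sub>N \<and>\<^sub>f vN 1 <\<^sub>N vN 0)) \<longleftrightarrow>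
        (rec f a n + n = a \<or> rec f a n = 0 \<and> a < n)" for n
      using f by auto
    fix n assume *: "rec f a n + n = a \<or> rec f a n = 0 \<and> a < n"
    show "rec f a (n + 1) + (n + 1) = a \<or> rec f a (n + 1) = 0 \<and> a < n + 1"
    proof (cases rule: num_cases[of "rec f a n"])
      case 1
      then show ?thesis using * f by (auto simp: num_diff num_less_Suc)
    next
      case (2 m)
      have "rec f a n \<noteq> 0"
        unfolding 2 by (rule num_Suc_neq_0)
      then have "m + 1 + n = a" using * unfolding 2 by blast
      moreover have "rec f a (n + 1) = m" using f 2 by simp
      ultimately show ?thesis by (metis add.assoc add.commute)
    qed
  qed (use f in auto)
  from this[of "nv e t"] have "rec f a (nv e t) = a - nv e t"
    by (metis add_diff_cancel_right' less_imp_le num_diff)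
  moreover have "nv e (s -\<^sub>N t) = rec f a (nv e t)"
    using assms by (simp add: monusC_def f_def a_def)
  ultimately show ?thesis by (simp add: a_def)
qed

lemma diff_eq_0_iff: "(a :: 'n) - b = 0 \<longleftrightarrow> a \<le> b"
  by (metis add_0_right le_add_diff_inverse linear num_diff)

lemma nv_ifzero [simp]:
  assumes "valid e" "wt s" "tyof s = T0" "wt t" "tyof t = T0" "wt u" "tyof u = T0"
  shows "nv e (ifzero s t u) = (if nv e s = 0 then nv e t else nv e u)"
  using assms by (cases rule: num_cases[of "nv e s"]) (simp_all add: ifzeroC_def)

lemma nv_closed:
  assumes "valid e" "wt s" "tyof s = T1" "tv s = {}" "wt t" "tyof t = T0"
  shows "nv e (s \<cdot> t) = at (eval e0 s) (nv e t)"
  using assms nv_app[of e s t] eval_closed[of s e e0] by simp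

definition p2 :: "'n \<Rightarrow> 'n" where "p2 = at (eval e0 pow2C)"

lemma nv_pow2 [simp]: "valid e \<Longrightarrow> wt t \<Longrightarrow> tyof t = T0 \<Longrightarrow> nv e (pow2 t) = p2 (nv e t)"
  unfolding p2_def by (rule nv_closed) (simp_all, simp add: pow2C_def)

lemma p2_simps [simp]: "p2 0 = 1" "p2 (n + 1) = p2 n + p2 n"
proof -
  define f where "f = eval e0 (lam2 (vN 0 +\<^sub>N vN 0))"
  have "eval e (lam2 (vN 0 +\<^sub>N vN 0)) = f" for e
    unfolding f_def by (rule eval_closed) simp
  then have "p2 n = rec f 1 n" for n
    by (simp add: p2_def pow2C_def)
  moreover have "f \<in> D T2f" "\<And>m n. at2 f m n = n + n" by (simp_all add: f_def)
  ultimately show "p2 0 = 1" "p2 (n + 1) = p2 n + p2 n" by simp_all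
qed

lemma p2_pos [simp]: "0 < p2 n"
  by (rule num_induct[where e=e0 and A="0\<^sub>N <\<^sub>N pow2 (vN 0)"]) (simp_all add: add_pos_pos)

lemma p2_add: "p2 (m + n) = p2 m * p2 n"
  by (rule num_induct[where e="push T0 (num m) e0" and A="pow2 (vN 1 +\<^sub>N vN 0) =\<^sub>N pow2 (vN 1) *\<^sub>N pow2 (vN 0)"])
    (simp_all add: add.assoc[symmetric] distrib_left)

subsection \<open>Pairing\<close>

definition tri :: "'n \<Rightarrow> 'n" where "tri = at (eval e0 triC)"

lemma nv_tri [simp]: "valid e \<Longrightarrow> wt t \<Longrightarrow> tyof t = T0 \<Longrightarrow> nv e (triN t) = tri (nv e t)"
  unfolding tri_def by (rule nv_closed) simp_all

lemma tri_simps [simp]: "tri 0 = 0" "tri (n + 1) = tri n + (n + 1)"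
proof -
  let ?t = "lam2 (vN 0 +\<^sub>N (vN 1 +\<^sub>N 1\<^sub>N))"
  define f where "f = eval e0 ?t"
  have "eval e ?t = f" for e
    unfolding f_def by (rule eval_closed) simp
  then have "tri n = rec f 0 n" for n
    by (simp add: tri_def triC_def)
  moreover have "f \<in> D T2f" "\<And>m n. at2 f m n = n + (m + 1)" by (simp_all add: f_def)
  ultimately show "tri 0 = 0" "tri (n + 1) = tri n + (n + 1)" by simp_all
qed

text \<open>The closed form, doubled to avoid a division; monotonicity of \<open>tri\<close> follows
  from it.\<close>

lemma tri_double: "tri n + tri n = n * (n + 1)"
proof (rule num_induct[where e=e0 and A="triN (vN 0) +\<^sub>N triN (vN 0) =\<^sub>N vN 0 *\<^sub>N (vN 0 +\<^sub>N 1\<^sub>N)"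
      and P="\<lambda>n. tri n + tri n = n * (n + 1)"])
  fix n assume IH: "tri n + tri n = n * (n + 1)"
  have "tri (n + 1) + tri (n + 1) = (tri n + tri n) + ((n + 1) + (n + 1))"
    unfolding tri_simps by (simp only: ac_simps)
  also have "\<dots> = (n + 1) * (n + 1 + 1)"
    unfolding IH by (simp only: distrib_left distrib_right mult_1_left mult_1_right ac_simps)
  finally show "tri (n + 1) + tri (n + 1) = (n + 1) * (n + 1 + 1)" .
qed simp_all

lemma tri_mono: assumes "m \<le> n" shows "tri m \<le> tri n"
proof -
  have "m * (m + 1) \<le> n * (n + 1)" using assms by (intro mult_mono) simp_all
  then have "tri m + tri m \<le> tri n + tri n" by (simp only: tri_double)
  then show ?thesis by (meson add_strict_mono not_less)
qed

definition root :: "'n \<Rightarrow> 'n" where "root = at (eval e0 rootC)"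

lemma nv_root [simp]: "valid e \<Longrightarrow> wt t \<Longrightarrow> tyof t = T0 \<Longrightarrow> nv e (rootN t) = root (nv e t)"
  unfolding root_def by (rule nv_closed) simp_all

lemma root_simps: "root 0 = 0" "root (n + 1) = (if tri (root n + 1) \<le> n + 1 then root n + 1 else root n)"
proof -
  let ?t = "lam2 (ifzero (triN (vN 0 +\<^sub>N 1\<^sub>N) -\<^sub>N (vN 1 +\<^sub>N 1\<^sub>N)) (vN 0 +\<^sub>N 1\<^sub>N) (vN 0))"
  define f where "f = eval e0 ?t"
  have "eval e ?t = f" for e
    unfolding f_def by (rule eval_closed) simp
  then have "root n = rec f 0 n" for n
    by (simp add: root_def rootC_def)
  moreover have "f \<in> D T2f" "\<And>m n. at2 f m n = (if tri (n + 1) \<le> m + 1 then n + 1 else n)"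
    by (simp_all add: f_def diff_eq_0_iff)
  ultimately show "root 0 = 0" "root (n + 1) = (if tri (root n + 1) \<le> n + 1 then root n + 1 else root n)"
    by simp_all
qed

text \<open>One increment per step is enough: as \<open>n < tri (root n + 1)\<close> before the
  step, a next triangular number that is at most \<open>n + 1\<close> equals \<open>n + 1\<close>,
  and the one after it is larger still.\<close>

lemma root_bounds: "tri (root n) \<le> n \<and> n < tri (root n + 1)"
proof (rule num_induct[where e=e0 and P="\<lambda>n. tri (root n) \<le> n \<and> n < tri (root n + 1)"
      and A="\<not>\<^sub>f vN 0 <\<^sub>N triN (rootN (vN 0)) \<and>\<^sub>f vN 0 <\<^sub>N triN (rootN (vN 0) +\<^sub>N 1\<^sub>N)"])
  fix n assume IH: "tri (root n) \<le> n \<and> n < tri (root n + 1)"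
  show "tri (root (n + 1)) \<le> n + 1 \<and> n + 1 < tri (root (n + 1) + 1)"
  proof (cases "tri (root n + 1) \<le> n + 1")
    case True
    with IH have "tri (root n + 1) = n + 1"
      by (meson num_less_Suc leD leI order_antisym less_add_one add_le_cancel_right not_less)
    moreover have "tri (root n + 1) < tri (root n + 1 + 1)"
      unfolding tri_simps(2)[of "root n + 1"] by (simp add: add_nonneg_pos)
    ultimately show ?thesis using True by (simp only: root_simps if_True)
  next
    case False
    then have "root (n + 1) = root n" by (simp only: root_simps if_False)
    then show ?thesis using IH False by (metis less_add_one less_imp_le not_le order_trans)
  qed
qed (use tri_simps(2)[of 0] in \<open>auto simp: root_simps not_less\<close>)

text \<open>The code of a pair with sum \<open>s\<close> lies in the block from \<open>tri s\<close>
  up to \<open>tri (s + 1)\<close>, exclusive; so the sum can be read off the code, and the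
  components follow.\<close>

lemma root_tri: assumes "a \<le> s" shows "root (tri s + a) = s"
proof (rule antisym)
  have *: "tri s + a < tri (s + 1)" using assms by (simp add: num_less_Suc)
  note b = root_bounds[of "tri s + a"]
  show "root (tri s + a) \<le> s"
  proof (rule ccontr)
    assume "\<not> root (tri s + a) \<le> s"
    then have "s + 1 \<le> root (tri s + a)" by (meson num_less_Suc not_le)
    then have "tri (s + 1) \<le> tri (root (tri s + a))" by (rule tri_mono)
    with * b show False by (meson le_less_trans less_irrefl order_trans)
  qed
  show "s \<le> root (tri s + a)"
  proof (rule ccontr)
    assume "\<not> s \<le> root (tri s + a)"
    then have "root (tri s + a) + 1 \<le> s" by (meson num_less_Suc not_le)
    then have "tri (root (tri s + a) + 1) \<le> tri s" by (rule tri_mono)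
    also have "\<dots> \<le> tri s + a" by simp
    finally show False using b by (metis not_le)
  qed
qed

definition \<pi>\<^sub>1 :: "'n \<Rightarrow> 'n" where "\<pi>\<^sub>1 p = p - tri (root p)"
definition \<pi>\<^sub>2 :: "'n \<Rightarrow> 'n" where "\<pi>\<^sub>2 p = root p - \<pi>\<^sub>1 p"

lemma nv_proj [simp]:
  assumes "valid e" "wt t" "tyof t = T0"
  shows "nv e (proj1 t) = \<pi>\<^sub>1 (nv e t)" "nv e (proj2 t) = \<pi>\<^sub>2 (nv e t)"
proof -
  have 1: "nv e (proj1 t) = \<pi>\<^sub>1 (nv e t)" if "valid e" "wt t" "tyof t = T0" for e t
    using that by (simp add: proj1C_def \<pi>\<^sub>1_def)
  show "nv e (proj1 t) = \<pi>\<^sub>1 (nv e t)" using assms by (rule 1)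
  show "nv e (proj2 t) = \<pi>\<^sub>2 (nv e t)" using assms by (simp add: proj2C_def \<pi>\<^sub>2_def 1)
qed

definition pair :: "'n \<Rightarrow> 'n \<Rightarrow> 'n" where "pair a b = tri (a + b) + a"

lemma nv_pair [simp]:
  assumes "valid e" "wt s" "tyof s = T0" "wt t" "tyof t = T0"
  shows "nv e (pairN s t) = pair (nv e s) (nv e t)"
  using assms by (simp add: pairC_def pair_def)

lemma proj_pair [simp]: "\<pi>\<^sub>1 (pair a b) = a" "\<pi>\<^sub>2 (pair a b) = b"
  by (simp_all add: \<pi>\<^sub>1_def \<pi>\<^sub>2_def pair_def root_tri)

subsection \<open>Rational numbers\<close>

text \<open>The value lies in the ordered field over the model's own numbers, so that a nonstandard
  code has a value as well.\<close>

definition qv :: "'n \<Rightarrow> 'n gz fract" where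
  "qv q = (qof (\<pi>\<^sub>1 (\<pi>\<^sub>1 q)) - qof (\<pi>\<^sub>2 (\<pi>\<^sub>1 q))) / (qof (\<pi>\<^sub>2 q) + 1)"

definition rv :: "(ty \<Rightarrow> nat \<Rightarrow> 'd) \<Rightarrow> tm \<Rightarrow> 'n gz fract" where "rv e t = qv (nv e t)"

lemma qof_nonneg [simp]: "0 \<le> qof (n :: 'n)"
  using qof_le_iff[of 0 n] by simp

lemma qof_pos: "0 < qof (n :: 'n) + 1"
  by (simp add: add_nonneg_pos)

lemma nv_qmk [simp]:
  assumes "valid e" "wt s" "tyof s = T0" "wt t" "tyof t = T0" "wt u" "tyof u = T0"
  shows "nv e (qmk s t u) = pair (pair (nv e s) (nv e t)) (nv e u)"
  using assms by (simp add: qmkC_def)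

lemma rv_qmk:
  assumes "valid e" "wt s" "tyof s = T0" "wt t" "tyof t = T0" "wt u" "tyof u = T0"
  shows "rv e (qmk s t u) = (qof (nv e s) - qof (nv e t)) / (qof (nv e u) + 1)"
  using assms by (simp add: rv_def qv_def)

lemma rv_qadd [simp]:
  assumes "valid e" "wt s" "tyof s = T0" "wt t" "tyof t = T0"
  shows "rv e (s +\<^sub>Q t) = rv e s + rv e t"
proof -
  let ?q = "nv e s" and ?r = "nv e t"
  define a b c a' b' c' where "a = \<pi>\<^sub>1 (\<pi>\<^sub>1 ?q)" and "b = \<pi>\<^sub>2 (\<pi>\<^sub>1 ?q)" and "c = \<pi>\<^sub>2 ?q"
    and "a' = \<pi>\<^sub>1 (\<pi>\<^sub>1 ?r)" and "b' = \<pi>\<^sub>2 (\<pi>\<^sub>1 ?r)" and "c' = \<pi>\<^sub>2 ?r"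
  \<comment> \<open>A code stores the denominator minus one; this bound keeps the truncated
    subtraction in \<open>qaddC\<close> exact.\<close>
  have one: "1 \<le> (c + 1) * (c' + 1)"
    by (simp add: algebra_simps)
  have "rv e (s +\<^sub>Q t) = (qof (a * (c' + 1) + a' * (c + 1)) - qof (b * (c' + 1) + b' * (c + 1))) /
      (qof ((c + 1) * (c' + 1) - 1) + 1)"
    using assms by (simp add: rv_def qaddC_def Let_def qv_def a_def b_def c_def a'_def b'_def c'_def del: qof_simps)
  also have "\<dots> = rv e s + rv e t"
    using qof_pos[of c] qof_pos[of c'] one
    by (simp add: rv_def qv_def a_def[symmetric] b_def[symmetric] c_def[symmetric] a'_def[symmetric] b'_def[symmetric] c'_def[symmetric]
        qof_diff add_divide_eq_iff divide_add_eq_iff field_simps)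
  finally show ?thesis .
qed

lemma rv_qneg [simp]:
  assumes "valid e" "wt t" "tyof t = T0"
  shows "rv e (qnegC \<cdot> t) = - rv e t"
  using assms by (simp add: rv_def qnegC_def qv_def minus_divide_left)

lemma rv_qabs [simp]:
  assumes "valid e" "wt t" "tyof t = T0"
  shows "rv e (qabs t) = \<bar>rv e t\<bar>"
proof -
  define a b c where "a = \<pi>\<^sub>1 (\<pi>\<^sub>1 (nv e t))" and "b = \<pi>\<^sub>2 (\<pi>\<^sub>1 (nv e t))" and "c = \<pi>\<^sub>2 (nv e t)"
  have "rv e (qabs t) = qof ((a - b) + (b - a)) / (qof c + 1)"
    using assms by (simp add: rv_def qabsC_def Let_def qv_def a_def b_def c_def)
  also have "qof ((a - b) + (b - a)) = \<bar>qof a - qof b\<bar>"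
    by (cases a b rule: le_cases) (auto simp: num_diff qof_diff abs_if)
  also have "\<bar>qof a - qof b\<bar> / (qof c + 1) = \<bar>rv e t\<bar>"
    using qof_pos[of c] by (simp add: rv_def qv_def a_def b_def c_def)
  finally show ?thesis .
qed

lemma sat_qless [simp]:
  assumes "valid e" "wt s" "tyof s = T0" "wt t" "tyof t = T0"
  shows "sat e (s <\<^sub>Q t) \<longleftrightarrow> rv e s < rv e t"
proof -
  let ?q = "nv e s" and ?r = "nv e t"
  define a b c a' b' c' where "a = \<pi>\<^sub>1 (\<pi>\<^sub>1 ?q)" and "b = \<pi>\<^sub>2 (\<pi>\<^sub>1 ?q)" and "c = \<pi>\<^sub>2 ?q"
    and "a' = \<pi>\<^sub>1 (\<pi>\<^sub>1 ?r)" and "b' = \<pi>\<^sub>2 (\<pi>\<^sub>1 ?r)" and "c' = \<pi>\<^sub>2 ?r"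
  have "sat e (s <\<^sub>Q t) \<longleftrightarrow> qof (a * (c' + 1) + b' * (c + 1)) < qof (a' * (c + 1) + b * (c' + 1))"
    using assms by (simp add: qless_def a_def b_def c_def a'_def b'_def c'_def del: qof_simps)
  also have "\<dots> \<longleftrightarrow> rv e s < rv e t"
    using qof_pos[of c] qof_pos[of c']
    by (simp add: rv_def qv_def a_def[symmetric] b_def[symmetric] c_def[symmetric] a'_def[symmetric] b'_def[symmetric] c'_def[symmetric]
        divide_less_eq less_divide_eq field_simps del: qof_less_iff)
  finally show ?thesis .
qed

definition eps :: "'n \<Rightarrow> 'n gz fract" where "eps n = 1 / qof (p2 n)"

lemma qof_p2_pos [simp]: "0 < qof (p2 n)"
  using qof_less_iff[of 0 "p2 n"] by simp

lemma qof_p2_pred: "qof (p2 n - 1) + 1 = qof (p2 n)"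
  using num_pos_iff[of "p2 n"] by (simp add: qof_diff)

lemma eps_pos [simp]: "0 < eps n"
  by (simp add: eps_def)

lemma eps_nonneg [simp]: "0 \<le> eps n"
  by (rule less_imp_le) (rule eps_pos)

lemma eps_0 [simp]: "eps 0 = 1"
  by (simp add: eps_def)

lemma eps_Suc: "eps n = 2 * eps (n + 1)"
  unfolding eps_def p2_simps qof_simps by (simp add: field_simps)

lemma eps_add: "eps (m + n) = eps m * eps n"
  by (simp add: eps_def p2_add)

lemma rv_qeps [simp]:
  assumes "valid e" "wt t" "tyof t = T0"
  shows "rv e (qeps t) = eps (nv e t)" "rv e (qeps2 t) = 2 * eps (nv e t)"
  using assms by (simp_all add: rv_qmk qof_p2_pred eps_def)

lemma rv_consts [simp]: "valid e \<Longrightarrow> rv e 0\<^sub>Q = 0" "valid e \<Longrightarrow> rv e 1\<^sub>Q = 1"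
  by (simp_all add: rv_qmk)

lemma rv_ifzero [simp]:
  assumes "valid e" "wt s" "tyof s = T0" "wt t" "tyof t = T0" "wt u" "tyof u = T0"
  shows "rv e (ifzero s t u) = (if nv e s = 0 then rv e t else rv e u)"
  using assms by (simp add: rv_def)

subsection \<open>Real numbers\<close>

definition rx :: "'d \<Rightarrow> 'n \<Rightarrow> 'n gz fract" where "rx x n = qv (at x n)"

lemma rv_app:
  assumes "valid e" "wt s" "tyof s = T1" "wt t" "tyof t = T0"
  shows "rv e (s \<cdot> t) = rx (eval e s) (nv e t)"
  using assms by (simp add: rv_def rx_def nv_app)

lemma rv_tsubst_app [simp]:
  assumes "valid e" "wt (tsubst s x)" "tyof (tsubst s x) = T1" "wt t" "tyof t = T0"
  shows "rv e (tsubst s x \<cdot> t) = rx (eval e (tsubst s x)) (nv e t)"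
  using assms by (rule rv_app)

lemma rv_app_app [simp]:
  assumes "valid e" "wt s" "tyof s = \<sigma>" "wt t" "tyof t = T0"
  shows "rv e (Var (\<sigma> \<rightarrow>\<^sub>t T1) k \<cdot> s \<cdot> t) = rx (app (e (\<sigma> \<rightarrow>\<^sub>t T1) k) (eval e s)) (nv e t)"
  using assms by (simp add: rv_app)

lemma rx_lam [simp]: "valid e \<Longrightarrow> wt b \<Longrightarrow> tyof b = T0 \<Longrightarrow> rx (eval e (lam T0 b)) n = rv (push T0 (num n) e) b"
  by (simp add: rx_def rv_def)

lemma app_num_D [simp]: "w \<in> D TW \<Longrightarrow> app w (num i) \<in> D T1"
  by (simp add: app_D[where \<sigma>=T0])

definition IsR :: "'d \<Rightarrow> bool" where "IsR x \<longleftrightarrow> (\<forall>n i. \<bar>rx x n - rx x (n + i)\<bar> < eps n)"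
definition EqR :: "'d \<Rightarrow> 'd \<Rightarrow> bool" where "EqR x y \<longleftrightarrow> (\<forall>n. \<bar>rx x n - rx y n\<bar> \<le> 2 * eps n)"
definition LtR :: "'d \<Rightarrow> 'd \<Rightarrow> bool" where "LtR x y \<longleftrightarrow> (\<exists>n. 2 * eps n < rx y n - rx x n)"
text \<open>The two bounds negate \<open>x <\<^sub>R 0\<^sub>R\<close> and
  \<open>1\<^sub>R <\<^sub>R x\<close>, with the constant sequences evaluated.\<close>

definition In01 :: "'d \<Rightarrow> bool" where
  "In01 x \<longleftrightarrow> IsR x \<and> (\<forall>n. - rx x n \<le> 2 * eps n) \<and> (\<forall>n. rx x n - 1 \<le> 2 * eps n)"
definition Fin :: "'n \<Rightarrow> 'd \<Rightarrow> bool" where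
  "Fin l w \<longleftrightarrow> (\<forall>i<l. In01 (app w (num i))) \<and>
    (\<forall>i<l. \<forall>j<l. i \<noteq> j \<longrightarrow> \<not> EqR (app w (num i)) (app w (num j)))"
definition Disj :: "'n \<Rightarrow> 'd \<Rightarrow> 'n \<Rightarrow> 'd \<Rightarrow> bool" where
  "Disj k u l w \<longleftrightarrow> (\<forall>i<k. \<forall>j<l. \<not> EqR (app u (num i)) (app w (num j)))"

lemma EqR_sym: "EqR x y \<Longrightarrow> EqR y x"
  by (simp add: EqR_def abs_minus_commute)

lemma sat_is_real [simp]:
  "valid e \<Longrightarrow> wt x \<Longrightarrow> tyof x = T1 \<Longrightarrow> sat e (is_real x) \<longleftrightarrow> IsR (eval e x)"
  by (simp add: is_real_def IsR_def Let_def)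

lemma sat_reals [simp]:
  assumes "valid e" "wt x" "tyof x = T1" "wt y" "tyof y = T1"
  shows "sat e (x =\<^sub>R y) \<longleftrightarrow> EqR (eval e x) (eval e y)"
    and "sat e (x <\<^sub>R y) \<longleftrightarrow> LtR (eval e x) (eval e y)"
  using assms by (auto simp: eqR_def lessR_def EqR_def LtR_def Let_def not_less not_le)

lemma LtR_const [simp]:
  assumes "valid e"
  shows "LtR x (eval e 0\<^sub>R) \<longleftrightarrow> (\<exists>n. 2 * eps n < - rx x n)"
    "LtR (eval e 0\<^sub>R) x \<longleftrightarrow> (\<exists>n. 2 * eps n < rx x n)"
    "LtR (eval e 1\<^sub>R) x \<longleftrightarrow> (\<exists>n. 2 * eps n < rx x n - 1)"
  using assms by (simp_all add: LtR_def)

lemma EqR_zero [simp]: "valid e \<Longrightarrow> EqR x (eval e 0\<^sub>R) \<longleftrightarrow> (\<forall>n. \<bar>rx x n\<bar> \<le> 2 * eps n)"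
  by (simp add: EqR_def)

lemma sat_in01 [simp]:
  assumes "valid e" "wt x" "tyof x = T1"
  shows "sat e (in01 x) \<longleftrightarrow> In01 (eval e x)"
  using assms by (auto simp: in01_def In01_def not_less)

lemma sat_fin01 [simp]:
  assumes "valid e" "wt l" "tyof l = T0" "wt w" "tyof w = TW"
  shows "sat e (fin01 l w) \<longleftrightarrow> Fin (nv e l) (eval e w)"
  using assms by (auto simp: fin01_def Fin_def Let_def nv_def[of _ "lift _ _"] nv_def[of e])

lemma sat_disjoint01 [simp]:
  assumes "valid e" "wt k" "tyof k = T0" "wt u" "tyof u = TW" "wt l" "tyof l = T0" "wt w" "tyof w = TW"
  shows "sat e (disjoint01 k u l w) \<longleftrightarrow> Disj (nv e k) (eval e u) (nv e l) (eval e w)"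
  using assms by (auto simp: disjoint01_def Disj_def Let_def nv_def[of _ "lift _ _"] nv_def[of e])

definition atY :: "'d \<Rightarrow> 'd \<Rightarrow> 'n" where "atY Y x = nm (app Y x)"

lemma nv_Var_appY [simp]: "nv e (Var TY k \<cdot> t) = atY (e TY k) (eval e t)"
  by (simp add: nv_def atY_def)

lemma nv_lift_appY [simp]: "nv e (tsubst s Y \<cdot> Var T1 k) = atY (eval e (tsubst s Y)) (e T1 k)"
  by (simp add: nv_def atY_def)

lemma sat_natfun01 [simp]:
  assumes "valid e" "wt Y" "tyof Y = TY"
  shows "sat e (natfun01 Y) \<longleftrightarrow> (\<forall>x \<in> D T1. \<forall>y \<in> D T1. In01 x \<longrightarrow> In01 y \<longrightarrow> EqR x y \<longrightarrow> atY (eval e Y) x = atY (eval e Y) y)"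
  using assms by (simp add: natfun01_def Let_def)

lemma sat_realfun01 [simp]:
  assumes "valid e" "wt a" "tyof a = TA"
  shows "sat e (realfun01 a) \<longleftrightarrow> (\<forall>x \<in> D T1. In01 x \<longrightarrow> IsR (app (eval e a) x)) \<and>
    (\<forall>x \<in> D T1. \<forall>y \<in> D T1. In01 x \<longrightarrow> In01 y \<longrightarrow> EqR x y \<longrightarrow> EqR (app (eval e a) x) (app (eval e a) y))"
  using assms by (simp add: realfun01_def Let_def) blast

lemma sat_nonneg01 [simp]:
  assumes "valid e" "wt a" "tyof a = TA"
  shows "sat e (nonneg01 a) \<longleftrightarrow> (\<forall>x \<in> D T1. In01 x \<longrightarrow> (\<forall>n. - rx (app (eval e a) x) n \<le> 2 * eps n))"
  using assms by (simp add: nonneg01_def Let_def not_less)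

lemma rx_rabs [simp]: "valid e \<Longrightarrow> wt x \<Longrightarrow> tyof x = T1 \<Longrightarrow> rx (eval e (rabs x)) n = \<bar>rx (eval e x) n\<bar>"
  by (simp add: rabs_def)

text \<open>The length may be nonstandard, so the sum cannot be unfolded into a finite sum of HOL.
  Its step function and start value are exposed instead, for use in inductions over
  \<open>rec\<close>.\<close>

lemma rx_rsum:
  assumes "valid e" "wt a" "tyof a = TA" "wt l" "tyof l = T0" "wt w" "tyof w = TW"
  obtains f z where "f \<in> D T2f" "qv z = 0"
    "\<And>i s. qv (at2 f i s) = qv s + rx (app (eval e a) (app (eval e w) (num i))) (n + nv e l)"
    "rx (eval e (rsum a l w)) n = qv (rec f z (nv e l))"
proof -
  let ?a = "lift T0 (lift T0 (lift T0 a))" and ?l = "lift T0 (lift T0 (lift T0 l))"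
    and ?w = "lift T0 (lift T0 (lift T0 w))"
  let ?step = "vN 0 +\<^sub>Q ?a \<cdot> (?w \<cdot> vN 1) \<cdot> (vN 2 +\<^sub>N ?l)"
  let ?e = "push T0 (num n) e"
  show thesis
  proof (rule that[of "eval ?e (lam2 ?step)" "nv ?e 0\<^sub>Q"])
    show "eval ?e (lam2 ?step) \<in> D T2f" using assms by simp
    show "qv (nv ?e 0\<^sub>Q) = 0" using assms rv_consts(1)[of ?e] by (simp only: rv_def valid_push num_D)
    show "qv (at2 (eval ?e (lam2 ?step)) i s) = qv s + rx (app (eval e a) (app (eval e w) (num i))) (n + nv e l)" for i s
    proof -
      have "qv (at2 (eval ?e (lam2 ?step)) i s) = rv (push T0 (num s) (push T0 (num i) ?e)) ?step"
        using assms by (simp add: rv_def)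
      also have "\<dots> = qv s + rx (app (eval e a) (app (eval e w) (num i))) (n + nv e l)"
        using assms by (simp add: rv_app[of _ "?a \<cdot> (?w \<cdot> vN 1)"])
          (simp add: rv_def nv_def[of _ "_ \<cdot> _"] rx_def at_def eval_num[of e l] num_plus)
      finally show ?thesis .
    qed
    show "rx (eval e (rsum a l w)) n = qv (rec (eval ?e (lam2 ?step)) (nv ?e 0\<^sub>Q) (nv e l))"
      using assms by (simp add: rsum_def Let_def rv_def nv_def[of _ "lift _ _"] nv_def[of e])
  qed
qed

lemma sat_Cauchy_sum [simp]:
  assumes "valid e" "wt a" "tyof a = TA"
  shows "sat e (Cauchy_sum a) \<longleftrightarrow> (\<forall>\<epsilon> \<in> D T1. IsR \<epsilon> \<longrightarrow> (\<exists>n. 2 * eps n < rx \<epsilon> n) \<longrightarrow>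
    (\<exists>k. \<exists>u \<in> D TW. Fin k u \<and> (\<forall>l. \<forall>w \<in> D TW. Fin l w \<longrightarrow> Disj k u l w \<longrightarrow>
      (\<exists>n. 2 * eps n < rx \<epsilon> n - \<bar>rx (eval (push TW w (push T0 (num l) (push TW u (push T0 (num k) (push T1 \<epsilon> e)))))
        (rsum (lift T1 (lift T0 (lift TW (lift T0 (lift TW a))))) (vN 0) (Var TW 0))) n\<bar>))))"
  using assms by (simp add: Cauchy_sum_def Let_def LtR_def) blast

subsection \<open>Diagonalization\<close>

lemma p2_ge_1: "1 \<le> p2 n"
  using p2_pos num_pos_iff by blast

lemma eps_le_1: "eps n \<le> 1"
  using p2_ge_1[of n] qof_le_iff[of 1 "p2 n"] by (simp add: eps_def divide_le_eq_1)

lemma eps_values: "eps 1 = 1 / 2" "eps (n + 1) = eps n / 2" "eps (n + n) = eps n * eps n"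
  using eps_Suc[of 0] eps_Suc[of n] by (simp_all add: eps_add)

text \<open>The step of a recursion has to branch on a term, not on a formula: this one vanishes
  exactly if \<open>q <\<^sub>Q r\<close> fails.\<close>

definition ltT :: "tm \<Rightarrow> tm \<Rightarrow> tm" where
  "ltT q r = (qpos r *\<^sub>N qden q +\<^sub>N qneg q *\<^sub>N qden r) -\<^sub>N (qpos q *\<^sub>N qden r +\<^sub>N qneg r *\<^sub>N qden q)"

lemma wt_ltT [simp]:
  assumes "wt q" "tyof q = T0" "wt r" "tyof r = T0"
  shows "wt (ltT q r)" "tyof (ltT q r) = T0"
  using assms by (simp_all add: ltT_def)

lemma nv_ltT [simp]:
  assumes "valid e" "wt q" "tyof q = T0" "wt r" "tyof r = T0"
  shows "nv e (ltT q r) = 0 \<longleftrightarrow> rv e r \<le> rv e q"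
proof -
  have "nv e (ltT q r) = 0 \<longleftrightarrow> \<not> sat e (q <\<^sub>Q r)"
    using assms by (simp add: ltT_def qless_def diff_eq_0_iff not_less del: sat_qless)
  then show ?thesis using assms by (simp add: not_less)
qed

text \<open>Step \<open>n\<close> appends to the base 4 expansion \<open>s\<close> the digit 0 or 3 that keeps away from an approximation
  to the \<open>n\<close>-th real of the list.\<close>

definition diag_step :: tm where
  "diag_step =
    (let n = vN 1; s = vN 0; y = Var TW 0 \<cdot> n \<cdot> (n +\<^sub>N n +\<^sub>N 1\<^sub>N +\<^sub>N 1\<^sub>N +\<^sub>N 1\<^sub>N +\<^sub>N 1\<^sub>N +\<^sub>N 1\<^sub>N);
         d = pow2 (n +\<^sub>N n +\<^sub>N 1\<^sub>N +\<^sub>N 1\<^sub>N) -\<^sub>N 1\<^sub>N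
     in ifzero (ltT y (s +\<^sub>Q qmk (1\<^sub>N +\<^sub>N 1\<^sub>N) 0\<^sub>N d)) s (s +\<^sub>Q qmk (1\<^sub>N +\<^sub>N 1\<^sub>N +\<^sub>N 1\<^sub>N) 0\<^sub>N d))"

text \<open>Let \<open>h n\<close> be the weight of digit \<open>n\<close>; all later digits
  together add at most \<open>h n\<close>. With digit 0 the later values stay at most
  \<open>s n + h n\<close>, while \<open>Y n\<close> is at least \<open>s n + 2 * h n\<close>. With
  digit 3 they are at least \<open>s n + 3 * h n\<close>, while \<open>Y n\<close> is below
  \<open>s n + 2 * h n\<close>. The gap of \<open>h n\<close> exceeds the distance that equal reals
  can have at the index used in \<open>Y n\<close>.\<close>

lemma diagonal:
  assumes y: "y \<in> D TW"
  obtains x where "x \<in> D T1" "In01 x" "\<And>i. \<not> EqR x (app y (num i))"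
proof -
  \<comment> \<open>This is 4 to the power \<open>-(n + 1)\<close>, as \<open>eps\<close> gives the
    powers of 1/2.\<close>
  define h where "h n = eps n * eps n / 4" for n
  define f where "f = eval (push TW y e0) (lam2 diag_step)"
  have wt: "wt diag_step" "tyof diag_step = T0" by (simp_all add: diag_step_def Let_def)
  have f: "f \<in> D T2f" using y wt by (simp add: f_def)
  define z where "z = nv e0 0\<^sub>Q"
  define s where "s n = qv (rec f z n)" for n
  \<comment> \<open>The index is \<open>2 * n + 5\<close>: the approximations of equal reals differ
    there by at most twice its \<open>eps\<close>, which is \<open>h n / 4\<close>.\<close>
  define Y where "Y n = rx (app y (num n)) (n + n + 1 + 1 + 1 + 1 + 1)" for n
  have s0: "s 0 = 0" using f rv_consts(1)[of e0] by (simp add: s_def z_def rv_def)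
  have step: "qv (at2 f n t) = (if Y n < qv t + 2 * h n then qv t + 3 * h n else qv t)" for n t
  proof -
    have three: "qof (3 :: 'n) = 3" using qof_simps(3)[of "2 :: 'n" 1] by simp
    have "qv (at2 f n t) = rv (push T0 (num t) (push T0 (num n) (push TW y e0))) diag_step"
      using y wt by (simp add: f_def rv_def)
    also have "\<dots> = (if Y n < qv t + 2 * h n then qv t + 3 * h n else qv t)"
    proof -
      let ?e = "push T0 (num t) (push T0 (num n) (push TW y e0))"
      let ?d = "pow2 (vN 1 +\<^sub>N vN 1 +\<^sub>N 1\<^sub>N +\<^sub>N 1\<^sub>N) -\<^sub>N 1\<^sub>N"
      let ?y = "Var TW 0 \<cdot> vN 1 \<cdot> (vN 1 +\<^sub>N vN 1 +\<^sub>N 1\<^sub>N +\<^sub>N 1\<^sub>N +\<^sub>N 1\<^sub>N +\<^sub>N 1\<^sub>N +\<^sub>N 1\<^sub>N)"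
      have e: "valid ?e" using y by simp
      have "nv ?e ?d = p2 (n + n + 1 + 1) - 1" using e by simp
      then have d: "qof (nv ?e ?d) + 1 = qof (p2 (n + n + 1 + 1))" by (simp only: qof_p2_pred)
      have h: "1 / qof (p2 (n + n + 1 + 1)) = h n" unfolding eps_def[symmetric] eps_values h_def by simp
      have "rv ?e (qmk c 0\<^sub>N ?d) = qof (nv ?e c) * h n" if "wt c" "tyof c = T0" for c
      proof -
        have "rv ?e (qmk c 0\<^sub>N ?d) = (qof (nv ?e c) - qof (nv ?e 0\<^sub>N)) / (qof (nv ?e ?d) + 1)"
          by (rule rv_qmk) (use e that in simp_all)
        also have "\<dots> = qof (nv ?e c) * (1 / qof (p2 (n + n + 1 + 1)))"
          unfolding d nv_const qof_simps(1) by (simp only: diff_0_right times_divide_eq_right mult_1_right)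
        finally show ?thesis unfolding h .
      qed
      from this[of "1\<^sub>N +\<^sub>N 1\<^sub>N"] this[of "1\<^sub>N +\<^sub>N 1\<^sub>N +\<^sub>N 1\<^sub>N"]
      have "rv ?e (qmk (1\<^sub>N +\<^sub>N 1\<^sub>N) 0\<^sub>N ?d) = 2 * h n" "rv ?e (qmk (1\<^sub>N +\<^sub>N 1\<^sub>N +\<^sub>N 1\<^sub>N) 0\<^sub>N ?d) = 3 * h n"
        using e three by simp_all
      moreover have "rv ?e ?y = Y n" using e y by (simp add: rv_app Y_def)
      moreover have "rv ?e (vN 0) = qv t" by (simp add: rv_def)
      ultimately show ?thesis
        unfolding diag_step_def Let_def using e by (simp add: not_less[symmetric])
    qed
    finally show ?thesis .
  qed
  have s_Suc: "s (n + 1) = (if Y n < s n + 2 * h n then s n + 3 * h n else s n)" for n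
    using f by (simp add: s_def step)
  \<comment> \<open>The intervals from \<open>s n\<close> to \<open>s n + eps n * eps n\<close> are
    nested: a digit 3 uses up three quarters of the length, and the remaining quarter is the length
    of the next interval.\<close>
  have bounds: "s n \<le> s (n + i) \<and> s (n + i) + eps (n + i) * eps (n + i) \<le> s n + eps n * eps n" for n i
  proof -
    let ?E = "push T2f f (push T0 (num n) (push T0 (num z) e0))"
    let ?s = "recN (Var T2f 0) (vN 2)"
    let ?A = "?s (vN 1) \<le>\<^sub>Q ?s (vN 1 +\<^sub>N vN 0) \<and>\<^sub>f
      (?s (vN 1 +\<^sub>N vN 0) +\<^sub>Q qeps (vN 1 +\<^sub>N vN 0 +\<^sub>N (vN 1 +\<^sub>N vN 0)) \<le>\<^sub>Q ?s (vN 1) +\<^sub>Q qeps (vN 1 +\<^sub>N vN 1))"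
    show ?thesis
    proof (rule num_induct[where e="?E" and A="?A" and
        P="\<lambda>i. s n \<le> s (n + i) \<and> s (n + i) + eps (n + i) * eps (n + i) \<le> s n + eps n * eps n"])
      show "sat (push T0 (num i) ?E) ?A \<longleftrightarrow> s n \<le> s (n + i) \<and> s (n + i) + eps (n + i) * eps (n + i) \<le> s n + eps n * eps n" for i
        using f by (simp add: s_def not_less rv_def[of _ "recN _ _ _"] eps_add mult_ac)
      fix i assume IH: "s n \<le> s (n + i) \<and> s (n + i) + eps (n + i) * eps (n + i) \<le> s n + eps n * eps n"
      define E where "E = eps (n + i) * eps (n + i)"
      have E: "0 < E" "h (n + i) = E / 4" "eps (n + i + 1) * eps (n + i + 1) = E / 4"
        by (simp_all add: E_def h_def eps_values(2))
      show "s n \<le> s (n + (i + 1)) \<and> s (n + (i + 1)) + eps (n + (i + 1)) * eps (n + (i + 1)) \<le> s n + eps n * eps n"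
        using IH s_Suc[of "n + i"] E(1) unfolding add.assoc[symmetric] E(2,3) E_def[symmetric]
        by (cases "Y (n + i) < s (n + i) + 2 * (E / 4)") simp_all
    qed (use f in simp_all)
  qed
  have s_nonneg: "0 \<le> s n" and s_le: "s n \<le> 1" for n
  proof -
    have "0 \<le> s n" "s n + eps n * eps n \<le> 1" using bounds[of 0 n] s0 by simp_all
    then show "0 \<le> s n" "s n \<le> 1"
      using mult_pos_pos[OF eps_pos[of n] eps_pos[of n]] by linarith+
  qed
  define x where "x = eval (push T2f f (push T0 (num z) e0)) (lam T0 (recN (Var T2f 0) (vN 1) (vN 0)))"
  have x: "x \<in> D T1" and rx: "rx x n = s n" for n
    using f by (simp_all add: x_def s_def rv_def)
  have "IsR x"
    unfolding IsR_def rx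
  proof (intro HOL.allI)
    fix n i
    have "s (n + i) - s n < eps n * eps n"
      using bounds[of n i] mult_pos_pos[OF eps_pos[of "n + i"] eps_pos[of "n + i"]] by linarith
    also have "\<dots> \<le> eps n"
      using mult_left_mono[OF eps_le_1[of n], of "eps n"] eps_pos[of n] by simp
    finally show "\<bar>s n - s (n + i)\<bar> < eps n" using bounds[of n i] by linarith
  qed
  moreover have "- s n \<le> 2 * eps n" "s n - 1 \<le> 2 * eps n" for n
    using s_nonneg[of n] s_le[of n] eps_pos[of n] by linarith+
  ultimately have "In01 x" by (simp add: In01_def rx)
  moreover have "\<not> EqR x (app y (num i))" for i
  proof
    assume "EqR x (app y (num i))"
    let ?m = "i + i + 1 + 1 + 1 + 1 + 1"
    have "\<bar>s ?m - Y i\<bar> \<le> 2 * eps ?m"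
      using \<open>EqR x (app y (num i))\<close> unfolding EqR_def rx Y_def by blast
    also have "2 * eps ?m = h i / 4"
      unfolding eps_values by (simp add: h_def)
    finally have close: "\<bar>s ?m - Y i\<bar> \<le> h i / 4" .
    have m: "?m = (i + 1) + (i + 1 + 1 + 1 + 1)" by (simp only: ac_simps)
    have "0 < h i" by (simp add: h_def)
    have "eps (i + 1) * eps (i + 1) = h i" by (simp add: eps_values h_def)
    then have "s (i + 1) \<le> s ?m" "s ?m \<le> s (i + 1) + h i"
      using bounds[of "i + 1" "i + 1 + 1 + 1 + 1"] mult_pos_pos[OF eps_pos[of ?m] eps_pos[of ?m]]
      unfolding m[symmetric] by linarith+
    then show False
      using close \<open>0 < h i\<close> s_Suc[of i] by (auto split: if_splits simp: abs_le_iff)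
  qed
  ultimately show thesis using that x by blast
qed

subsection \<open>Sums of distinct powers of two\<close>

text \<open>Even for nonstandard \<open>L\<close> a bound exists, by induction in the model. Each
  step adds \<open>at y L + 1\<close> to the previous bound, which avoids taking a maximum.\<close>

lemma num_ex_bound:
  assumes y: "y \<in> D T1"
  obtains M where "\<And>i. i < L \<Longrightarrow> at y i < M"
proof -
  have "\<exists>M. \<forall>i<L. at y i < M"
  proof (rule num_induct[where e="push T1 y e0"
        and A="Exists T0 (Forall T0 (vN 0 <\<^sub>N vN 2 \<longrightarrow>\<^sub>f Var T1 0 \<cdot> vN 0 <\<^sub>N vN 1))"
        and P="\<lambda>L. \<exists>M. \<forall>i<L. at y i < M"])
    show "\<exists>M. \<forall>i<L + 1. at y i < M" if IH: "\<exists>M. \<forall>i<L. at y i < M" for L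
    proof -
      obtain M where M: "\<forall>i<L. at y i < M" using IH by blast
      have "at y i < M + (at y L + 1)" if "i < L + 1" for i
      proof (cases "i = L")
        case True
        have "at y L < at y L + 1" by (rule less_add_one)
        also have "\<dots> \<le> M + (at y L + 1)" by simp
        finally show ?thesis using True by simp
      next
        case False
        then have "i < L" using that num_less_Suc by (simp add: le_less)
        then have "at y i < M" using M by blast
        also have "\<dots> \<le> M + (at y L + 1)" by simp
        finally show ?thesis .
      qed
      then show ?thesis by blast
    qed
  qed (use y in \<open>simp_all\<close>)
  then show thesis using that by blast
qed

text \<open>The sum is compared with \<open>S M\<close>, which keeps only the terms with exponent below \<open>M\<close>. Raising
  \<open>M\<close> by one adds at most one term \<open>2\<^sup>-\<^sup>M\<close>, because the exponents are distinct.\<close>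

lemma distinct_powers_sum:
  assumes y: "y \<in> D T1" and f: "f \<in> D T2f" and z: "qv z = 0"
    and step: "\<And>i s. qv (at2 f i s) = qv s + eps (at y i)"
    and ge: "\<And>i. i < L \<Longrightarrow> m \<le> at y i"
    and distinct: "\<And>i j. i < L \<Longrightarrow> j < L \<Longrightarrow> at y i = at y j \<Longrightarrow> i = j"
  shows "0 \<le> qv (rec f z L)" "qv (rec f z L) < 2 * eps m"
proof -
  let ?R = "\<lambda>i. recN (Var T2f 0) (vN 1) i"
  have f_Suc: "qv (rec f z (i + 1)) = qv (rec f z i) + eps (at y i)" for i
    using f by (simp add: step)
  have "0 \<le> qv (rec f z i)" for i
  proof (rule num_induct[where e="push T2f f (push T0 (num z) e0)" and A="0\<^sub>Q \<le>\<^sub>Q ?R (vN 0)"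
        and P="\<lambda>i. 0 \<le> qv (rec f z i)"])
    show "0 \<le> qv (rec f z (i + 1))" if "0 \<le> qv (rec f z i)" for i
      using that by (simp only: f_Suc add_nonneg_nonneg eps_pos less_imp_le)
  qed (use f z in \<open>simp_all add: rv_def[of _ "recN _ _ _"] not_less\<close>)
  then show "0 \<le> qv (rec f z L)" .

  \<comment> \<open>The cut-off \<open>M\<close> is an argument of \<open>G\<close>, so that
    formulas can speak of the truncated sums for all \<open>M\<close> and be proved by induction on
    the cut-off.\<close>
  define G where "G = eval (push T1 y e0)
    (lam T0 (lam2 (vN 0 +\<^sub>Q ifzero (vN 2 -\<^sub>N Var T1 0 \<cdot> vN 1) 0\<^sub>Q (qeps (Var T1 0 \<cdot> vN 1)))))"
  have G: "G \<in> D (T0 \<rightarrow>\<^sub>t T2f)" using y by (simp add: G_def)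
  then have GM: "app G (num M) \<in> D T2f" for M by (rule app_D) simp
  define S where "S M i = qv (rec (app G (num M)) z i)" for M i
  have S_0: "S M 0 = 0" for M using GM z by (simp add: S_def)
  have S_Suc: "S M (i + 1) = S M i + (if at y i < M then eps (at y i) else 0)" for M i
  proof -
    have "qv (at2 (app G (num M)) i s) = qv s + (if at y i < M then eps (at y i) else 0)" for s
    proof -
      let ?e = "push T0 (num s) (push T0 (num i) (push T0 (num M) (push T1 y e0)))"
      have "qv (at2 (app G (num M)) i s) =
        rv ?e (vN 0 +\<^sub>Q ifzero (vN 2 -\<^sub>N Var T1 0 \<cdot> vN 1) 0\<^sub>Q (qeps (Var T1 0 \<cdot> vN 1)))"
        using y by (simp add: G_def rv_def)
      also have "\<dots> = qv s + (if at y i < M then eps (at y i) else 0)"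
        using y by (simp add: diff_eq_0_iff rv_def[of _ "vN 0"] not_le[symmetric])
      finally show ?thesis .
    qed
    then show ?thesis using GM by (simp add: S_def)
  qed
  let ?E = "push (T0 \<rightarrow>\<^sub>t T2f) G (push T1 y (push T0 (num L) (push T0 (num z) e0)))"
  let ?S = "\<lambda>k M i. recN (Var (T0 \<rightarrow>\<^sub>t T2f) 0 \<cdot> M) (vN k) i"
  have E: "valid ?E" using G y by simp
  have rv_S: "rv e (?S k M i) = S (nv e M) (nv e i)"
    if "valid e" "e (T0 \<rightarrow>\<^sub>t T2f) 0 = G" "e T0 k = num z" "wt M" "tyof M = T0" "wt i" "tyof i = T0" for e k M i
    using that by (simp add: rv_def S_def eval_num[of e M])
  \<comment> \<open>No exponent is smaller than \<open>m\<close>, so nothing survives the cut-off at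
    \<open>m\<close>; this starts the induction on the cut-off in \<open>upper\<close>.\<close>
  have below: "i \<le> L \<longrightarrow> S m i \<le> 0" for i
  proof (rule num_induct[where e="push T0 (num m) ?E" and P="\<lambda>i. i \<le> L \<longrightarrow> S m i \<le> 0"
        and A="\<not>\<^sub>f vN 2 <\<^sub>N vN 0 \<longrightarrow>\<^sub>f ?S 3 (vN 1) (vN 0) \<le>\<^sub>Q 0\<^sub>Q"])
    show "i + 1 \<le> L \<longrightarrow> S m (i + 1) \<le> 0" if "i \<le> L \<longrightarrow> S m i \<le> 0" for i
    proof
      assume "i + 1 \<le> L"
      then have "i < L" by (meson less_add_one less_le_trans)
      then show "S m (i + 1) \<le> 0" using ge[of i] that unfolding S_Suc by (simp add: not_less[symmetric])
    qed
  qed (use E S_0 in \<open>simp_all add: rv_S not_less\<close>)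
  \<comment> \<open>The disjunction records whether the exponent \<open>M\<close> has been met among
    the first \<open>i\<close> terms. If term \<open>i\<close> itself has exponent \<open>M\<close>,
    distinctness excludes an earlier occurrence, so the second alternative held before and only one
    \<open>eps M\<close> is gained.\<close>
  have one_more: "i \<le> L \<longrightarrow> (\<exists>j<i. at y j = M) \<and> S (M + 1) i \<le> S M i + eps M \<or> S (M + 1) i \<le> S M i" for M i
  proof (rule num_induct[where e="push T0 (num M) ?E"
        and P="\<lambda>i. i \<le> L \<longrightarrow> (\<exists>j<i. at y j = M) \<and> S (M + 1) i \<le> S M i + eps M \<or> S (M + 1) i \<le> S M i"
        and A="\<not>\<^sub>f vN 2 <\<^sub>N vN 0 \<longrightarrow>\<^sub>f
          Exists T0 (vN 0 <\<^sub>N vN 1 \<and>\<^sub>f Var T1 0 \<cdot> vN 0 =\<^sub>N vN 2) \<and>\<^sub>f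
            ?S 3 (vN 1 +\<^sub>N 1\<^sub>N) (vN 0) \<le>\<^sub>Q ?S 3 (vN 1) (vN 0) +\<^sub>Q qeps (vN 1) \<or>\<^sub>f
          ?S 3 (vN 1 +\<^sub>N 1\<^sub>N) (vN 0) \<le>\<^sub>Q ?S 3 (vN 1) (vN 0)"])
    fix i assume IH: "i \<le> L \<longrightarrow> (\<exists>j<i. at y j = M) \<and> S (M + 1) i \<le> S M i + eps M \<or> S (M + 1) i \<le> S M i"
    show "i + 1 \<le> L \<longrightarrow> (\<exists>j<i + 1. at y j = M) \<and> S (M + 1) (i + 1) \<le> S M (i + 1) + eps M \<or> S (M + 1) (i + 1) \<le> S M (i + 1)"
    proof
      assume "i + 1 \<le> L"
      then have i: "i < L" by (meson less_add_one less_le_trans)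
      have lt: "j < i + 1" if "j < i" for j using that less_add_one by (rule less_trans)
      show "(\<exists>j<i + 1. at y j = M) \<and> S (M + 1) (i + 1) \<le> S M (i + 1) + eps M \<or> S (M + 1) (i + 1) \<le> S M (i + 1)"
      proof (cases "at y i = M")
        case True
        have "\<not> (\<exists>j<i. at y j = M)"
          using distinct[of _ i] True i by (metis less_irrefl less_trans)
        then have "S (M + 1) i \<le> S M i" using IH i by auto
        moreover have "\<exists>j<i + 1. at y j = M" using True less_add_one by blast
        ultimately show ?thesis using True less_add_one[of M] unfolding S_Suc by auto
      next
        case False
        then have "at y i < M + 1 \<longleftrightarrow> at y i < M" by (simp add: num_less_Suc le_less)
        then have "S (M + 1) (i + 1) - S M (i + 1) = S (M + 1) i - S M i" unfolding S_Suc by simp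
        then show ?thesis using IH i lt by (smt (verit) diff_le_eq add.commute less_imp_le diff_le_0_iff_le)
      qed
    qed
  qed (use E S_0 y in \<open>auto simp: rv_S simp flip: not_less\<close>)
  \<comment> \<open>The reserve \<open>2 * eps (m + k)\<close> halves when \<open>k\<close> grows by
    one, and the amount released is \<open>eps (m + k)\<close>, just the gain allowed by
    \<open>one_more\<close>. What is left of the reserve makes the final bound strict.\<close>
  have upper: "S (m + k) L + 2 * eps (m + k) \<le> 2 * eps m" for k
  proof (rule num_induct[where e="push T0 (num m) ?E" and P="\<lambda>k. S (m + k) L + 2 * eps (m + k) \<le> 2 * eps m"
        and A="?S 3 (vN 1 +\<^sub>N vN 0) (vN 2) +\<^sub>Q qeps2 (vN 1 +\<^sub>N vN 0) \<le>\<^sub>Q qeps2 (vN 1)"])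
    show "S (m + 0) L + 2 * eps (m + 0) \<le> 2 * eps m" using below[of L] by simp
    show "S (m + (k + 1)) L + 2 * eps (m + (k + 1)) \<le> 2 * eps m" if "S (m + k) L + 2 * eps (m + k) \<le> 2 * eps m" for k
    proof -
      have "S (m + k + 1) L \<le> S (m + k) L + eps (m + k)"
        using one_more[of L "m + k"] eps_pos[of "m + k"] by (smt (verit) order_refl add_increasing2 less_imp_le order_trans)
      then show ?thesis using that unfolding add.assoc[symmetric] eps_values(2) by simp
    qed
  qed (use E in \<open>simp_all add: rv_S not_less\<close>)
  obtain M where M: "\<And>i. i < L \<Longrightarrow> at y i < M" using num_ex_bound[OF y] by metis
  \<comment> \<open>All exponents are smaller than \<open>M\<close>, so the cut-off at
    \<open>m + M\<close> removes no term and the truncated sum dominates the full one.\<close>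
  have all: "i \<le> L \<longrightarrow> qv (rec f z i) \<le> S (m + M) i" for i
  proof (rule num_induct[where e="push T2f f (push T0 (num (m + M)) ?E)" and P="\<lambda>i. i \<le> L \<longrightarrow> qv (rec f z i) \<le> S (m + M) i"
        and A="\<not>\<^sub>f vN 2 <\<^sub>N vN 0 \<longrightarrow>\<^sub>f recN (Var T2f 0) (vN 3) (vN 0) \<le>\<^sub>Q ?S 3 (vN 1) (vN 0)"])
    show "i + 1 \<le> L \<longrightarrow> qv (rec f z (i + 1)) \<le> S (m + M) (i + 1)" if "i \<le> L \<longrightarrow> qv (rec f z i) \<le> S (m + M) i" for i
    proof
      assume "i + 1 \<le> L"
      then have "i < L" by (meson less_add_one less_le_trans)
      moreover have "at y i < m + M" using M[OF \<open>i < L\<close>] by (simp add: add_strict_increasing2)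
      ultimately show "qv (rec f z (i + 1)) \<le> S (m + M) (i + 1)" using that unfolding S_Suc f_Suc by simp
    qed
  qed (use E f z S_0 in \<open>simp_all add: rv_S not_less rv_def[of _ "recN (Var T2f 0) _ _"]\<close>)
  show "qv (rec f z L) < 2 * eps m"
    using all[of L, THEN mp, OF order_refl] upper[of M] eps_pos[of "m + M"] by linarith
qed

subsection \<open>The unordered sum of an injection\<close>

lemma T1_ext: "f \<in> D T1 \<Longrightarrow> g \<in> D T1 \<Longrightarrow> (\<And>n. at f n = at g n) \<Longrightarrow> f = g"
proof (rule app_ext[of _ T0 T0])
  fix d assume fg: "f \<in> D T1" "g \<in> D T1" and eq: "\<And>n. at f n = at g n" and d: "d \<in> D T0"
  obtain n where "d = num n" using d range_num by blast
  then show "app f d = app g d" using fg eq by (simp add: num_at)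
qed

text \<open>The available case distinction is between numbers, so the choice between the old entries
  and \<open>x\<close> is made value by value; extensionality turns this into identity of the
  entries.\<close>

lemma append_real:
  assumes u: "u \<in> D TW" and x: "x \<in> D T1"
  obtains u' where "u' \<in> D TW" "\<And>i. i < k \<Longrightarrow> app u' (num i) = app u (num i)" "app u' (num k) = x"
proof -
  define u' where "u' = eval (push T1 x (push TW u (push T0 (num k) e0)))
    (lam2 (ifzero (vN 2 -\<^sub>N vN 1) (Var T1 0 \<cdot> vN 0) (Var TW 0 \<cdot> vN 1 \<cdot> vN 0)))"
  have u': "u' \<in> D TW" using u x by (simp add: u'_def)
  have at: "at (app u' (num i)) n = (if k \<le> i then at x n else at (app u (num i)) n)" for i n
    using u x by (simp add: u'_def diff_eq_0_iff)
  show thesis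
  proof (rule that[OF u'])
    show "app u' (num i) = app u (num i)" if "i < k" for i
      by (rule T1_ext) (use u u' at that in \<open>simp_all add: not_le[symmetric]\<close>)
    show "app u' (num k) = x"
      by (rule T1_ext) (use x u' at in simp_all)
  qed
qed

context
  fixes Y
  assumes Y: "Y \<in> D TY"
    and Y_ext: "\<And>x y. x \<in> D T1 \<Longrightarrow> y \<in> D T1 \<Longrightarrow> In01 x \<Longrightarrow> In01 y \<Longrightarrow> EqR x y \<Longrightarrow> atY Y x = atY Y y"
    and Y_inj: "\<And>x y. x \<in> D T1 \<Longrightarrow> y \<in> D T1 \<Longrightarrow> In01 x \<Longrightarrow> In01 y \<Longrightarrow> atY Y x = atY Y y \<Longrightarrow> EqR x y"
begin

text \<open>The induction formula quantifies over reals and sequences of reals, which full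
  \<open>IND\<close> permits. If some real has value exactly \<open>m\<close>, one such real is
  appended; by injectivity it represents all of them up to equality of reals.\<close>

lemma finite_preimage:
  obtains k u where "u \<in> D TW" "Fin k u"
    "\<And>x. x \<in> D T1 \<Longrightarrow> In01 x \<Longrightarrow> atY Y x < m \<Longrightarrow> \<exists>i<k. EqR (app u (num i)) x"
proof -
  \<comment> \<open>The clause on the values of the entries strengthens the induction: a new entry
    of value \<open>m\<close> then differs from all old ones, because \<open>Y\<close> respects
    equality of reals.\<close>
  let ?P = "\<lambda>m k u. Fin k u \<and> (\<forall>i<k. atY Y (app u (num i)) < m) \<and>
    (\<forall>x \<in> D T1. In01 x \<longrightarrow> atY Y x < m \<longrightarrow> (\<exists>i<k. EqR (app u (num i)) x))"
  have "\<exists>k. \<exists>u \<in> D TW. ?P m k u"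
  proof (rule num_induct[where e="push TY Y e0" and P="\<lambda>m. \<exists>k. \<exists>u \<in> D TW. ?P m k u"
        and A="Exists T0 (Exists TW (fin01 (vN 0) (Var TW 0) \<and>\<^sub>f
          Forall T0 (vN 0 <\<^sub>N vN 1 \<longrightarrow>\<^sub>f Var TY 0 \<cdot> (Var TW 0 \<cdot> vN 0) <\<^sub>N vN 2) \<and>\<^sub>f
          Forall T1 (in01 (Var T1 0) \<longrightarrow>\<^sub>f Var TY 0 \<cdot> Var T1 0 <\<^sub>N vN 1 \<longrightarrow>\<^sub>f
            Exists T0 (vN 0 <\<^sub>N vN 1 \<and>\<^sub>f Var TW 0 \<cdot> vN 0 =\<^sub>R Var T1 0))))"])
    show "\<exists>k. \<exists>u \<in> D TW. ?P 0 k u"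
      using D_nonempty[of TW] by (auto simp: Fin_def intro!: exI[of _ 0])
    show "\<exists>k. \<exists>u \<in> D TW. ?P (m + 1) k u" if IH: "\<exists>k. \<exists>u \<in> D TW. ?P m k u" for m
    proof -
      obtain k u where u: "u \<in> D TW" and P: "?P m k u" using IH by blast
      have less_cases: "i < n + 1 \<Longrightarrow> i < n \<or> i = n" for i n :: 'n
        by (simp add: num_less_Suc le_less)
      have lt: "i < n + 1" if "i < n" for i n :: 'n using that less_add_one by (rule less_trans)
      show ?thesis
      proof (cases "\<exists>x \<in> D T1. In01 x \<and> atY Y x = m")
        case False
        have "?P (m + 1) k u"
          using P False less_cases lt by blast
        then show ?thesis using u by blast
      next
        case True
        then obtain x where x: "x \<in> D T1" "In01 x" "atY Y x = m" by blast
        obtain u' where u': "u' \<in> D TW" "\<And>i. i < k \<Longrightarrow> app u' (num i) = app u (num i)" "app u' (num k) = x"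
          using append_real[OF u x(1)] by metis
        have old: "In01 (app u' (num i))" "atY Y (app u' (num i)) < m" if "i < k" for i
          using P that u'(2) by (auto simp: Fin_def)
        have new: "\<not> EqR (app u' (num i)) x" if "i < k" for i
          using Y_ext[of "app u' (num i)" x] old[OF that] x u'(1) by auto
        have new': "\<not> EqR x (app u' (num i))" if "i < k" for i
          using new[OF that] EqR_sym by blast
        have "\<not> EqR (app u' (num i)) (app u' (num j))" if "i < k" "j < k" "i \<noteq> j" for i j
          using P that u'(2) by (simp add: Fin_def)
        then have "Fin (k + 1) u'"
          using old new new' x u'(3) unfolding Fin_def by (metis less_cases)
        moreover have "\<forall>i<k + 1. atY Y (app u' (num i)) < m + 1"
          using old(2) x u'(3) less_cases lt by (metis less_add_one)
        moreover have "\<exists>i<k + 1. EqR (app u' (num i)) x'" if x': "x' \<in> D T1" "In01 x'" "atY Y x' < m + 1" for x'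
        proof (cases "atY Y x' = m")
          case True
          then show ?thesis using Y_inj[of x x'] x x' u'(3) less_add_one by metis
        next
          case False
          then show ?thesis using P x' u'(2) less_cases lt by metis
        qed
        ultimately show ?thesis using u'(1) by blast
      qed
    qed
  qed (use Y in \<open>simp_all\<close>)
  then show thesis using that by blast
qed

text \<open>A rational weight is coded by a constant sequence, so that the approximations to its
  sums carry no error.\<close>

definition wgt :: 'd where
  "wgt = eval (push TY Y e0) (lam T1 (lam T0 (qeps (Var TY 0 \<cdot> Var T1 0))))"

lemma wgt: "wgt \<in> D TA" "x \<in> D T1 \<Longrightarrow> rx (app wgt x) n = eps (atY Y x)"
  using Y by (simp_all add: wgt_def)

lemma injection_impossible: "valid e \<Longrightarrow> \<not> sat e SUM_stmt"
proof
  assume e: "valid e" and SUM: "sat e SUM_stmt"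
  let ?e = "push TA wgt e"
  have "sat ?e (realfun01 (Var TA 0))"
  proof -
    have "IsR (app wgt x)" if "x \<in> D T1" for x
      using that by (simp add: IsR_def wgt)
    moreover have "EqR (app wgt x) (app wgt y)" if "x \<in> D T1" "y \<in> D T1" "In01 x" "In01 y" "EqR x y" for x y
      unfolding EqR_def wgt(2)[OF that(1)] wgt(2)[OF that(2)] Y_ext[OF that] by simp
    ultimately show ?thesis using e wgt(1) by simp
  qed
  moreover have "sat ?e (nonneg01 (Var TA 0))"
  proof -
    have "- eps i \<le> 2 * eps n" for i n using eps_pos[of i] eps_pos[of n] by linarith
    then show ?thesis using e wgt by simp
  qed
  moreover have "sat ?e (Cauchy_sum (Var TA 0))"
  proof -
    have "\<exists>k. \<exists>u \<in> D TW. Fin k u \<and> (\<forall>l. \<forall>w \<in> D TW. Fin l w \<longrightarrow> Disj k u l w \<longrightarrow>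
      (\<exists>n. 2 * eps n < rx \<epsilon> n - \<bar>rx (eval (push TW w (push T0 (num l) (push TW u (push T0 (num k) (push T1 \<epsilon> ?e)))))
        (rsum (Var TA 0) (vN 0) (Var TW 0))) n\<bar>))"
      if \<epsilon>: "\<epsilon> \<in> D T1" "IsR \<epsilon>" "2 * eps m < rx \<epsilon> m" for \<epsilon> m
    proof -
      \<comment> \<open>The cut-off \<open>m + 2\<close> comes from
        \<open>2 * eps m < rx \<epsilon> m\<close>: at index \<open>m + 2\<close> the approximation
        to \<open>\<epsilon>\<close> still exceeds \<open>eps m\<close>, that is
        \<open>4 * eps (m + 2)\<close>. The sum takes less than half of this, and the other half is
        the margin that strict order of reals asks for at that index.\<close>
      obtain k u where u: "u \<in> D TW" "Fin k u"
        "\<And>x. x \<in> D T1 \<Longrightarrow> In01 x \<Longrightarrow> atY Y x < m + 1 + 1 \<Longrightarrow> \<exists>i<k. EqR (app u (num i)) x"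
        using finite_preimage[of "m + 1 + 1"] by metis
      have "\<exists>n. 2 * eps n < rx \<epsilon> n - \<bar>rx (eval (push TW w (push T0 (num l) (push TW u (push T0 (num k) (push T1 \<epsilon> ?e)))))
        (rsum (Var TA 0) (vN 0) (Var TW 0))) n\<bar>" if w: "w \<in> D TW" "Fin l w" "Disj k u l w" for l w
      proof -
        let ?n = "m + 1 + 1"
        let ?e' = "push TW w (push T0 (num l) (push TW u (push T0 (num k) (push T1 \<epsilon> ?e))))"
        have e': "valid ?e'" using e wgt u w \<epsilon> by simp
        obtain f z where f: "f \<in> D T2f" "qv z = 0"
          "\<And>i s. qv (at2 f i s) = qv s + rx (app wgt (app w (num i))) (?n + l)"
          "rx (eval ?e' (rsum (Var TA 0) (vN 0) (Var TW 0))) ?n = qv (rec f z l)"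
          using rx_rsum[OF e', of "Var TA 0" "vN 0" "Var TW 0" ?n] by auto
        \<comment> \<open>The exponents of the weights as an object of type 1, the form in which
          \<open>distinct_powers_sum\<close> takes them.\<close>
        define y where "y = eval (push TY Y (push TW w e0)) (lam T0 (Var TY 0 \<cdot> (Var TW 0 \<cdot> vN 0)))"
        have y: "y \<in> D T1" "\<And>i. at y i = atY Y (app w (num i))" using Y w by (simp_all add: y_def)
        have in01: "In01 (app w (num i))" if "i < l" for i using w(2) that by (simp add: Fin_def)
        have "?n \<le> at y i" if i: "i < l" for i
        proof (rule ccontr)
          assume "\<not> ?n \<le> at y i"
          then obtain j where "j < k" "EqR (app u (num j)) (app w (num i))"
            using u(3)[of "app w (num i)"] in01[OF i] w(1) y(2) by (auto simp: not_le)
          then show False using w(3) i by (auto simp: Disj_def)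
        qed
        moreover have "i = j" if "i < l" "j < l" "at y i = at y j" for i j
          using w(1,2) Y_inj[of "app w (num i)" "app w (num j)"] in01 that y(2) by (auto simp: Fin_def)
        ultimately have "0 \<le> qv (rec f z l)" "qv (rec f z l) < 2 * eps ?n"
          using distinct_powers_sum[OF y(1) f(1,2), of l ?n] f(3) wgt(2) w(1) y(2) by auto
        moreover have "\<bar>rx \<epsilon> m - rx \<epsilon> (m + (1 + 1))\<bar> < eps m"
          using \<epsilon>(2) unfolding IsR_def by blast
        then have "rx \<epsilon> m - eps m < rx \<epsilon> ?n" unfolding add.assoc by linarith
        ultimately have "2 * eps ?n < rx \<epsilon> ?n - \<bar>qv (rec f z l)\<bar>"
          using \<epsilon>(3) unfolding eps_values(2) by linarith
        then show ?thesis using f(4) by metis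
      qed
      then show ?thesis using u(1,2) by blast
    qed
    moreover have "lift T1 (lift T0 (lift TW (lift T0 (lift TW (Var TA 0))))) = Var TA 0"
      by (simp add: shiftv_def)
    ultimately show ?thesis using e wgt(1) by (auto simp only: sat_Cauchy_sum valid_push wt.simps tyof.simps)
  qed
  ultimately have "sat ?e (Exists TW (Forall T0 (in01 (Var TW 0 \<cdot> vN 0)) \<and>\<^sub>f
      Forall T1 (in01 (Var T1 0) \<longrightarrow>\<^sub>f Forall T0 (\<not>\<^sub>f Var T1 0 =\<^sub>R Var TW 0 \<cdot> vN 0) \<longrightarrow>\<^sub>f Var TA 0 \<cdot> Var T1 0 =\<^sub>R 0\<^sub>R)))"
    using SUM wgt(1) unfolding SUM_stmt_def Let_def sat.simps by blast
  then have "\<exists>y \<in> D TW. (\<forall>i. In01 (app y (num i))) \<and>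
      (\<forall>z \<in> D T1. In01 z \<longrightarrow> (\<forall>i. \<not> EqR z (app y (num i))) \<longrightarrow> (\<forall>n. \<bar>rx (app wgt z) n\<bar> \<le> 2 * eps n))"
    using e wgt(1) by simp blast
  then obtain y where y: "y \<in> D TW" "\<And>i. In01 (app y (num i))"
    "\<And>z. z \<in> D T1 \<Longrightarrow> In01 z \<Longrightarrow> (\<And>i. \<not> EqR z (app y (num i))) \<Longrightarrow>
      (\<forall>n. \<bar>rx (app wgt z) n\<bar> \<le> 2 * eps n)"
    by blast
  obtain x where x: "x \<in> D T1" "In01 x" "\<And>i. \<not> EqR x (app y (num i))"
    using diagonal[OF y(1)] by metis
  \<comment> \<open>At this index, equality with 0 as a real would make the weight
    \<open>eps (atY Y x)\<close> at most half of itself.\<close>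
  have "\<bar>rx (app wgt x) (atY Y x + 1 + 1)\<bar> \<le> 2 * eps (atY Y x + 1 + 1)" using y(3) x by blast
  then have "eps (atY Y x) \<le> 2 * eps (atY Y x + 1 + 1)"
    using x(1) by (simp only: wgt(2) abs_of_pos eps_pos)
  then show False using eps_pos[of "atY Y x"] unfolding eps_values(2) by linarith
qed

end

theorem SUM_implies_NIN:
  assumes e: "valid e"
  shows "sat e (SUM_stmt \<longrightarrow>\<^sub>f NIN)"
proof -
  have "sat e NIN" if SUM: "sat e SUM_stmt"
  proof (rule ccontr)
    assume "\<not> sat e NIN"
    then obtain Y where "Y \<in> D TY"
      "\<And>x y. x \<in> D T1 \<Longrightarrow> y \<in> D T1 \<Longrightarrow> In01 x \<Longrightarrow> In01 y \<Longrightarrow> EqR x y \<Longrightarrow> atY Y x = atY Y y"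
      "\<And>x y. x \<in> D T1 \<Longrightarrow> y \<in> D T1 \<Longrightarrow> In01 x \<Longrightarrow> In01 y \<Longrightarrow> atY Y x = atY Y y \<Longrightarrow> EqR x y"
      using e by (fastforce simp: NIN_def Let_def)
    then show False using injection_impossible[OF _ _ _ e] SUM by blast
  qed
  then show ?thesis by simp
qed

end

section \<open>A type of numbers for a countermodel\<close>

type_synonym 'd num_str = "'d set \<times> 'd \<times> 'd \<times> ('d \<Rightarrow> 'd \<Rightarrow> 'd) \<times> ('d \<Rightarrow> 'd \<Rightarrow> 'd) \<times> ('d \<Rightarrow> 'd \<Rightarrow> bool)"

text \<open>The laws behind \<open>linordered_semidom\<close> relative to a carrier set, with the
  existence of differences in place of a subtraction.\<close>

definition is_num :: "'d num_str \<Rightarrow> bool" where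
  "is_num N \<longleftrightarrow> (case N of (C, z, u, p, t, l) \<Rightarrow> z \<in> C \<and> u \<in> C \<and> l z u \<and>
    (\<forall>x \<in> C. \<not> l x x \<and> p x z = x \<and> t x u = x \<and> t x z = z \<and> (x = z \<or> l z x)) \<and>
    (\<forall>x \<in> C. \<forall>y \<in> C. p x y \<in> C \<and> t x y \<in> C \<and> p x y = p y x \<and> t x y = t y x \<and>
      (l x y \<or> x = y \<or> l y x) \<and> (l x y \<longrightarrow> (\<exists>c \<in> C. y = p x c))) \<and>
    (\<forall>x \<in> C. \<forall>y \<in> C. \<forall>w \<in> C. p (p x y) w = p x (p y w) \<and> t (t x y) w = t x (t y w) \<and>
      t x (p y w) = p (t x y) (t x w) \<and> (l x y \<longrightarrow> l y w \<longrightarrow> l x w) \<and>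
      (l x y \<longrightarrow> l (p x w) (p y w)) \<and> (l z w \<longrightarrow> l x y \<longrightarrow> l (t x w) (t y w))))"

definition num_str_of :: "(ty \<Rightarrow> 'd set) \<Rightarrow> ('d \<Rightarrow> 'd \<Rightarrow> 'd) \<Rightarrow> (const \<Rightarrow> 'd) \<Rightarrow> ('d \<Rightarrow> 'd \<Rightarrow> bool) \<Rightarrow> 'd num_str" where
  "num_str_of D app con lt = (D T0, con Zero, con One,
    \<lambda>x y. app (app (con Plus) x) y, \<lambda>x y. app (app (con Times) x) y, lt)"

lemma (in omega_model) is_num_model: "is_num (num_str_of D app con lt)"
proof -
  let ?C = "D T0"
  have 1: "lt (con Zero) (con One)"
    using raw_laws(12)[OF con0_D(1) con0_D(1) con0_D(1)] by simp
  have 2: "\<forall>x \<in> ?C. \<not> lt x x \<and> pl x (con Zero) = x \<and> ti x (con One) = x \<and> ti x (con Zero) = con Zero \<and>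
      (x = con Zero \<or> lt (con Zero) x)"
    using raw_laws(9,3,6,7)[OF _ con0_D(1) con0_D(1)] raw_nonneg by (intro ballI conjI)
  have 3: "\<forall>x \<in> ?C. \<forall>y \<in> ?C. pl x y \<in> ?C \<and> ti x y \<in> ?C \<and> pl x y = pl y x \<and> ti x y = ti y x \<and>
      (lt x y \<or> x = y \<or> lt y x) \<and> (lt x y \<longrightarrow> (\<exists>c \<in> ?C. y = pl x c))"
    using pl_D ti_D raw_laws(2,5,11)[OF _ _ con0_D(1)] raw_diff by (intro ballI conjI HOL.impI)
  have 4: "\<forall>x \<in> ?C. \<forall>y \<in> ?C. \<forall>w \<in> ?C. pl (pl x y) w = pl x (pl y w) \<and> ti (ti x y) w = ti x (ti y w) \<and>
      ti x (pl y w) = pl (ti x y) (ti x w) \<and> (lt x y \<longrightarrow> lt y w \<longrightarrow> lt x w) \<and>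
      (lt x y \<longrightarrow> lt (pl x w) (pl y w)) \<and> (lt (con Zero) w \<longrightarrow> lt x y \<longrightarrow> lt (ti x w) (ti y w))"
    using raw_laws(1,4,8,10,13,14) by (intro ballI conjI HOL.impI)
  show ?thesis
    unfolding is_num_def num_str_of_def prod.case by (intro conjI con0_D 1 2 3 4)
qed

text \<open>Supplies the fallback that makes \<open>num_str\<close> satisfy \<open>is_num\<close>
  unconditionally, as the type definition and its class instance require.\<close>

lemma is_num_copy:
  assumes "inj (f :: nat \<Rightarrow> 'd)"
  shows "is_num (range f, f 0, f 1, \<lambda>x y. f (inv f x + inv f y), \<lambda>x y. f (inv f x * inv f y), \<lambda>x y. inv f x < inv f y)"
  using assms by (auto simp: is_num_def inv_f_f inj_eq algebra_simps dest: less_imp_add_positive)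

definition countermodel ::
  "(ty \<Rightarrow> tm set set) \<Rightarrow> (tm set \<Rightarrow> tm set \<Rightarrow> tm set) \<Rightarrow> (const \<Rightarrow> tm set) \<Rightarrow> (tm set \<Rightarrow> tm set \<Rightarrow> bool) \<Rightarrow> bool" where
  "countermodel D app con lt \<longleftrightarrow> is_model (RCA0\<omega> \<union> IND) D app con lt \<and>
    (\<exists>e. type_structure.valid D e \<and> \<not> type_structure.sat D app con lt e (SUM_stmt \<longrightarrow>\<^sub>f NIN))"

text \<open>A type cannot depend on the assumption that the theorem is underivable, so the numbers are
  a copy of the natural numbers if there is no countermodel.\<close>

definition num_str :: "tm set num_str" where
  "num_str = (SOME N. is_num N \<and>
    ((\<exists>D app con lt. countermodel D app con lt) \<longrightarrow>
      (\<exists>D app con lt. countermodel D app con lt \<and> N = num_str_of D app con lt)))"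

lemma omega_model_if_is_model: "is_model (RCA0\<omega> \<union> IND) D app con lt \<Longrightarrow> omega_model D app con lt"
  by (simp add: is_model_def omega_model_def omega_model_axioms_def)

lemma num_str:
  "is_num num_str"
  "countermodel D app con lt \<Longrightarrow> \<exists>D app con lt. countermodel D app con lt \<and> num_str = num_str_of D app con lt"
proof -
  have "\<exists>N. is_num N \<and> ((\<exists>D app con lt. countermodel D app con lt) \<longrightarrow>
      (\<exists>D app con lt. countermodel D app con lt \<and> N = num_str_of D app con lt))"
  proof (cases "\<exists>D app con lt. countermodel D app con lt")
    case True
    then obtain D app con lt where "countermodel D app con lt" by blast
    moreover from this have "is_num (num_str_of D app con lt)"
      unfolding countermodel_def by (intro omega_model.is_num_model omega_model_if_is_model) blast
    ultimately show ?thesis by blast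
  next
    case False
    have "inj (\<lambda>n. {Var T0 n})" by (simp add: inj_def)
    then show ?thesis using False is_num_copy by blast
  qed
  from someI_ex[OF this]
  show "is_num num_str"
    "countermodel D app con lt \<Longrightarrow> \<exists>D app con lt. countermodel D app con lt \<and> num_str = num_str_of D app con lt"
    unfolding num_str_def[symmetric] by blast+
qed

section \<open>The chosen numbers as a type of class \<open>linordered_semidom\<close>\<close>

definition "nC = fst num_str"
definition "nZ = fst (snd num_str)"
definition "nU = fst (snd (snd num_str))"
definition "nP = fst (snd (snd (snd num_str)))"
definition "nT = fst (snd (snd (snd (snd num_str))))"
definition "nL = snd (snd (snd (snd (snd num_str))))"

lemma num_str_eq: "num_str = (nC, nZ, nU, nP, nT, nL)"
  by (simp add: nC_def nZ_def nU_def nP_def nT_def nL_def)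

lemmas num_str_laws = num_str(1)[unfolded num_str_eq is_num_def prod.case]

lemma num_str_const: "nZ \<in> nC" "nU \<in> nC" "nL nZ nU"
  using num_str_laws[THEN conjunct1] num_str_laws[THEN conjunct2, THEN conjunct1]
    num_str_laws[THEN conjunct2, THEN conjunct2, THEN conjunct1] .

lemma num_str_unary:
  assumes "x \<in> nC"
  shows "\<not> nL x x" "nP x nZ = x" "nT x nU = x" "nT x nZ = nZ" "nL nZ x \<or> x = nZ"
  using num_str_laws[THEN conjunct2, THEN conjunct2, THEN conjunct2, THEN conjunct1, THEN bspec, OF assms]
  by blast+

lemma num_str_binary:
  assumes "x \<in> nC" "y \<in> nC"
  shows "nP x y \<in> nC" "nT x y \<in> nC" "nP x y = nP y x" "nT x y = nT y x"
    "nL x y \<or> x = y \<or> nL y x" "nL x y \<Longrightarrow> \<exists>c \<in> nC. y = nP x c"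
  using num_str_laws[THEN conjunct2, THEN conjunct2, THEN conjunct2, THEN conjunct2, THEN conjunct1,
      THEN bspec, THEN bspec, OF assms]
  by blast+

lemma num_str_ternary:
  assumes "x \<in> nC" "y \<in> nC" "w \<in> nC"
  shows "nP (nP x y) w = nP x (nP y w)" "nT (nT x y) w = nT x (nT y w)" "nT x (nP y w) = nP (nT x y) (nT x w)"
    "nL x y \<Longrightarrow> nL y w \<Longrightarrow> nL x w" "nL x y \<Longrightarrow> nL (nP x w) (nP y w)"
    "nL nZ w \<Longrightarrow> nL x y \<Longrightarrow> nL (nT x w) (nT y w)"
  using num_str_laws[THEN conjunct2, THEN conjunct2, THEN conjunct2, THEN conjunct2, THEN conjunct2,
      THEN bspec, THEN bspec, THEN bspec, OF assms]
  by blast+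

typedef natnum = nC
  using num_str_const(1) by (rule exI)

setup_lifting type_definition_natnum

instantiation natnum :: "{zero, one, plus, times, linorder}"
begin

lift_definition zero_natnum :: natnum is nZ by (rule num_str_const)
lift_definition one_natnum :: natnum is nU by (rule num_str_const)
lift_definition plus_natnum :: "natnum \<Rightarrow> natnum \<Rightarrow> natnum" is nP by (rule num_str_binary)
lift_definition times_natnum :: "natnum \<Rightarrow> natnum \<Rightarrow> natnum" is nT by (rule num_str_binary)
lift_definition less_natnum :: "natnum \<Rightarrow> natnum \<Rightarrow> bool" is nL .
definition less_eq_natnum :: "natnum \<Rightarrow> natnum \<Rightarrow> bool" where "less_eq_natnum a b \<longleftrightarrow> a < b \<or> a = b"

instance
proof
  fix x y z :: natnum
  have trans: "x < y \<Longrightarrow> y < z \<Longrightarrow> x < z" for x y z :: natnum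
    by transfer (rule num_str_ternary)
  have irrefl: "\<not> x < x" for x :: natnum
    by transfer (rule num_str_unary)
  have "x < y \<or> x = y \<or> y < x"
    by transfer (rule num_str_binary)
  then show "x \<le> y \<or> y \<le> x" unfolding less_eq_natnum_def by blast
  show "x < y \<longleftrightarrow> x \<le> y \<and> \<not> y \<le> x" unfolding less_eq_natnum_def using trans irrefl by metis
  show "x \<le> x" unfolding less_eq_natnum_def by simp
  show "x \<le> y \<Longrightarrow> y \<le> z \<Longrightarrow> x \<le> z" unfolding less_eq_natnum_def using trans by metis
  show "x \<le> y \<Longrightarrow> y \<le> x \<Longrightarrow> x = y" unfolding less_eq_natnum_def using trans irrefl by metis
qed

end

lemma natnum_laws:
  fixes x y z :: natnum
  shows "x + y + z = x + (y + z)" "x + y = y + x" "x + 0 = x" "x * y * z = x * (y * z)" "x * y = y * x"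
    "x * 1 = x" "x * 0 = 0" "x * (y + z) = x * y + x * z" "x < y \<Longrightarrow> x + z < y + z"
    "0 < z \<Longrightarrow> x < y \<Longrightarrow> x * z < y * z" "(0 :: natnum) < 1" "0 \<le> x"
  unfolding less_eq_natnum_def eq_commute[of 0 x]
  by (transfer; rule num_str_const num_str_unary num_str_binary num_str_ternary; assumption)+

lemma natnum_diff: fixes x y :: natnum assumes "x \<le> y" shows "\<exists>c. y = x + c"
proof (cases "x = y")
  case True
  then show ?thesis using natnum_laws(3) by metis
next
  case False
  then have "x < y" using assms by simp
  then show ?thesis by transfer (unfold Collect_mem_eq, rule num_str_binary)
qed

instantiation natnum :: linordered_semidom
begin

text \<open>The default value 0 yields the truncated subtraction that \<open>num_model\<close>
  assumes.\<close>

definition minus_natnum :: "natnum \<Rightarrow> natnum \<Rightarrow> natnum" where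
  "minus_natnum x y = (if y \<le> x then SOME c. x = y + c else 0)"

lemma natnum_cancel: "z + x \<le> z + y \<longleftrightarrow> x \<le> (y :: natnum)"
  using natnum_laws(9)[of x y z] natnum_laws(9)[of y x z] natnum_laws(2)[of z]
  by (metis leD leI less_eq_natnum_def)

lemma natnum_le_add: "x \<le> x + (y :: natnum)"
  using natnum_cancel[of x 0 y] natnum_laws(3,12) by simp

lemma natnum_add_diff [simp]: "x + y - x = (y :: natnum)"
proof -
  have "c = y" if "x + y = x + c" for c
    using that natnum_cancel by (metis antisym order_refl)
  then show ?thesis
    unfolding minus_natnum_def by (auto simp: natnum_le_add intro!: some_equality)
qed

instance
proof
  fix a b c :: natnum
  show "a + b + c = a + (b + c)" "a + b = b + a" "a * b * c = a * (b * c)" "a * b = b * a" by (rule natnum_laws)+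
  show "0 + a = a" "1 * a = a" "(a + b) * c = a * c + b * c" using natnum_laws by metis+
  show "0 * a = 0" "a * 0 = 0" using natnum_laws by metis+
  show "(0 :: natnum) \<noteq> 1" "(0 :: natnum) < 1" using natnum_laws(11) by auto
  show "a * (b + c) = a * b + a * c" by (rule natnum_laws)
  show "a + b - a = b" by simp
  have zero: "x - y = 0" if "x \<le> y" for x y :: natnum
    using natnum_add_diff[of y 0] that natnum_laws(3)[of y] by (cases "x = y") (auto simp: minus_natnum_def)
  show "a - b - c = a - (b + c)"
  proof (cases "b \<le> a")
    case True
    then obtain d where a: "a = b + d" using natnum_diff by blast
    show ?thesis
    proof (cases "c \<le> d")
      case True
      then obtain e where "d = c + e" using natnum_diff by blast
      then have "a = (b + c) + e" using a natnum_laws(1) by simp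
      then show ?thesis using \<open>d = c + e\<close> a by (metis natnum_add_diff)
    next
      case False
      then show ?thesis using a zero[of d c] zero[of a "b + c"] by (simp add: natnum_cancel)
    qed
  next
    case False
    then have "a \<le> b" by simp
    moreover have "b \<le> b + c" by (rule natnum_le_add)
    ultimately show ?thesis using zero[of a b] zero[of 0 c] zero[of a "b + c"] natnum_laws(12) by simp
  qed
  show "a * (b - c) = a * b - a * c"
  proof (cases "c \<le> b")
    case True
    then obtain d where "b = c + d" using natnum_diff by blast
    then show ?thesis using natnum_laws(8) by simp
  next
    case False
    then have "b \<le> c" by simp
    then obtain d where "c = b + d" using natnum_diff by blast
    then have "a * b \<le> a * c" using natnum_laws(8) natnum_le_add by simp
    then show ?thesis using \<open>b \<le> c\<close> zero natnum_laws(7) by simp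
  qed
  show "a * b \<noteq> 0" if "a \<noteq> 0" "b \<noteq> 0"
    using natnum_laws(10)[of b 0 a] natnum_laws(5,7,12) that by (metis less_eq_natnum_def less_irrefl)
  show "c + a \<le> c + b" if "a \<le> b" using that by (simp add: natnum_cancel)
  show "c * a < c * b" if "a < b" "0 < c"
    using natnum_laws(10)[OF that(2,1)] natnum_laws(5) by simp
  show "a - b + b = a" if "b \<le> a"
    using natnum_diff[OF that] natnum_laws(2) by (metis natnum_add_diff)
qed

end

lemma natnum_diff_eq_0: "a \<le> b \<Longrightarrow> a - b = (0 :: natnum)"
  using natnum_add_diff[of b 0] by (cases "a = b") (auto simp: minus_natnum_def)

theorem theorem3p10:
  shows "RCA0\<omega> \<union> IND \<turnstile> SUM_stmt \<longrightarrow>\<^sub>f NIN"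
proof (rule ccontr)
  assume unprovable: "\<not> (RCA0\<omega> \<union> IND \<turnstile> SUM_stmt \<longrightarrow>\<^sub>f NIN)"
  have wff: "wff (SUM_stmt \<longrightarrow>\<^sub>f NIN)"
    by (simp add: SUM_stmt_def NIN_def Let_def)
  obtain D0 app0 con0 lt0 e0 where "is_model (RCA0\<omega> \<union> IND) (D0 :: ty \<Rightarrow> tm set set) app0 con0 lt0"
    "type_structure.valid D0 e0" "\<not> type_structure.sat D0 app0 con0 lt0 e0 (SUM_stmt \<longrightarrow>\<^sub>f NIN)"
    by (rule completeness[OF Un_upper1 wff unprovable])
  then have "countermodel D0 app0 con0 lt0" unfolding countermodel_def by (intro conjI exI)
  \<comment> \<open>The countermodel found by completeness may differ from the one whose numbers
    became \<open>natnum\<close>. Its existence ensures that \<open>num_str\<close> stems from some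
    countermodel, and the argument is carried out in that one.\<close>
  then obtain D app con lt where model: "countermodel D app con lt" and eq: "num_str = num_str_of D app con lt"
    using num_str(2) by blast
  have "nC = D T0" "nZ = con Zero" "nU = con One" "nP = (\<lambda>x y. app (app (con Plus) x) y)"
    "nT = (\<lambda>x y. app (app (con Times) x) y)" "nL = lt"
    using eq unfolding num_str_eq num_str_of_def by auto
  note parts = this
  interpret M: omega_model D app con lt
    using model unfolding countermodel_def by (blast intro: omega_model_if_is_model)
  interpret M: num_model D app con lt Rep_natnum
  proof
    show "range Rep_natnum = D T0"
      using type_definition.Rep_range[OF type_definition_natnum] parts(1) by simp
    show "Rep_natnum a = Rep_natnum b \<longleftrightarrow> a = b" for a b by (rule Rep_natnum_inject)
    show "con Zero = Rep_natnum 0" "con One = Rep_natnum 1"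
      using parts zero_natnum.rep_eq one_natnum.rep_eq by simp_all
    show "M.pl (Rep_natnum a) (Rep_natnum b) = Rep_natnum (a + b)"
      "M.ti (Rep_natnum a) (Rep_natnum b) = Rep_natnum (a * b)" for a b
      unfolding plus_natnum.rep_eq times_natnum.rep_eq parts by (rule refl)+
    show "lt (Rep_natnum a) (Rep_natnum b) \<longleftrightarrow> a < b" for a b
      using parts by (simp add: less_natnum.rep_eq)
    show "a - b = 0" if "a \<le> b" for a b :: natnum
      using that by (rule natnum_diff_eq_0)
  qed
  show False
    using model M.SUM_implies_NIN unfolding countermodel_def by blast
qed

end
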